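(* Let $M$ be a smooth manifold and $\Theta\in\Omega^n(M)$. Let $\alpha\in\Omega^{n-p}(M)$ and $\beta\in\Omega^{n-q}(M)$ be conformal Hamiltonian forms and let $X_\alpha\in\mathfrak{X}^p(M)$, $V_\alpha\in\mathfrak{X}^{p-1}(M)$, $X_\beta\in\mathfrak{X}^q(M)$, $V_\beta\in\mathfrak{X}^{q-1}(M)$ be multivector fields satisfying $$\iota_{X_\alpha}\Theta=-\alpha,\qquad \iota_{X_\alpha}d\Theta=(-1)^{p+1}(d\alpha+\iota_{V_\alpha}\Theta),$$ $$\iota_{X_\beta}\Theta=-\beta,\qquad \iota_{X_\beta}d\Theta=(-1)^{q+1}(d\beta+\iota_{V_\beta}\Theta).$$ Then the expression $-\iota_{[X_\alpha,X_\beta]}\Theta$ depends only on $\alpha$ and $\beta$ (not on the choice of $X_\alpha,V_\alpha,X_\beta,V_\beta$), and it is also a conformal Hamiltonian form.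
   Context: $\mathfrak{X}^p(M)=\Gamma(\bigwedge^p TM)$ is the space of multivector fields of degree $p$; $\mathfrak{X}^0(M)=C^\infty(M)$. Conventions: $\iota_{U\wedge V}=\iota_V\iota_U$; for $U\in\mathfrak{X}^p(M)$ the Lie derivative is $\mathcal{L}_U\alpha=d\iota_U\alpha-(-1)^p\iota_U d\alpha$; the Schouten--Nijenhuis bracket of $U\in\mathfrak{X}^p(M)$, $V\in\mathfrak{X}^q(M)$ has degree $p+q-1$ and is normalized by $\iota_{[U,V]}=(-1)^{(p-1)q}\mathcal{L}_U\iota_V-\iota_V\mathcal{L}_U$ on forms. Forms of negative degree are zero. For $1\le p\le n$, $X\in\mathfrak{X}^p(M)$ is an infinitesimal conformal transformation of $\Theta$ if there is $V\in\mathfrak{X}^{p-1}(M)$ with $\mathcal{L}_X\Theta=\iota_V\Theta$. A form $\alpha\in\Omega^{n-p}(M)$ is conformal Hamiltonian if $\iota_{X_\alpha}\Theta=-\alpha$ for some infinitesimal conformal transformation $X_\alpha\in\mathfrak{X}^p(M)$; equivalently, if there are $X_\alpha\in\mathfrak{X}^p(M)$, $V_\alpha\in\mathfrak{X}^{p-1}(M)$ with $\iota_{X_\alpha}\Theta=-\alpha$ and $\iota_{X_\alpha}d\Theta=(-1)^{p+1}(d\alpha+\iota_{V_\alpha}\Theta)$. *)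

theory Defs
  imports "HOL-Analysis.Analysis" "HOL-Library.Function_Algebras"
begin

section \<open>Smooth maps\<close>

primrec Ck_on :: "nat \<Rightarrow> 'a::real_normed_vector set \<Rightarrow> ('a \<Rightarrow> 'b::real_normed_vector) \<Rightarrow> bool" where
  "Ck_on 0 S f \<longleftrightarrow> continuous_on S f"
| "Ck_on (Suc k) S f \<longleftrightarrow>
     (\<forall>x\<in>S. f differentiable (at x)) \<and> (\<forall>v. Ck_on k S (\<lambda>x. frechet_derivative f (at x) v))"

text \<open>Only used for open sets in finite-dimensional spaces, where it is the usual notion.\<close>

definition smooth_on :: "'a::real_normed_vector set \<Rightarrow> ('a \<Rightarrow> 'b::real_normed_vector) \<Rightarrow> bool" where
  "smooth_on S f \<longleftrightarrow> (\<forall>k. Ck_on k S f)"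

section \<open>Smooth manifolds\<close>

text \<open>A chart \<open>(U, \<phi>)\<close> consists of its domain and its coordinate map (irrelevant outside \<open>U\<close>).\<close>

type_synonym ('m, 'e) chart = "'m set \<times> ('m \<Rightarrow> 'e)"

definition transition :: "('m, 'e) chart \<Rightarrow> ('m, 'e) chart \<Rightarrow> 'e \<Rightarrow> 'e" where
  "transition c d = snd d \<circ> inv_into (fst c) (snd c)"

text \<open>
  The manifold is the whole type \<open>'m\<close> (Hausdorff and second countable by its sort), with an atlas
  that need not be maximal. The model space is a finite-dimensional inner product space; the class
  \<open>euclidean_space\<close> is not used because it would exclude dimension 0.
\<close>

definition smooth_manifold ::
    "('m::{t2_space,second_countable_topology}, 'e::real_inner) chart set \<Rightarrow> bool" where
  "smooth_manifold A \<longleftrightarrow>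
     (\<exists>B::'e set. finite B \<and> span B = UNIV) \<and>
     (\<Union>c\<in>A. fst c) = UNIV \<and>
     (\<forall>c\<in>A. open (fst c) \<and> open (snd c ` fst c) \<and>
        homeomorphism (fst c) (snd c ` fst c) (snd c) (inv_into (fst c) (snd c))) \<and>
     (\<forall>c\<in>A. \<forall>d\<in>A. smooth_on (snd c ` (fst c \<inter> fst d)) (transition c d))"

section \<open>Tangent spaces, covectors and multivectors at a point\<close>

text \<open>
  A tangent vector at \<open>x\<close> is given by its coordinates in every chart around \<open>x\<close>, transforming by
  the derivatives of the transition maps; it is 0 at all other arguments.
\<close>

type_synonym ('m, 'e) tvec = "('m, 'e) chart \<Rightarrow> 'e"

definition tangent_space ::
    "('m, 'e::real_normed_vector) chart set \<Rightarrow> 'm \<Rightarrow> ('m, 'e) tvec set" where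
  "tangent_space A x =
     {v. (\<forall>c. \<not> (c \<in> A \<and> x \<in> fst c) \<longrightarrow> v c = 0) \<and>
         (\<forall>c\<in>A. \<forall>d\<in>A. x \<in> fst c \<longrightarrow> x \<in> fst d \<longrightarrow>
            v d = frechet_derivative (transition c d) (at (snd c x)) (v c))}"

text \<open>The tangent vector at \<open>x\<close> whose coordinates in the chart \<open>c\<close> are \<open>u\<close>.\<close>

definition coord_vec ::
    "('m, 'e::real_normed_vector) chart set \<Rightarrow> ('m, 'e) chart \<Rightarrow> 'm \<Rightarrow> 'e \<Rightarrow> ('m, 'e) tvec" where
  "coord_vec A c x u =
     (\<lambda>d. if d \<in> A \<and> x \<in> fst d
          then frechet_derivative (transition c d) (at (snd c x)) u else 0)"

text \<open>
  Alternating \<open>k\<close>-linear forms on the tangent space, as functions on lists that vanish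
  on all lists other than those of \<open>k\<close> tangent vectors at \<open>x\<close>.
\<close>

type_synonym ('m, 'e) covec = "('m, 'e) tvec list \<Rightarrow> real"

definition covectors ::
    "('m, 'e::real_normed_vector) chart set \<Rightarrow> 'm \<Rightarrow> nat \<Rightarrow> ('m, 'e) covec set" where
  "covectors A x k =
     {\<eta>. (\<forall>vs. \<not> (length vs = k \<and> set vs \<subseteq> tangent_space A x) \<longrightarrow> \<eta> vs = 0) \<and>
         (\<forall>vs i u w a b.
            length vs = k \<and> set vs \<subseteq> tangent_space A x \<and> i < k \<and>
            u \<in> tangent_space A x \<and> w \<in> tangent_space A x \<longrightarrow>
            \<eta> (vs[i := (\<lambda>c. a *\<^sub>R u c + b *\<^sub>R w c)]) = a * \<eta> (vs[i := u]) + b * \<eta> (vs[i := w])) \<and>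
         (\<forall>vs i j. length vs = k \<and> set vs \<subseteq> tangent_space A x \<and> i < j \<and> j < k \<and> vs ! i = vs ! j \<longrightarrow>
            \<eta> vs = 0)}"

text \<open>
  The exterior power \<open>\<Lambda>\<^sup>p T\<^sub>x M\<close> is realised inside the dual of the space of alternating
  \<open>p\<close>-linear forms, as the span of the decomposable elements \<open>v\<^sub>1 \<and> \<dots> \<and> v\<^sub>p\<close>, i.e. of
  the evaluations \<open>\<eta> \<mapsto> \<eta> (v\<^sub>1, \<dots>, v\<^sub>p)\<close>.
\<close>

type_synonym ('m, 'e) mvec = "('m, 'e) covec \<Rightarrow> real"

definition wedge ::
    "('m, 'e::real_normed_vector) chart set \<Rightarrow> 'm \<Rightarrow> ('m, 'e) tvec list \<Rightarrow> ('m, 'e) mvec" where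
  "wedge A x vs = (\<lambda>\<eta>. if \<eta> \<in> covectors A x (length vs) then \<eta> vs else 0)"

definition multivectors ::
    "('m, 'e::real_normed_vector) chart set \<Rightarrow> 'm \<Rightarrow> nat \<Rightarrow> ('m, 'e) mvec set" where
  "multivectors A x p =
     {U. \<exists>(m::nat) a vs. (\<forall>i<m. length (vs i) = p \<and> set (vs i) \<subseteq> tangent_space A x) \<and>
           U = (\<lambda>\<eta>. \<Sum>i<m. a i * wedge A x (vs i) \<eta>)}"

section \<open>Differential forms and multivector fields\<close>

type_synonym ('m, 'e) form = "'m \<Rightarrow> ('m, 'e) covec"
type_synonym ('m, 'e) mvfield = "'m \<Rightarrow> ('m, 'e) mvec"

text \<open>The coordinate expression of a form in the chart \<open>c\<close>.\<close>

definition local_form ::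
    "('m, 'e::real_normed_vector) chart set \<Rightarrow> ('m, 'e) chart \<Rightarrow> ('m, 'e) form \<Rightarrow>
     'e \<Rightarrow> 'e list \<Rightarrow> real" where
  "local_form A c \<omega> y us =
     \<omega> (inv_into (fst c) (snd c) y) (map (coord_vec A c (inv_into (fst c) (snd c) y)) us)"

text \<open>The degree is an integer; forms of negative degree are zero.\<close>

definition forms ::
    "('m, 'e::real_normed_vector) chart set \<Rightarrow> int \<Rightarrow> ('m, 'e) form set" where
  "forms A k =
     (if k < 0 then {0}
      else {\<omega>. (\<forall>x. \<omega> x \<in> covectors A x (nat k)) \<and>
               (\<forall>c\<in>A. \<forall>us. length us = nat k \<longrightarrow>
                  smooth_on (snd c ` fst c) (\<lambda>y. local_form A c \<omega> y us))})"

text \<open>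
  Sections of \<open>\<Lambda>\<^sup>p TM\<close> which in every chart are combinations, with smooth coefficients, of
  wedge products of \<open>p\<close> constant coordinate vector fields. For \<open>p = 0\<close> these are the smooth
  functions.
\<close>

definition mvfields ::
    "('m, 'e::real_normed_vector) chart set \<Rightarrow> nat \<Rightarrow> ('m, 'e) mvfield set" where
  "mvfields A p =
     {U. (\<forall>x. U x \<in> multivectors A x p) \<and>
         (\<forall>c\<in>A. \<exists>(m::nat) f us.
            (\<forall>i<m. length (us i) = p \<and> smooth_on (snd c ` fst c) (f i)) \<and>
            (\<forall>x\<in>fst c. U x =
               (\<lambda>\<eta>. \<Sum>i<m. f i (snd c x) * wedge A x (map (coord_vec A c x) (us i)) \<eta>)))}"

definition scale_form :: "real \<Rightarrow> ('m, 'e) form \<Rightarrow> ('m, 'e) form" where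
  "scale_form a \<omega> = (\<lambda>x vs. a * \<omega> x vs)"

text \<open>
  For \<open>U = X\<^sub>1 \<and> \<dots> \<and> X\<^sub>p\<close> this is \<open>\<omega> (X\<^sub>1, \<dots>, X\<^sub>p, _)\<close>, which is the convention
  \<open>\<iota>\<^bsub>U \<and> V\<^esub> = \<iota>\<^sub>V \<iota>\<^sub>U\<close>. For \<open>p = 0\<close> it is multiplication by a function. If the
  degree of \<open>\<omega>\<close> is less than \<open>p\<close>, it is zero.
\<close>

definition int_prod :: "('m, 'e) mvfield \<Rightarrow> ('m, 'e) form \<Rightarrow> ('m, 'e) form" where
  "int_prod U \<omega> = (\<lambda>x vs. U x (\<lambda>ws. \<omega> x (ws @ vs)))"

text \<open>
  The usual coordinate formula
  \<open>d\<omega> (v\<^sub>0, \<dots>, v\<^sub>k) = \<Sum>\<^sub>i (-1)\<^sup>i (D\<^bsub>v\<^sub>i\<^esub> \<omega>) (v\<^sub>0, \<dots>, v\<^bsub>i-1\<^esub>, v\<^bsub>i+1\<^esub>, \<dots>, v\<^sub>k)\<close>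
  in some chart around \<open>x\<close>; it does not depend on the chart.
\<close>

definition ext_deriv ::
    "('m, 'e::real_normed_vector) chart set \<Rightarrow> ('m, 'e) form \<Rightarrow> ('m, 'e) form" where
  "ext_deriv A \<omega> = (\<lambda>x vs.
     if set vs \<subseteq> tangent_space A x then
       let c = (SOME c. c \<in> A \<and> x \<in> fst c); us = map (\<lambda>v. v c) vs in
         \<Sum>i<length us. (-1) ^ i *
           frechet_derivative (\<lambda>y. local_form A c \<omega> y (take i us @ drop (Suc i) us))
             (at (snd c x)) (us ! i)
     else 0)"

text \<open>In what follows the natural numbers \<open>p\<close> and \<open>q\<close> are the degrees of the multivector fields.\<close>

definition lie_deriv ::
    "('m, 'e::real_normed_vector) chart set \<Rightarrow> nat \<Rightarrow> ('m, 'e) mvfield \<Rightarrow>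
     ('m, 'e) form \<Rightarrow> ('m, 'e) form" where
  "lie_deriv A p U \<alpha> =
     ext_deriv A (int_prod U \<alpha>) - scale_form ((-1) ^ p) (int_prod U (ext_deriv A \<alpha>))"

text \<open>
  The sign is \<open>(-1)\<^bsup>(p-1)q\<^esup>\<close>; writing \<open>p + 1\<close> for \<open>p - 1\<close> avoids truncated subtraction at \<open>p = 0\<close>.
\<close>

definition schouten ::
    "('m, 'e::real_normed_vector) chart set \<Rightarrow> nat \<Rightarrow> nat \<Rightarrow>
     ('m, 'e) mvfield \<Rightarrow> ('m, 'e) mvfield \<Rightarrow> ('m, 'e) mvfield" where
  "schouten A p q U V =
     (THE W. W \<in> mvfields A (p + q - 1) \<and>
        (\<forall>k. \<forall>\<omega>\<in>forms A k.
           int_prod W \<omega> = scale_form ((-1) ^ ((p + 1) * q)) (lie_deriv A p U (int_prod V \<omega>))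
                           - int_prod V (lie_deriv A p U \<omega>)))"

section \<open>Conformal Hamiltonian forms\<close>

definition infinitesimal_conformal ::
    "('m, 'e::real_normed_vector) chart set \<Rightarrow> ('m, 'e) form \<Rightarrow> nat \<Rightarrow> ('m, 'e) mvfield \<Rightarrow> bool" where
  "infinitesimal_conformal A \<Theta> p X \<longleftrightarrow>
     1 \<le> p \<and> X \<in> mvfields A p \<and> (\<exists>V\<in>mvfields A (p - 1). lie_deriv A p X \<Theta> = int_prod V \<Theta>)"

text \<open>
  Here \<open>\<Theta>\<close> has degree \<open>n\<close> and \<open>\<alpha>\<close> has degree \<open>n - p\<close>. The bound \<open>p \<le> n\<close> is not imposed, since the
  bracket of fields of degrees \<open>p, q \<le> n\<close> may have degree \<open>p + q - 1 > n\<close>; then \<open>\<alpha>\<close>, being of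
  negative degree, is zero.
\<close>

definition conformal_hamiltonian ::
    "('m, 'e::real_normed_vector) chart set \<Rightarrow> nat \<Rightarrow> ('m, 'e) form \<Rightarrow> nat \<Rightarrow> ('m, 'e) form \<Rightarrow> bool" where
  "conformal_hamiltonian A n \<Theta> p \<alpha> \<longleftrightarrow>
     \<alpha> \<in> forms A (int n - int p) \<and>
     (\<exists>X. infinitesimal_conformal A \<Theta> p X \<and> int_prod X \<Theta> = - \<alpha>)"

definition conformal_pair ::
    "('m, 'e::real_normed_vector) chart set \<Rightarrow> ('m, 'e) form \<Rightarrow> nat \<Rightarrow> ('m, 'e) form \<Rightarrow>
     ('m, 'e) mvfield \<Rightarrow> ('m, 'e) mvfield \<Rightarrow> bool" where
  "conformal_pair A \<Theta> p \<alpha> X V \<longleftrightarrow>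
     X \<in> mvfields A p \<and> V \<in> mvfields A (p - 1) \<and>
     int_prod X \<Theta> = - \<alpha> \<and>
     int_prod X (ext_deriv A \<Theta>) = scale_form ((-1) ^ (p + 1)) (ext_deriv A \<alpha> + int_prod V \<Theta>)"

end

theory Submission
  imports Defs
begin

text \<open>
  Write \<open>\<iota>\<^sub>X\<Theta> = - \<alpha>\<close> and \<open>\<iota>\<^sub>Y\<Theta> = - \<beta>\<close> with companion fields \<open>V\<close> and \<open>Z\<close>. The second equation of a conformal pair says
  that \<open>\<L>\<^sub>X\<Theta> = \<iota>\<^sub>V\<Theta>\<close> and \<open>\<L>\<^sub>Y\<Theta> = \<iota>\<^sub>Z\<Theta>\<close>. Everything follows from this, from the defining equation
  \<open>\<iota>\<^bsub>[X,Y]\<^esub> = \<plusminus>\<L>\<^sub>X\<iota>\<^sub>Y - \<iota>\<^sub>Y\<L>\<^sub>X\<close>, from \<open>d \<circ> d = 0\<close> and from the graded commutativity of contractions.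

  \<^item> Independence. Expanding \<open>\<iota>\<^bsub>[X,Y]\<^esub>\<Theta>\<close> in one way, \<open>Y\<close> and \<open>Z\<close> enter only through \<open>\<beta>\<close>
    (\<open>bracket_via_left_pair\<close>); in another way, \<open>X\<close> and \<open>V\<close> enter only through \<open>\<alpha>\<close> (\<open>bracket_via_right_pair\<close>).
    So the two pairs can be exchanged one after the other.

  \<^item> Conformality. Since \<open>\<L>\<^bsub>[X,Y]\<^esub>\<close> is the graded commutator of \<open>\<L>\<^sub>X\<close> and \<open>\<L>\<^sub>Y\<close> up to sign, \<open>\<L>\<^bsub>[X,Y]\<^esub>\<Theta>\<close> is the
    contraction of \<open>\<Theta>\<close> with \<open>[X,Z] \<plusminus> [Y,V]\<close> (\<open>schouten_infinitesimal_conformal\<close>).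

  The bulk of the work is to establish the calculus that these arguments use. The Schouten bracket is
  defined as the unique field that satisfies its defining equation on all forms. Existence comes from
  a coordinate formula (\<open>chart_bracket_identity\<close>), where forms are alternating functions of lists of
  vectors and multivector fields are lists of coefficients with constant vectors. Uniqueness, which
  also shows that the local brackets fit together, requires that every covector at a point be a value
  of a global form (\<open>covector_extends\<close>). The exterior derivative, computed in one chart, is the same in all
  charts because it commutes with pullbacks (\<open>chart_d_pullback\<close>). Both this and \<open>d \<circ> d = 0\<close> rest on the
  symmetry of second derivatives (\<open>dderiv_commute\<close>) and one cancellation in alternating sums
  (\<open>altsum_altsum_symmetric\<close>).
\<close>

section \<open>Calculus of smooth maps\<close>

abbreviation dderiv :: "('a::real_normed_vector \<Rightarrow> 'b::real_normed_vector) \<Rightarrow> 'a \<Rightarrow> 'a \<Rightarrow> 'b" where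
  "dderiv f x v \<equiv> frechet_derivative f (at x) v"

lemma dderivI: "(f has_derivative f') (at x) \<Longrightarrow> dderiv f x = f'"
  by (metis frechet_derivative_at)

lemma dderiv_has: "f differentiable (at x) \<Longrightarrow> (f has_derivative dderiv f x) (at x)"
  by (simp add: frechet_derivative_works)

lemma dderiv_linear:
  assumes "f differentiable (at x)"
  shows "dderiv f x (a *\<^sub>R u + b *\<^sub>R w) = a *\<^sub>R dderiv f x u + b *\<^sub>R dderiv f x w"
  using linear_frechet_derivative[OF assms] by (simp add: linear_add linear_scale)

lemma dderiv_cong:
  assumes "open S" "x \<in> S" "\<And>y. y \<in> S \<Longrightarrow> f y = g y" "f differentiable (at x)"
  shows "dderiv g x = dderiv f x"
  using frechet_derivative_transform_within_open[OF assms(4,1,2)] assms(3) by auto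

lemma differentiable_cong:
  assumes "open S" "x \<in> S" "\<And>y. y \<in> S \<Longrightarrow> f y = g y" "f differentiable (at x)"
  shows "g differentiable (at x)"
  using has_derivative_transform_within_open[OF dderiv_has[OF assms(4)] assms(1,2)] assms(3)
  unfolding differentiable_def by auto

lemma Ck_on_cong:
  assumes "open S" "\<And>x. x \<in> S \<Longrightarrow> f x = g x" "Ck_on k S f"
  shows "Ck_on k S g"
  using assms(2,3)
proof (induction k arbitrary: f g)
  case 0
  then show ?case using continuous_on_cong[of S S f g] by auto
next
  case (Suc k)
  have d: "f differentiable (at x)" if "x \<in> S" for x using Suc.prems(2) that by simp
  have 1: "dderiv f x v = dderiv g x v" if "x \<in> S" for x v
    using dderiv_cong[OF assms(1) that Suc.prems(1) d[OF that]] by simp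
  have "Ck_on k S (\<lambda>x. dderiv g x v)" for v
    by (rule Suc.IH[of "\<lambda>x. dderiv f x v"]) (use 1 Suc.prems(2) in auto)
  moreover have "g differentiable (at x)" if "x \<in> S" for x
    by (rule differentiable_cong[OF assms(1) that Suc.prems(1) d[OF that]])
  ultimately show ?case by simp
qed

lemma Ck_on_SucD: "Ck_on (Suc k) S f \<Longrightarrow> Ck_on k S f"
proof (induction k arbitrary: f)
  case 0
  then show ?case
    by (auto intro!: continuous_at_imp_continuous_on differentiable_imp_continuous_within)
next
  case (Suc k)
  then show ?case by (metis Ck_on.simps(2))
qed

lemma Ck_on_const: "Ck_on k S (\<lambda>_. c)"
  by (induction k arbitrary: c) auto

lemma Ck_on_mono: "Ck_on k S f \<Longrightarrow> T \<subseteq> S \<Longrightarrow> Ck_on k T f"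
  by (induction k arbitrary: f) (auto intro: continuous_on_subset)

lemma Ck_on_Un:
  assumes "open S" "open T" "Ck_on k S f" "Ck_on k T f"
  shows "Ck_on k (S \<union> T) f"
  using assms(3,4)
  by (induction k arbitrary: f) (auto intro: continuous_on_open_Un assms(1,2))

lemma Ck_on_add:
  assumes "open S" "Ck_on k S f" "Ck_on k S g"
  shows "Ck_on k S (\<lambda>x. f x + g x)"
  using assms(2,3)
proof (induction k arbitrary: f g)
  case 0
  then show ?case by (auto intro: continuous_intros)
next
  case (Suc k)
  have 1: "dderiv (\<lambda>x. f x + g x) x = (\<lambda>v. dderiv f x v + dderiv g x v)" if "x \<in> S" for x
    by (rule dderivI, intro derivative_intros dderiv_has) (use Suc.prems that in auto)
  have "Ck_on k S (\<lambda>x. dderiv f x v + dderiv g x v)" for v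
    by (rule Suc.IH) (use Suc.prems in auto)
  then have "Ck_on k S (\<lambda>x. dderiv (\<lambda>x. f x + g x) x v)" for v
    by (rule Ck_on_cong[OF assms(1), rotated]) (simp add: 1)
  then show ?case using Suc.prems by simp
qed

lemma Ck_on_bounded_linear:
  assumes "open S" "bounded_linear L" "Ck_on k S f"
  shows "Ck_on k S (\<lambda>x. L (f x))"
  using assms(3)
proof (induction k arbitrary: f)
  case 0
  then show ?case using assms(2) by (auto intro: bounded_linear.continuous_on)
next
  case (Suc k)
  have d: "((\<lambda>x. L (f x)) has_derivative (\<lambda>v. L (dderiv f x v))) (at x)" if "x \<in> S" for x
    by (rule bounded_linear.has_derivative[OF assms(2)], rule dderiv_has)
       (use Suc.prems that in auto)
  have "Ck_on k S (\<lambda>x. L (dderiv f x v))" for v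
    by (rule Suc.IH) (use Suc.prems in auto)
  then have "Ck_on k S (\<lambda>x. dderiv (\<lambda>x. L (f x)) x v)" for v
    by (rule Ck_on_cong[OF assms(1), rotated]) (simp add: dderivI[OF d])
  then show ?case using d by (auto intro: Derivative.differentiableI)
qed

lemma Ck_on_scaleR:
  assumes "open S" "Ck_on k S f" "Ck_on k S g"
  shows "Ck_on k S (\<lambda>x. f x *\<^sub>R g x)"
  using assms(2,3)
proof (induction k arbitrary: f g)
  case 0
  then show ?case by (auto intro: continuous_intros)
next
  case (Suc k)
  have d: "((\<lambda>x. f x *\<^sub>R g x) has_derivative (\<lambda>v. f x *\<^sub>R dderiv g x v + dderiv f x v *\<^sub>R g x)) (at x)"
    if "x \<in> S" for x
    by (intro has_derivative_scaleR dderiv_has) (use Suc.prems that in auto)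
  have "Ck_on k S (\<lambda>x. f x *\<^sub>R dderiv g x v + dderiv f x v *\<^sub>R g x)" for v
    by (intro Ck_on_add assms(1) Suc.IH)
       (use Suc.prems Ck_on_SucD[OF Suc.prems(1)] Ck_on_SucD[OF Suc.prems(2)] in auto)
  then have "Ck_on k S (\<lambda>x. dderiv (\<lambda>x. f x *\<^sub>R g x) x v)" for v
    by (rule Ck_on_cong[OF assms(1), rotated]) (simp add: dderivI[OF d])
  then show ?case using d by (auto intro: Derivative.differentiableI)
qed

lemma Ck_on_sum:
  assumes "open S" "\<And>i. i \<in> I \<Longrightarrow> Ck_on k S (f i)"
  shows "Ck_on k S (\<lambda>x. \<Sum>i\<in>I. f i x)"
proof (cases "finite I")
  case True
  then show ?thesis using assms(2)
    by (induction I) (auto intro: Ck_on_const Ck_on_add assms(1))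
qed (simp add: Ck_on_const)

text \<open>
  Parseval's identity for an orthonormal basis is all that is used of finite dimension below. Stating
  it for the set of basis vectors covers the model spaces of dimension 0 as well.
\<close>

definition frame :: "'a::real_inner set \<Rightarrow> bool" where
  "frame B \<longleftrightarrow> finite B \<and> (\<forall>x. (\<Sum>b\<in>B. (x \<bullet> b) *\<^sub>R b) = x)"

lemma frame_real: "frame {1::real}"
  by (simp add: frame_def)

lemma frame_exists:
  assumes "finite (B::'a::real_inner set)" "span B = UNIV"
  shows "\<exists>C::'a set. frame C"
proof -
  obtain C where C: "finite C" "span C = (UNIV::'a set)" "pairwise orthogonal C"
    using basis_orthogonal[OF assms(1)] assms(2) by auto
  define N where "N = (\<lambda>b::'a. b /\<^sub>R norm b) ` (C - {0})"
  have fin: "finite N" using C by (simp add: N_def)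
  have on: "b \<bullet> b' = (if b = b' then 1 else 0)" if bN: "b \<in> N" "b' \<in> N" for b b'
  proof -
    obtain c c' where c: "c \<in> C" "c \<noteq> 0" "b = c /\<^sub>R norm c" "c' \<in> C" "c' \<noteq> 0" "b' = c' /\<^sub>R norm c'"
      using bN unfolding N_def by blast
    show ?thesis
    proof (cases "c = c'")
      case True
      then show ?thesis using c by (simp add: dot_square_norm power2_eq_square)
    next
      case False
      then have "c \<bullet> c' = 0" using C(3) c by (auto simp: pairwise_def orthogonal_def)
      then have "b \<bullet> b' = 0" using c by simp
      moreover have "b \<bullet> b = 1" using c by (simp add: dot_square_norm power2_eq_square)
      ultimately show ?thesis by auto
    qed
  qed
  have "C \<subseteq> span N"
  proof
    fix c assume "c \<in> C"
    show "c \<in> span N"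
    proof (cases "c = 0")
      case False
      then have "norm c *\<^sub>R (c /\<^sub>R norm c) \<in> span N"
        using \<open>c \<in> C\<close> by (intro span_mul span_base) (auto simp: N_def)
      then show ?thesis using False by simp
    qed (simp add: span_zero)
  qed
  then have sp: "span N = UNIV" using C(2) by (metis span_mono span_span top.extremum_uniqueI)
  have "(\<Sum>b\<in>N. (x \<bullet> b) *\<^sub>R b) = x" for x
  proof -
    have "x \<in> span N" using sp by simp
    then show ?thesis
    proof (induction rule: span_induct_alt)
      case base
      then show ?case by simp
    next
      case (step a c y)
      have "(\<Sum>b\<in>N. (c \<bullet> b) *\<^sub>R b) = (\<Sum>b\<in>N. if b = c then b else 0)"
        by (rule sum.cong) (use on[OF step(1)] in auto)
      also have "\<dots> = c" using fin step(1) by simp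
      finally have "(\<Sum>b\<in>N. (c \<bullet> b) *\<^sub>R b) = c" .
      then show ?case using step
        by (simp add: inner_add_left scaleR_add_left sum.distrib scaleR_scaleR[symmetric]
            scaleR_sum_right[symmetric] del: scaleR_scaleR)
    qed
  qed
  then show ?thesis using fin by (auto simp: frame_def)
qed

text \<open>
  By the chain rule a derivative of \<open>g \<circ> f\<close> is a derivative of \<open>g\<close> in a direction that varies with the
  point. Expanding that direction in a frame leaves only derivatives in constant directions, to
  which the induction hypothesis applies.
\<close>

lemma Ck_on_compose:
  fixes f :: "'a::real_normed_vector \<Rightarrow> 'b::real_inner" and g :: "'b \<Rightarrow> 'c::real_normed_vector"
  assumes fr: "frame (B::'b set)" and "open S" "f ` S \<subseteq> T" "Ck_on k S f" "Ck_on k T g"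
  shows "Ck_on k S (\<lambda>x. g (f x))"
  using assms(4,5)
proof (induction k arbitrary: g)
  case 0
  then show ?case using assms(3) by (auto intro: continuous_on_compose2)
next
  case (Suc k)
  have d: "((\<lambda>x. g (f x)) has_derivative (\<lambda>v. dderiv g (f x) (dderiv f x v))) (at x)" if "x \<in> S" for x
  proof -
    have "f differentiable (at x)" "g differentiable (at (f x))"
      using Suc.prems that assms(3) by auto
    then show ?thesis using diff_chain_at[OF dderiv_has dderiv_has, of f x g] by (simp add: o_def)
  qed
  have e: "dderiv g (f x) (dderiv f x v) = (\<Sum>b\<in>B. (dderiv f x v \<bullet> b) *\<^sub>R dderiv g (f x) b)"
    if "x \<in> S" for x v
  proof -
    have "g differentiable (at (f x))"
      using Suc.prems that assms(3) by auto
    then have "linear (dderiv g (f x))" by (rule linear_frechet_derivative)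
    moreover have "dderiv f x v = (\<Sum>b\<in>B. (dderiv f x v \<bullet> b) *\<^sub>R b)"
      using fr by (simp add: frame_def)
    ultimately show ?thesis
      using linear_sum[of "dderiv g (f x)" "\<lambda>b. (dderiv f x v \<bullet> b) *\<^sub>R b" B]
      by (simp add: linear_scale)
  qed
  have "Ck_on k S (\<lambda>x. \<Sum>b\<in>B. (dderiv f x v \<bullet> b) *\<^sub>R dderiv g (f x) b)" for v
    by (intro Ck_on_sum Ck_on_scaleR assms(2) Suc.IH
        Ck_on_bounded_linear[where L = "\<lambda>y. y \<bullet> _"] bounded_linear_inner_left)
       (use Suc.prems Ck_on_SucD[OF Suc.prems(1)] in auto)
  then have "Ck_on k S (\<lambda>x. dderiv (\<lambda>x. g (f x)) x v)" for v
    by (rule Ck_on_cong[OF assms(2), rotated]) (simp add: dderivI[OF d] e)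
  then show ?case using d by (auto intro: Derivative.differentiableI)
qed

lemma smooth_on_differentiable: "smooth_on S f \<Longrightarrow> x \<in> S \<Longrightarrow> f differentiable (at x)"
  unfolding smooth_on_def using Ck_on.simps(2) by blast

lemma smooth_on_dderiv: "smooth_on S f \<Longrightarrow> smooth_on S (\<lambda>x. dderiv f x v)"
  unfolding smooth_on_def using Ck_on.simps(2) by blast

lemma smooth_on_cong:
  "open S \<Longrightarrow> (\<And>x. x \<in> S \<Longrightarrow> f x = g x) \<Longrightarrow> smooth_on S f \<Longrightarrow> smooth_on S g"
  unfolding smooth_on_def by (metis Ck_on_cong)

lemma smooth_on_const: "smooth_on S (\<lambda>_. c)"
  unfolding smooth_on_def by (simp add: Ck_on_const)

lemma smooth_on_mono: "smooth_on S f \<Longrightarrow> T \<subseteq> S \<Longrightarrow> smooth_on T f"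
  unfolding smooth_on_def by (metis Ck_on_mono)

lemma smooth_on_Un: "open S \<Longrightarrow> open T \<Longrightarrow> smooth_on S f \<Longrightarrow> smooth_on T f \<Longrightarrow> smooth_on (S \<union> T) f"
  unfolding smooth_on_def by (metis Ck_on_Un)

lemma smooth_on_add:
  "open S \<Longrightarrow> smooth_on S f \<Longrightarrow> smooth_on S g \<Longrightarrow> smooth_on S (\<lambda>x. f x + g x)"
  unfolding smooth_on_def by (metis Ck_on_add)

lemma smooth_on_bounded_linear:
  "open S \<Longrightarrow> bounded_linear L \<Longrightarrow> smooth_on S f \<Longrightarrow> smooth_on S (\<lambda>x. L (f x))"
  unfolding smooth_on_def by (metis Ck_on_bounded_linear)

lemma smooth_on_id: "smooth_on S (\<lambda>x. x)"
proof -
  have "Ck_on k S (\<lambda>x. x)" for k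
    by (cases k) (auto simp: Ck_on_const frechet_derivative_id)
  then show ?thesis by (simp add: smooth_on_def)
qed

lemma smooth_on_scaleR:
  "open S \<Longrightarrow> smooth_on S f \<Longrightarrow> smooth_on S g \<Longrightarrow> smooth_on S (\<lambda>x. f x *\<^sub>R g x)"
  unfolding smooth_on_def by (metis Ck_on_scaleR)

lemma smooth_on_mult:
  fixes f g :: "'a::real_normed_vector \<Rightarrow> real"
  shows "open S \<Longrightarrow> smooth_on S f \<Longrightarrow> smooth_on S g \<Longrightarrow> smooth_on S (\<lambda>x. f x * g x)"
  using smooth_on_scaleR[of S f g] by simp

lemma smooth_on_cmult:
  fixes f :: "'a::real_normed_vector \<Rightarrow> real"
  shows "open S \<Longrightarrow> smooth_on S f \<Longrightarrow> smooth_on S (\<lambda>x. a * f x)"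
  by (intro smooth_on_mult smooth_on_const)

lemma smooth_on_sum:
  "open S \<Longrightarrow> (\<And>i. i \<in> I \<Longrightarrow> smooth_on S (f i)) \<Longrightarrow> smooth_on S (\<lambda>x. \<Sum>i\<in>I. f i x)"
  unfolding smooth_on_def by (metis Ck_on_sum)

lemma smooth_on_sum_list:
  "open S \<Longrightarrow> (\<And>t. t \<in> set ts \<Longrightarrow> smooth_on S (f t)) \<Longrightarrow> smooth_on S (\<lambda>x. \<Sum>t\<leftarrow>ts. f t x)"
  by (induction ts) (auto intro: smooth_on_const smooth_on_add)

lemma smooth_on_compose:
  fixes f :: "'a::real_normed_vector \<Rightarrow> 'b::real_inner"
  shows "frame (B::'b set) \<Longrightarrow> open S \<Longrightarrow> f ` S \<subseteq> T \<Longrightarrow> smooth_on S f \<Longrightarrow> smooth_on T g \<Longrightarrow>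
    smooth_on S (\<lambda>x. g (f x))"
  unfolding smooth_on_def by (metis Ck_on_compose)

subsection \<open>Symmetry of second derivatives\<close>

text \<open>
  The mean value theorem is applied to the second difference quotient, in the direction \<open>u\<close> and then
  in the direction \<open>v\<close>. Since the second difference is symmetric in \<open>u\<close> and \<open>v\<close>, it approximates both
  mixed derivatives.
\<close>

lemma second_difference_mean_value:
  fixes f :: "'a::real_normed_vector \<Rightarrow> real"
  assumes h: "0 < h"
    and S: "\<And>s t. 0 \<le> s \<Longrightarrow> s \<le> h \<Longrightarrow> 0 \<le> t \<Longrightarrow> t \<le> h \<Longrightarrow> x + s *\<^sub>R u + t *\<^sub>R v \<in> S"
    and f: "\<And>y. y \<in> S \<Longrightarrow> f differentiable (at y)"
    and f': "\<And>y. y \<in> S \<Longrightarrow> (\<lambda>y. dderiv f y u) differentiable (at y)"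
  shows "\<exists>s t. 0 < s \<and> s < h \<and> 0 < t \<and> t < h \<and>
    f (x + h *\<^sub>R u + h *\<^sub>R v) - f (x + h *\<^sub>R u) - f (x + h *\<^sub>R v) + f x =
    h * h * dderiv (\<lambda>y. dderiv f y u) (x + s *\<^sub>R u + t *\<^sub>R v) v"
proof -
  have line: "((\<lambda>s. F (a + s *\<^sub>R w)) has_real_derivative dderiv F (a + s *\<^sub>R w) w) (at s)"
    if F: "F differentiable (at (a + s *\<^sub>R w))" for F :: "'a \<Rightarrow> real" and a s w
  proof -
    have "((\<lambda>s. a + s *\<^sub>R w) has_derivative (\<lambda>r. r *\<^sub>R w)) (at s)"
      by (auto intro!: derivative_eq_intros)
    from diff_chain_at[OF this dderiv_has[OF F]]
    have "((\<lambda>s. F (a + s *\<^sub>R w)) has_derivative (\<lambda>r. dderiv F (a + s *\<^sub>R w) (r *\<^sub>R w))) (at s)"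
      by (simp add: o_def)
    moreover have "dderiv F (a + s *\<^sub>R w) (r *\<^sub>R w) = dderiv F (a + s *\<^sub>R w) w * r" for r
      using linear_scale[OF linear_frechet_derivative[OF F]] by simp
    ultimately show ?thesis by (simp add: has_field_derivative_def)
  qed
  have "\<exists>s. 0 < s \<and> s < h \<and> (f (x + h *\<^sub>R v + h *\<^sub>R u) - f (x + h *\<^sub>R u)) - (f (x + h *\<^sub>R v + 0 *\<^sub>R u) - f (x + 0 *\<^sub>R u))
      = (h - 0) * (dderiv f (x + h *\<^sub>R v + s *\<^sub>R u) u - dderiv f (x + s *\<^sub>R u) u)"
    by (rule MVT2[OF h, of "\<lambda>s. f (x + h *\<^sub>R v + s *\<^sub>R u) - f (x + s *\<^sub>R u)"])
       (intro DERIV_diff line f, use S[of _ h] S[of _ 0] h in \<open>auto simp: algebra_simps\<close>)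
  then obtain s where s: "0 < s" "s < h" "f (x + h *\<^sub>R v + h *\<^sub>R u) - f (x + h *\<^sub>R u) - (f (x + h *\<^sub>R v) - f x)
      = h * (dderiv f (x + s *\<^sub>R u + h *\<^sub>R v) u - dderiv f (x + s *\<^sub>R u) u)"
    by (auto simp: algebra_simps)
  have "\<exists>t. 0 < t \<and> t < h \<and> dderiv f (x + s *\<^sub>R u + h *\<^sub>R v) u - dderiv f (x + s *\<^sub>R u + 0 *\<^sub>R v) u
      = (h - 0) * dderiv (\<lambda>y. dderiv f y u) (x + s *\<^sub>R u + t *\<^sub>R v) v"
    by (rule MVT2[OF h, of "\<lambda>t. dderiv f (x + s *\<^sub>R u + t *\<^sub>R v) u"])
       (intro line f', use S[of s] s h in auto)
  then obtain t where t: "0 < t" "t < h" "dderiv f (x + s *\<^sub>R u + h *\<^sub>R v) u - dderiv f (x + s *\<^sub>R u) u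
      = h * dderiv (\<lambda>y. dderiv f y u) (x + s *\<^sub>R u + t *\<^sub>R v) v"
    by auto
  show ?thesis using s t by (intro exI[of _ s] exI[of _ t]) (simp add: algebra_simps)
qed

lemma dderiv_commute:
  fixes f :: "'a::real_normed_vector \<Rightarrow> real"
  assumes "open S" "x \<in> S" "Ck_on 2 S f"
  shows "dderiv (\<lambda>y. dderiv f y u) x v = dderiv (\<lambda>y. dderiv f y v) x u"
proof -
  have f: "f differentiable (at y)" "(\<lambda>y. dderiv f y w) differentiable (at y)"
    and c: "continuous_on S (\<lambda>y. dderiv (\<lambda>y. dderiv f y w) y w')" if "y \<in> S" for y w w'
    using assms(3) that by (auto simp: numeral_2_eq_2)
  define P where "P y = dderiv (\<lambda>y. dderiv f y u) y v" for y
  define Q where "Q y = dderiv (\<lambda>y. dderiv f y v) y u" for y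
  have "isCont P x" "isCont Q x"
    using c[OF assms(2), of u v] c[OF assms(2), of v u] assms(1,2)
    unfolding P_def Q_def by (simp_all add: continuous_on_eq_continuous_at)
  have "\<bar>P x - Q x\<bar> < e" if "e > 0" for e
  proof -
    obtain d1 where d1: "d1 > 0" "\<And>y. dist y x < d1 \<Longrightarrow> dist (P y) (P x) < e / 2"
      using \<open>isCont P x\<close> \<open>e > 0\<close> unfolding continuous_at_eps_delta by (metis half_gt_zero)
    obtain d2 where d2: "d2 > 0" "\<And>y. dist y x < d2 \<Longrightarrow> dist (Q y) (Q x) < e / 2"
      using \<open>isCont Q x\<close> \<open>e > 0\<close> unfolding continuous_at_eps_delta by (metis half_gt_zero)
    obtain d3 where d3: "d3 > 0" "ball x d3 \<subseteq> S" using assms(1,2) open_contains_ball by blast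
    define d where "d = min d1 (min d2 d3)"
    have "d > 0" using d1 d2 d3 by (simp add: d_def)
    \<comment> \<open>\<open>h\<close> is so small that the parallelogram spanned by \<open>h u\<close> and \<open>h v\<close> at \<open>x\<close> lies in the ball of radius \<open>d\<close>.\<close>
    define h where "h = d / (2 * (norm u + norm v + 1))"
    have n: "norm u + norm v + 1 > 0" by (meson add_nonneg_pos add_nonneg_nonneg norm_ge_zero zero_less_one)
    have h: "h > 0" unfolding h_def using \<open>d > 0\<close> n by (intro divide_pos_pos) auto
    have near: "dist (x + s *\<^sub>R w + t *\<^sub>R w') x < d"
      if "0 \<le> s" "s \<le> h" "0 \<le> t" "t \<le> h" "norm w + norm w' = norm u + norm v" for s t w w'
    proof -
      have "dist (x + s *\<^sub>R w + t *\<^sub>R w') x = norm (s *\<^sub>R w + t *\<^sub>R w')" by (simp add: dist_norm add.assoc)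
      also have "\<dots> \<le> s * norm w + t * norm w'"
        using norm_triangle_ineq[of "s *\<^sub>R w" "t *\<^sub>R w'"] that by simp
      also have "\<dots> \<le> h * norm w + h * norm w'"
        using that by (intro add_mono mult_right_mono) auto
      also have "\<dots> = h * (norm u + norm v)" using that by (simp add: distrib_left[symmetric])
      also have "\<dots> \<le> h * (norm u + norm v + 1)" using h by simp
      also have "\<dots> = d / 2" using n by (simp add: h_def field_simps)
      finally show ?thesis using \<open>d > 0\<close> by simp
    qed
    have inS: "x + s *\<^sub>R w + t *\<^sub>R w' \<in> S"
      if "0 \<le> s" "s \<le> h" "0 \<le> t" "t \<le> h" "norm w + norm w' = norm u + norm v" for s t w w'
      using near[OF that] d3 by (auto simp: d_def dist_commute)
    obtain s t where st: "0 < s" "s < h" "0 < t" "t < h"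
      "f (x + h *\<^sub>R u + h *\<^sub>R v) - f (x + h *\<^sub>R u) - f (x + h *\<^sub>R v) + f x = h * h * P (x + s *\<^sub>R u + t *\<^sub>R v)"
      using second_difference_mean_value[OF h, of x u v S f] inS f unfolding P_def by auto
    obtain s' t' where st': "0 < s'" "s' < h" "0 < t'" "t' < h"
      "f (x + h *\<^sub>R v + h *\<^sub>R u) - f (x + h *\<^sub>R v) - f (x + h *\<^sub>R u) + f x = h * h * Q (x + s' *\<^sub>R v + t' *\<^sub>R u)"
      using second_difference_mean_value[OF h, of x v u S f] inS f unfolding Q_def by auto
    have "h * h * P (x + s *\<^sub>R u + t *\<^sub>R v) = h * h * Q (x + s' *\<^sub>R v + t' *\<^sub>R u)"
      using st(5) st'(5) by (simp add: algebra_simps)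
    then have eq: "P (x + s *\<^sub>R u + t *\<^sub>R v) = Q (x + s' *\<^sub>R v + t' *\<^sub>R u)" using h by simp
    have "dist (P (x + s *\<^sub>R u + t *\<^sub>R v)) (P x) < e / 2"
      by (rule d1) (use near[of s t u v] st in \<open>auto simp: d_def\<close>)
    moreover have "dist (Q (x + s' *\<^sub>R v + t' *\<^sub>R u)) (Q x) < e / 2"
      by (rule d2) (use near[of s' t' v u] st' in \<open>auto simp: d_def\<close>)
    ultimately show ?thesis unfolding eq dist_real_def by arith
  qed
  then have "P x = Q x" by (metis abs_ge_zero eq_iff_diff_eq_0 less_irrefl zero_less_abs_iff)
  then show ?thesis by (simp add: P_def Q_def)
qed

subsection \<open>A smooth bump function\<close>

text \<open>
  The flat function \<open>exp (- 1 / t)\<close> is embedded in a family that is closed under differentiation up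
  to linear combinations, so that all members are smooth by one induction.
\<close>

definition flat :: "nat \<Rightarrow> real \<Rightarrow> real" where
  "flat m t = (if t > 0 then exp (- (1 / t)) / t ^ m else 0)"

lemma flat_tendsto_0: "(flat m \<longlongrightarrow> 0) (at 0)"
proof -
  have "((\<lambda>t::real. inverse t ^ m / exp (inverse t)) \<longlongrightarrow> 0) (at_right 0)"
    using filterlim_compose[OF tendsto_power_div_exp_0 filterlim_inverse_at_top_right] .
  then have "(flat m \<longlongrightarrow> 0) (at_right 0)"
    by (rule Lim_transform_eventually)
       (auto simp: eventually_at_right_less flat_def exp_minus field_simps
         intro!: eventually_at_rightI[of 0 1])
  moreover have "(flat m \<longlongrightarrow> 0) (at_left 0)"
    by (rule tendsto_eventually) (auto simp: flat_def intro!: eventually_at_leftI[of "-1"])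
  ultimately show ?thesis by (simp add: filterlim_at_split)
qed

lemma flat_has_derivative:
  "(flat m has_real_derivative (flat (m + 2) t - real m * flat (m + 1) t)) (at t)"
proof -
  consider "t > 0" | "t = 0" | "t < 0" by linarith
  then show ?thesis
  proof cases
    case 1
    have "((\<lambda>t. exp (- (1 / t)) / t ^ m) has_real_derivative (flat (m + 2) t - real m * flat (m + 1) t)) (at t)"
    proof -
      have e: "((\<lambda>t. exp (- (1 / t))) has_real_derivative exp (- (1 / t)) / t\<^sup>2) (at t)"
        using 1 by (auto intro!: derivative_eq_intros simp: field_simps power2_eq_square)
      have "(exp (- (1 / t)) / t\<^sup>2 * t ^ m - exp (- (1 / t)) * (real m * t ^ (m - Suc 0))) / (t ^ m * t ^ m)
          = flat (m + 2) t - real m * flat (m + 1) t"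
        using 1 by (cases m) (simp_all add: flat_def field_simps power2_eq_square)
      then show ?thesis using DERIV_divide[OF e DERIV_pow[of m t]] 1 by simp
    qed
    then show ?thesis
      by (rule has_field_derivative_transform_within_open[where S = "{0<..}"]) (use 1 in \<open>auto simp: flat_def\<close>)
  next
    case 2
    \<comment> \<open>The difference quotient at 0 is the next function of the family.\<close>
    have "((\<lambda>h. (flat m (0 + h) - flat m 0) / h) \<longlongrightarrow> 0) (at 0)"
      by (rule Lim_transform_eventually[OF flat_tendsto_0[of "Suc m"]])
         (auto simp: flat_def eventually_at_filter)
    then show ?thesis using 2 by (simp add: DERIV_def flat_def)
  next
    case 3
    have "((\<lambda>t. 0) has_real_derivative (flat (m + 2) t - real m * flat (m + 1) t)) (at t)"
      using 3 by (simp add: flat_def)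
    then show ?thesis
      by (rule has_field_derivative_transform_within_open[where S = "{..<0}"]) (use 3 in \<open>auto simp: flat_def\<close>)
  qed
qed

lemma smooth_on_flat: "smooth_on UNIV (flat m)"
proof -
  have "Ck_on k UNIV (flat m)" for k m
  proof (induction k arbitrary: m)
    case 0
    then show ?case using flat_has_derivative
      by (auto intro: continuous_at_imp_continuous_on DERIV_isCont)
  next
    case (Suc k)
    have d: "(flat m has_derivative (\<lambda>v. v * (flat (m + 2) t - real m * flat (m + 1) t))) (at t)" for t
      using flat_has_derivative[of m t] by (simp add: has_field_derivative_def mult.commute[of _ "_ - _"])
    have "Ck_on k UNIV (\<lambda>t. v *\<^sub>R (flat (m + 2) t + (- real m) *\<^sub>R flat (m + 1) t))" for v
      by (intro Ck_on_scaleR Ck_on_add Ck_on_const Suc open_UNIV)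
    then have "Ck_on k UNIV (\<lambda>t. dderiv (flat m) t v)" for v
      by (simp add: dderivI[OF d])
    then show ?case using d by (auto intro: Derivative.differentiableI)
  qed
  then show ?thesis by (simp add: smooth_on_def)
qed

lemma bump_exists:
  fixes x :: "'a::real_inner"
  assumes r: "r > 0"
  shows "\<exists>\<psi>. smooth_on UNIV \<psi> \<and> \<psi> x = (1::real) \<and> (\<forall>y. y \<notin> cball x r \<longrightarrow> \<psi> y = 0)"
proof -
  define \<rho> where "\<rho> y = flat 0 (r\<^sup>2 - (y - x) \<bullet> (y - x))" for y :: 'a
  have d: "((\<lambda>y. (y - x) \<bullet> (y - x)) has_derivative (\<lambda>v. 2 * ((y - x) \<bullet> v))) (at y)" for y
    by (auto intro!: derivative_eq_intros simp: inner_commute)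
  have "Ck_on k UNIV (\<lambda>y. (y - x) \<bullet> (y - x))" for k
  proof (cases k)
    case 0
    then show ?thesis by (auto intro!: continuous_intros)
  next
    case (Suc j)
    have "smooth_on UNIV (\<lambda>y. 2 * ((y + - x) \<bullet> v))" for v
      by (intro smooth_on_cmult smooth_on_add smooth_on_id smooth_on_const open_UNIV
          smooth_on_bounded_linear[where L = "\<lambda>y. y \<bullet> _"] bounded_linear_inner_left)
    then show ?thesis using Suc Derivative.differentiableI[OF d]
      by (auto simp: dderivI[OF d] smooth_on_def)
  qed
  then have "smooth_on UNIV (\<lambda>y. r\<^sup>2 + (-1) * ((y - x) \<bullet> (y - x)))"
    by (intro smooth_on_add smooth_on_const smooth_on_cmult open_UNIV) (simp add: smooth_on_def)
  then have "smooth_on UNIV \<rho>"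
    unfolding \<rho>_def using smooth_on_compose[OF frame_real open_UNIV _ _ smooth_on_flat] by auto
  then have s: "smooth_on UNIV (\<lambda>y. (1 / \<rho> x) * \<rho> y)" by (intro smooth_on_cmult) auto
  have "\<rho> x \<noteq> 0" using r by (simp add: \<rho>_def flat_def)
  moreover have "\<rho> y = 0" if "y \<notin> cball x r" for y
  proof -
    have "r < norm (y - x)" using that by (simp add: dist_norm norm_minus_commute)
    then have "r\<^sup>2 < (norm (y - x))\<^sup>2" using r by (intro power_strict_mono) auto
    then show ?thesis by (simp add: \<rho>_def flat_def dot_square_norm)
  qed
  ultimately show ?thesis using s by (intro exI[of _ "\<lambda>y. (1 / \<rho> x) * \<rho> y"]) auto
qed

text \<open>
  A ball lies in a parallelotope \<open>{\<Sum>b\<in>B. a\<^sub>b b | \<bar>a\<^sub>b\<bar> \<le> R}\<close>, which is compact as a sum of segments. This gives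
  the bump functions on the manifold a compact support.
\<close>

lemma compact_cball_frame:
  fixes x :: "'a::real_inner"
  assumes "frame (B::'a set)"
  shows "compact (cball x r)"
proof -
  have "compact {y. \<exists>a. (\<forall>b\<in>C. \<bar>a b\<bar> \<le> R) \<and> y = (\<Sum>b\<in>C. a b *\<^sub>R b)}" (is "compact (?K C)")
    if "finite C" for C :: "'a set" and R :: real
    using that
  proof (induction C)
    case empty
    have "?K {} = {0}" by auto
    then show ?case by simp
  next
    case (insert c C)
    have "compact ((\<lambda>a. a *\<^sub>R c) ` {-R..R})"
      by (intro compact_continuous_image continuous_intros) auto
    from compact_sums[OF this insert.IH]
    have "compact {x + y |x y. x \<in> (\<lambda>a. a *\<^sub>R c) ` {-R..R} \<and> y \<in> ?K C}" .
    also have "{x + y |x y. x \<in> (\<lambda>a. a *\<^sub>R c) ` {-R..R} \<and> y \<in> ?K C} = ?K (insert c C)"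
    proof (intro equalityI subsetI)
      fix z assume "z \<in> {x + y |x y. x \<in> (\<lambda>a. a *\<^sub>R c) ` {-R..R} \<and> y \<in> ?K C}"
      then obtain t a where ta: "t \<in> {-R..R}" "\<forall>b\<in>C. \<bar>a b\<bar> \<le> R" "z = t *\<^sub>R c + (\<Sum>b\<in>C. a b *\<^sub>R b)"
        by auto
      moreover have "(\<Sum>b\<in>C. (a(c := t)) b *\<^sub>R b) = (\<Sum>b\<in>C. a b *\<^sub>R b)"
        using insert by (intro sum.cong) auto
      ultimately show "z \<in> ?K (insert c C)"
        using insert by (intro CollectI exI[of _ "a(c := t)"]) auto
    next
      fix z assume "z \<in> ?K (insert c C)"
      then obtain a where "\<forall>b\<in>insert c C. \<bar>a b\<bar> \<le> R" "z = a c *\<^sub>R c + (\<Sum>b\<in>C. a b *\<^sub>R b)"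
        using insert by auto
      then show "z \<in> {x + y |x y. x \<in> (\<lambda>a. a *\<^sub>R c) ` {-R..R} \<and> y \<in> ?K C}"
        by (intro CollectI exI[of _ "a c *\<^sub>R c"] exI[of _ "\<Sum>b\<in>C. a b *\<^sub>R b"])
           (auto simp: abs_le_iff intro!: exI[of _ a])
    qed
    finally show ?case .
  qed
  moreover have "finite B" using assms by (simp add: frame_def)
  moreover define M where "M = (norm x + \<bar>r\<bar>) * (\<Sum>b\<in>B. norm b)"
  moreover have "cball x r \<subseteq> ?K M B"
  proof
    fix y assume "y \<in> cball x r"
    then have n: "norm y \<le> norm x + \<bar>r\<bar>" using norm_triangle_sub[of y x] by (simp add: dist_norm norm_minus_commute)
    have "\<bar>y \<bullet> b\<bar> \<le> M" if "b \<in> B" for b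
    proof -
      have "\<bar>y \<bullet> b\<bar> \<le> norm y * norm b" by (rule Cauchy_Schwarz_ineq2)
      also have "\<dots> \<le> M" unfolding M_def
        by (intro mult_mono n member_le_sum that \<open>finite B\<close>) (auto simp: sum_nonneg)
      finally show ?thesis .
    qed
    moreover have "y = (\<Sum>b\<in>B. (y \<bullet> b) *\<^sub>R b)" using assms by (simp add: frame_def)
    ultimately show "y \<in> ?K M B" by blast
  qed
  ultimately have "compact (?K M B \<inter> cball x r)" "?K M B \<inter> cball x r = cball x r"
    by (auto intro!: compact_Int_closed)
  then show ?thesis by simp
qed

section \<open>Alternating sums and alternating forms\<close>

text \<open>
  All sums over the removal of one argument, in the formulas for \<open>d\<close>, for Lie derivatives and for the
  Schouten bracket, have this shape. The entry removed from \<open>us\<close> is the first argument of \<open>F\<close>, the list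
  of the others is the second one.
\<close>

definition altsum :: "('a \<Rightarrow> 'a list \<Rightarrow> real) \<Rightarrow> 'a list \<Rightarrow> real" where
  "altsum F us = (\<Sum>i<length us. (-1) ^ i * F (us ! i) (take i us @ drop (Suc i) us))"

lemma altsum_Nil [simp]: "altsum F [] = 0"
  by (simp add: altsum_def)

lemma altsum_Cons [simp]: "altsum F (u # us) = F u us - altsum (\<lambda>v ws. F v (u # ws)) us"
proof -
  have "altsum F (u # us) = F u us +
      (\<Sum>i<length us. (-1) ^ Suc i * F (us ! i) (u # take i us @ drop (Suc i) us))"
    unfolding altsum_def by (simp add: sum.lessThan_Suc_shift del: sum.lessThan_Suc)
  then show ?thesis by (simp add: altsum_def sum_negf)
qed

lemma altsum_append:
  "altsum F (us @ vs) =
     altsum (\<lambda>v ws. F v (ws @ vs)) us + (-1) ^ length us * altsum (\<lambda>v ws. F v (us @ ws)) vs"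
  by (induction us arbitrary: F) auto

lemma altsum_add: "altsum (\<lambda>v ws. F v ws + G v ws) us = altsum F us + altsum G us"
  by (simp add: altsum_def distrib_left sum.distrib)

lemma altsum_diff: "altsum (\<lambda>v ws. F v ws - G v ws) us = altsum F us - altsum G us"
  by (simp add: altsum_def right_diff_distrib sum_subtractf)

lemma altsum_cmult: "altsum (\<lambda>v ws. a * F v ws) us = a * altsum F us"
  by (simp add: altsum_def sum_distrib_left mult.left_commute)

lemma altsum_zero [simp]: "altsum (\<lambda>v ws. 0) us = 0"
  by (simp add: altsum_def)

lemma altsum_uminus: "altsum (\<lambda>v ws. - F v ws) us = - altsum F us"
  using altsum_cmult[of "-1" F us] by simp

lemma altsum_sum: "altsum (\<lambda>v ws. \<Sum>b\<in>B. F b v ws) us = (\<Sum>b\<in>B. altsum (F b) us)"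
  unfolding altsum_def sum_distrib_left by (rule sum.swap)

lemma altsum_sum_list: "altsum (\<lambda>v ws. \<Sum>t\<leftarrow>ts. F t v ws) us = (\<Sum>t\<leftarrow>ts. altsum (F t) us)"
  by (induction ts) (auto simp: altsum_add)

lemma altsum_map: "altsum F (map g us) = altsum (\<lambda>v ws. F (g v) (map g ws)) us"
  by (induction us arbitrary: F) auto

text \<open>
  Each pair of entries is removed in two orders, with opposite signs. This is the only cancellation
  behind both \<open>d \<circ> d = 0\<close> and the naturality of \<open>d\<close>.
\<close>

lemma altsum_altsum_symmetric:
  assumes "\<And>v w ws. B v w ws = B w v ws"
  shows "altsum (\<lambda>v ws. altsum (\<lambda>w ws'. B v w ws') ws) us = 0"
  using assms
proof (induction us arbitrary: B)
  case (Cons u us)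
  have "altsum (\<lambda>v ws. altsum (\<lambda>w ws'. B v w (u # ws')) ws) us = 0"
    by (rule Cons.IH) (simp add: Cons.prems)
  moreover have "altsum (\<lambda>v ws. B v u ws) us = altsum (\<lambda>v ws. B u v ws) us"
    by (simp add: Cons.prems)
  ultimately show ?case by (simp add: altsum_diff)
qed simp

text \<open>
  The degree is an integer, so that forms of negative degree vanish without a separate convention.
  Vanishing is only required for equal neighbours, which is easy to preserve when lists are
  concatenated; arbitrary equal entries can be moved next to each other.
\<close>

definition alt :: "int \<Rightarrow> ('a::real_vector list \<Rightarrow> real) \<Rightarrow> bool" where
  "alt k \<eta> \<longleftrightarrow>
     (\<forall>us. int (length us) \<noteq> k \<longrightarrow> \<eta> us = 0) \<and>
     (\<forall>us u w a b vs. \<eta> (us @ (a *\<^sub>R u + b *\<^sub>R w) # vs) = a * \<eta> (us @ u # vs) + b * \<eta> (us @ w # vs)) \<and>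
     (\<forall>us a vs. \<eta> (us @ a # a # vs) = 0)"

lemma alt_length: "alt k \<eta> \<Longrightarrow> int (length us) \<noteq> k \<Longrightarrow> \<eta> us = 0"
  by (simp add: alt_def)

lemma alt_lincomb:
  "alt k \<eta> \<Longrightarrow> \<eta> (us @ (a *\<^sub>R u + b *\<^sub>R w) # vs) = a * \<eta> (us @ u # vs) + b * \<eta> (us @ w # vs)"
  by (simp add: alt_def)

lemma alt_adjacent: "alt k \<eta> \<Longrightarrow> \<eta> (us @ a # a # vs) = 0"
  by (simp add: alt_def)

lemma alt_swap:
  assumes "alt k \<eta>"
  shows "\<eta> (us @ a # b # vs) = - \<eta> (us @ b # a # vs)"
proof -
  note add = alt_lincomb[OF assms, of _ 1 _ 1, simplified]
  have "0 = \<eta> (us @ (a + b) # (a + b) # vs)" using alt_adjacent[OF assms] by simp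
  also have "\<dots> = \<eta> (us @ a # (a + b) # vs) + \<eta> (us @ b # (a + b) # vs)" by (rule add)
  also have "\<dots> = \<eta> (us @ a # b # vs) + \<eta> (us @ b # a # vs)"
    using add[of "us @ [a]" a b vs] add[of "us @ [b]" a b vs] alt_adjacent[OF assms] by simp
  finally show ?thesis by simp
qed

lemma alt_move:
  assumes "alt k \<eta>"
  shows "\<eta> (us @ a # ws @ vs) = (-1) ^ length ws * \<eta> (us @ ws @ a # vs)"
proof (induction ws arbitrary: us)
  case (Cons w ws)
  have "\<eta> (us @ a # w # ws @ vs) = - \<eta> ((us @ [w]) @ a # ws @ vs)"
    using alt_swap[OF assms, of us a w] by simp
  also have "\<dots> = - ((-1) ^ length ws * \<eta> ((us @ [w]) @ ws @ a # vs))" by (subst Cons.IH) simp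
  finally show ?case by simp
qed simp

lemma alt_contract:
  assumes "alt k \<eta>"
  shows "alt (k - int (length ps)) (\<lambda>us. \<eta> (ps @ us))"
  unfolding alt_def
  using alt_length[OF assms] alt_lincomb[OF assms, of "ps @ _"] alt_adjacent[OF assms, of "ps @ _"]
  by auto

lemma alt_contract_Cons: "alt k \<eta> \<Longrightarrow> alt (k - 1) (\<lambda>us. \<eta> (p # us))"
  using alt_contract[of k \<eta> "[p]"] by simp

lemma alt_contract_right:
  assumes "alt k \<eta>"
  shows "alt (k - int (length vs)) (\<lambda>us. \<eta> (us @ vs))"
  unfolding alt_def
  using alt_length[OF assms] alt_lincomb[OF assms, of _ _ _ _ _ "_ @ vs"] alt_adjacent[OF assms, of _ _ "_ @ vs"]
  by auto

lemma alt_map: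
  assumes "alt k \<eta>" "\<And>a u b w. J (a *\<^sub>R u + b *\<^sub>R w) = a *\<^sub>R J u + b *\<^sub>R J w"
  shows "alt k (\<lambda>us. \<eta> (map J us))"
  unfolding alt_def using alt_length[OF assms(1)] alt_lincomb[OF assms(1)] alt_adjacent[OF assms(1)]
  by (simp add: assms(2))

lemma alt_cmult: "alt k \<eta> \<Longrightarrow> alt k (\<lambda>us. r * \<eta> us)"
  unfolding alt_def by (simp add: algebra_simps)

lemma alt_block_swap:
  assumes "alt k \<eta>"
  shows "\<eta> (us @ ws @ vs) = (-1) ^ (length us * length ws) * \<eta> (ws @ us @ vs)"
  using assms
proof (induction us arbitrary: \<eta> k)
  case (Cons u us)
  have "\<eta> (u # us @ ws @ vs) = (-1) ^ (length us * length ws) * \<eta> (u # ws @ us @ vs)"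
    by (rule Cons.IH[OF alt_contract_Cons[OF Cons.prems]])
  also have "\<eta> (u # ws @ us @ vs) = (-1) ^ length ws * \<eta> (ws @ u # us @ vs)"
    using alt_move[OF Cons.prems, of "[]"] by simp
  finally show ?case by (simp add: power_add)
qed simp

lemma alt_repeated:
  assumes "alt k \<eta>" "i < j" "j < length us" "us ! i = us ! j"
  shows "\<eta> us = 0"
proof -
  define vs where "vs = drop (Suc i) us"
  have us: "us = take i us @ us ! i # vs"
    unfolding vs_def by (rule id_take_nth_drop) (use assms in simp)
  have j: "j - Suc i < length vs" "vs ! (j - Suc i) = us ! i" using assms by (auto simp: vs_def)
  then obtain ws ws' where vs: "vs = ws @ us ! i # ws'" by (metis id_take_nth_drop)
  have "\<eta> us = \<eta> (take i us @ us ! i # ws @ us ! i # ws')" using us vs by simp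
  also have "\<dots> = (-1) ^ length ws * \<eta> ((take i us @ ws) @ us ! i # us ! i # ws')"
    by (subst alt_move[OF assms(1)]) simp
  also have "\<dots> = 0" by (simp only: alt_adjacent[OF assms(1)])
  finally show ?thesis by simp
qed

lemma alt_expand:
  assumes "alt k \<eta>" "frame B"
  shows "\<eta> (us @ x # vs) = (\<Sum>b\<in>B. (x \<bullet> b) * \<eta> (us @ b # vs))"
proof -
  have "linear (\<lambda>x. \<eta> (us @ x # vs))"
    by (rule linearI)
       (use alt_lincomb[OF assms(1), of us 1 _ 1] alt_lincomb[OF assms(1), of us _ _ 0] in auto)
  from linear_sum[OF this, of "\<lambda>b. (x \<bullet> b) *\<^sub>R b" B] linear_scale[OF this]
  show ?thesis using assms(2) by (simp add: frame_def)
qed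

text \<open>
  The two terms that remove one of two equal neighbours have opposite signs; in every other term the
  two neighbours are still next to each other.
\<close>

lemma alt_altsum:
  assumes lin: "\<And>u w a b ws. F (a *\<^sub>R u + b *\<^sub>R w) ws = a * F u ws + b * F w ws"
    and alt: "\<And>v. alt k (F v)"
  shows "alt (k + 1) (altsum F)"
  unfolding alt_def
proof (intro conjI allI impI)
  fix us :: "'a list" assume "int (length us) \<noteq> k + 1"
  then show "altsum F us = 0"
    unfolding altsum_def by (intro sum.neutral ballI) (auto intro!: alt_length[OF alt])
next
  fix us vs u w a b
  show "altsum F (us @ (a *\<^sub>R u + b *\<^sub>R w) # vs) = a * altsum F (us @ u # vs) + b * altsum F (us @ w # vs)"
    using alt_lincomb[OF alt, of _ "_ @ _"]
    by (simp add: altsum_append altsum_add altsum_cmult lin alt_lincomb[OF alt] algebra_simps)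
next
  fix us vs a
  show "altsum F (us @ a # a # vs) = 0"
    by (simp add: altsum_append alt_adjacent[OF alt])
qed

section \<open>Differential forms on open subsets of the model space\<close>

lemma dderiv_lincomb:
  fixes f g :: "'a::real_normed_vector \<Rightarrow> real"
  assumes "f differentiable (at y)" "g differentiable (at y)"
  shows "dderiv (\<lambda>z. a * f z + b * g z) y v = a * dderiv f y v + b * dderiv g y v"
proof -
  have "((\<lambda>z. a * f z + b * g z) has_derivative (\<lambda>v. a * dderiv f y v + b * dderiv g y v)) (at y)"
    by (intro has_derivative_add has_derivative_mult_right dderiv_has assms)
  then show ?thesis by (simp add: dderivI)
qed

lemma dderiv_mult:
  fixes f g :: "'a::real_normed_vector \<Rightarrow> real"
  assumes "f differentiable (at y)" "g differentiable (at y)"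
  shows "dderiv (\<lambda>z. f z * g z) y v = f y * dderiv g y v + dderiv f y v * g y"
  using dderivI[OF has_derivative_mult[OF dderiv_has[OF assms(1)] dderiv_has[OF assms(2)]]] by simp

lemma dderiv_sum:
  fixes f :: "'i \<Rightarrow> 'a::real_normed_vector \<Rightarrow> real"
  assumes "\<And>i. i \<in> I \<Longrightarrow> f i differentiable (at y)"
  shows "dderiv (\<lambda>z. \<Sum>i\<in>I. f i z) y v = (\<Sum>i\<in>I. dderiv (f i) y v)"
proof -
  have "((\<lambda>z. \<Sum>i\<in>I. f i z) has_derivative (\<lambda>v. \<Sum>i\<in>I. dderiv (f i) y v)) (at y)"
    by (intro has_derivative_sum dderiv_has assms)
  then show ?thesis by (simp add: dderivI)
qed

lemma dderiv_cmult:
  fixes f :: "'a::real_normed_vector \<Rightarrow> real"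
  assumes "f differentiable (at y)"
  shows "dderiv (\<lambda>z. a * f z) y v = a * dderiv f y v"
  using dderiv_lincomb[OF assms assms, of a 0] by simp

lemma dderiv_sum_list:
  fixes f :: "'i \<Rightarrow> 'a::real_normed_vector \<Rightarrow> real"
  assumes "\<And>i. i \<in> set ts \<Longrightarrow> f i differentiable (at y)"
  shows "(\<lambda>z. \<Sum>i\<leftarrow>ts. f i z) differentiable (at y) \<and>
    dderiv (\<lambda>z. \<Sum>i\<leftarrow>ts. f i z) y v = (\<Sum>i\<leftarrow>ts. dderiv (f i) y v)"
  using assms
proof (induction ts)
  case (Cons t ts)
  then show ?case
    using dderiv_lincomb[of "f t" y "\<lambda>z. \<Sum>i\<leftarrow>ts. f i z" 1 1 v] by auto
qed simp

lemma dderiv_altsum: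
  fixes F :: "'a::real_normed_vector \<Rightarrow> 'b \<Rightarrow> 'b list \<Rightarrow> real"
  assumes "\<And>w ws. (\<lambda>z. F z w ws) differentiable (at y)"
  shows "dderiv (\<lambda>z. altsum (F z) us) y v = altsum (\<lambda>w ws. dderiv (\<lambda>z. F z w ws) y v) us"
  unfolding altsum_def
  by (subst dderiv_sum) (auto intro!: differentiable_mult assms simp: dderiv_cmult[OF assms])

definition chart_form :: "int \<Rightarrow> 'e::real_normed_vector set \<Rightarrow> ('e \<Rightarrow> 'e list \<Rightarrow> real) \<Rightarrow> bool" where
  "chart_form k S \<omega> \<longleftrightarrow> (\<forall>y\<in>S. alt k (\<omega> y)) \<and> (\<forall>us. smooth_on S (\<lambda>y. \<omega> y us))"

lemma chart_form_alt: "chart_form k S \<omega> \<Longrightarrow> y \<in> S \<Longrightarrow> alt k (\<omega> y)"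
  and chart_form_smooth: "chart_form k S \<omega> \<Longrightarrow> smooth_on S (\<lambda>y. \<omega> y us)"
  by (auto simp: chart_form_def)

lemma chart_form_differentiable: "chart_form k S \<omega> \<Longrightarrow> y \<in> S \<Longrightarrow> (\<lambda>y. \<omega> y us) differentiable (at y)"
  using chart_form_smooth smooth_on_differentiable by blast

lemma chart_form_mono: "chart_form k S \<omega> \<Longrightarrow> T \<subseteq> S \<Longrightarrow> chart_form k T \<omega>"
  unfolding chart_form_def using smooth_on_mono by blast

lemma chart_form_cong:
  assumes "open S" "\<And>y us. y \<in> S \<Longrightarrow> \<omega> y us = \<omega>' y us" "chart_form k S \<omega>"
  shows "chart_form k S \<omega>'"
proof -
  have "\<omega> y = \<omega>' y" if "y \<in> S" for y using assms(2) that by auto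
  moreover have "smooth_on S (\<lambda>y. \<omega>' y us)" for us
    by (rule smooth_on_cong[OF assms(1) _ chart_form_smooth[OF assms(3)]]) (simp add: assms(2))
  ultimately show ?thesis using assms(3) by (simp add: chart_form_def)
qed

text \<open>
  The coordinate formula for the exterior derivative. That it does not depend on the coordinates is
  the naturality under pullback proved below.
\<close>

definition chart_d :: "('e::real_normed_vector \<Rightarrow> 'e list \<Rightarrow> real) \<Rightarrow> 'e \<Rightarrow> 'e list \<Rightarrow> real" where
  "chart_d \<omega> y us = altsum (\<lambda>v ws. dderiv (\<lambda>z. \<omega> z ws) y v) us"

lemma chart_d_cong:
  assumes "open S" "y \<in> S" "\<And>y us. y \<in> S \<Longrightarrow> \<omega> y us = \<omega>' y us" "chart_form k S \<omega>"
  shows "chart_d \<omega>' y us = chart_d \<omega> y us"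
proof -
  have "dderiv (\<lambda>z. \<omega>' z ws) y = dderiv (\<lambda>z. \<omega> z ws) y" for ws
    by (rule dderiv_cong[OF assms(1,2)]) (auto simp: assms(3) chart_form_differentiable[OF assms(4,2)])
  then show ?thesis by (simp add: chart_d_def)
qed

lemma chart_form_chart_d:
  assumes "open S" "chart_form k S \<omega>"
  shows "chart_form (k + 1) S (chart_d \<omega>)"
  unfolding chart_form_def
proof (intro conjI ballI allI)
  fix y assume y: "y \<in> S"
  note dif = chart_form_differentiable[OF assms(2) y]
  note alt = chart_form_alt[OF assms(2)]
  have "alt k (\<lambda>ws. dderiv (\<lambda>z. \<omega> z ws) y v)" for v
    unfolding alt_def
  proof (intro conjI allI impI)
    fix us :: "'a list" assume "int (length us) \<noteq> k"
    then have "dderiv (\<lambda>z. \<omega> z us) y = dderiv (\<lambda>z. 0) y"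
      by (intro dderiv_cong[OF assms(1) y]) (auto simp: alt_length[OF alt])
    then show "dderiv (\<lambda>z. \<omega> z us) y v = 0" by simp
  next
    fix us vs :: "'a list" and u w a b
    have "dderiv (\<lambda>z. \<omega> z (us @ (a *\<^sub>R u + b *\<^sub>R w) # vs)) y =
        dderiv (\<lambda>z. a * \<omega> z (us @ u # vs) + b * \<omega> z (us @ w # vs)) y"
      by (intro dderiv_cong[OF assms(1) y] derivative_intros dif) (auto simp: alt_lincomb[OF alt])
    then show "dderiv (\<lambda>z. \<omega> z (us @ (a *\<^sub>R u + b *\<^sub>R w) # vs)) y v =
        a * dderiv (\<lambda>z. \<omega> z (us @ u # vs)) y v + b * dderiv (\<lambda>z. \<omega> z (us @ w # vs)) y v"
      by (simp add: dderiv_lincomb[OF dif dif])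
  next
    fix us vs :: "'a list" and a
    have "dderiv (\<lambda>z. \<omega> z (us @ a # a # vs)) y = dderiv (\<lambda>z. 0) y"
      by (intro dderiv_cong[OF assms(1) y]) (auto simp: alt_adjacent[OF alt])
    then show "dderiv (\<lambda>z. \<omega> z (us @ a # a # vs)) y v = 0" by simp
  qed
  moreover have "dderiv (\<lambda>z. \<omega> z ws) y (a *\<^sub>R u + b *\<^sub>R w) =
      a * dderiv (\<lambda>z. \<omega> z ws) y u + b * dderiv (\<lambda>z. \<omega> z ws) y w" for u w a b ws
    using dderiv_linear[OF dif] by simp
  ultimately have "alt (k + 1) (altsum (\<lambda>v ws. dderiv (\<lambda>z. \<omega> z ws) y v))"
    by (intro alt_altsum)
  then show "alt (k + 1) (chart_d \<omega> y)" by (simp add: chart_d_def[abs_def])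
next
  fix us
  show "smooth_on S (\<lambda>y. chart_d \<omega> y us)"
    unfolding chart_d_def altsum_def
    by (intro smooth_on_sum smooth_on_cmult smooth_on_dderiv chart_form_smooth[OF assms(2)] assms(1))
qed

text \<open>
  This is \<open>d \<circ> d = 0\<close>: second derivatives are symmetric, hence cancel in the double alternating sum.
\<close>

lemma chart_d_chart_d:
  assumes "open S" "chart_form k S \<omega>" "y \<in> S"
  shows "chart_d (chart_d \<omega>) y us = 0"
proof -
  have sm: "smooth_on S (\<lambda>z. \<omega> z ws)" for ws by (rule chart_form_smooth[OF assms(2)])
  have "chart_d (chart_d \<omega>) y us =
      altsum (\<lambda>v ws. altsum (\<lambda>w ws'. dderiv (\<lambda>z. dderiv (\<lambda>z. \<omega> z ws') z w) y v) ws) us"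
    unfolding chart_d_def
    by (subst dderiv_altsum) (auto intro: smooth_on_differentiable[OF smooth_on_dderiv[OF sm] assms(3)])
  also have "\<dots> = 0"
    using sm by (intro altsum_altsum_symmetric dderiv_commute[OF assms(1,3)]) (simp add: smooth_on_def)
  finally show ?thesis .
qed

lemma dderiv_commute_vector:
  fixes f :: "'a::real_normed_vector \<Rightarrow> 'b::real_inner"
  assumes "open S" "x \<in> S" "smooth_on S f"
  shows "dderiv (\<lambda>y. dderiv f y u) x v = dderiv (\<lambda>y. dderiv f y v) x u"
proof -
  have inner: "dderiv (\<lambda>y. g y \<bullet> b) y w = dderiv g y w \<bullet> b"
    if "smooth_on S g" "y \<in> S" for g :: "'a \<Rightarrow> 'b" and y w b
    using dderivI[OF has_derivative_inner_left[OF dderiv_has[OF smooth_on_differentiable[OF that]]]]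
    by simp
  have *: "dderiv (\<lambda>y. dderiv (\<lambda>y. f y \<bullet> b) y u) x v = dderiv (\<lambda>y. dderiv f y u) x v \<bullet> b" for u v b
  proof -
    have "dderiv (\<lambda>y. dderiv (\<lambda>y. f y \<bullet> b) y u) x = dderiv (\<lambda>y. dderiv f y u \<bullet> b) x"
      by (rule dderiv_cong[OF assms(1,2)])
         (auto simp: inner[OF assms(3)] intro!: differentiable_inner
           smooth_on_differentiable[OF smooth_on_dderiv[OF assms(3)] assms(2)])
    then show ?thesis by (simp add: inner[OF smooth_on_dderiv[OF assms(3)] assms(2)])
  qed
  have "smooth_on S (\<lambda>y. f y \<bullet> b)" for b
    using smooth_on_bounded_linear[OF assms(1) bounded_linear_inner_left assms(3)] .
  then have "dderiv (\<lambda>y. dderiv (\<lambda>y. f y \<bullet> b) y u) x v = dderiv (\<lambda>y. dderiv (\<lambda>y. f y \<bullet> b) y v) x u" for b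
    by (intro dderiv_commute[OF assms(1,2)]) (simp add: smooth_on_def)
  then have "(dderiv (\<lambda>y. dderiv f y u) x v - dderiv (\<lambda>y. dderiv f y v) x u) \<bullet> b = 0" for b
    by (simp add: * inner_diff_left)
  then show ?thesis by (metis inner_eq_zero_iff right_minus_eq)
qed

lemma smooth_on_alt_compose:
  fixes \<omega> :: "'e::real_inner \<Rightarrow> 'e list \<Rightarrow> real"
  assumes fr: "frame (B::'e set)" and S: "open S" and \<tau>: "smooth_on S \<tau>" "\<tau> ` S \<subseteq> T"
    and g: "\<And>v. v \<in> set ws \<Longrightarrow> smooth_on S (g v)" and \<omega>: "chart_form k T \<omega>"
  shows "smooth_on S (\<lambda>y. \<omega> (\<tau> y) (us @ map (\<lambda>v. g v y) ws))"
  using g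
proof (induction ws arbitrary: us)
  case Nil
  then show ?case using smooth_on_compose[OF fr S \<tau>(2,1) chart_form_smooth[OF \<omega>]] by simp
next
  case (Cons w ws)
  have "smooth_on S (\<lambda>y. \<Sum>b\<in>B. (g w y \<bullet> b) * \<omega> (\<tau> y) ((us @ [b]) @ map (\<lambda>v. g v y) ws))"
    by (intro smooth_on_sum smooth_on_mult S Cons.IH
        smooth_on_bounded_linear[where L = "\<lambda>y. y \<bullet> _"] bounded_linear_inner_left)
       (use Cons.prems in auto)
  then show ?case
    by (rule smooth_on_cong[OF S, rotated])
       (use \<tau>(2) in \<open>auto simp: alt_expand[OF chart_form_alt[OF \<omega>] fr, of _ us] image_subset_iff\<close>)
qed

text \<open>
  The product rule for a form evaluated on moving vectors. Alternation allows the differentiated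
  vector to be moved to the front, which turns the sum over the slots into an alternating sum.
\<close>

lemma dderiv_alt_compose:
  fixes \<omega> :: "'e::real_inner \<Rightarrow> 'e list \<Rightarrow> real"
  assumes fr: "frame (B::'e set)" and S: "open S" "x \<in> S" and \<tau>: "smooth_on S \<tau>" "\<tau> ` S \<subseteq> T" "open T"
    and g: "\<And>v. v \<in> set ws \<Longrightarrow> smooth_on S (g v)" and \<omega>: "chart_form k T \<omega>"
  shows "dderiv (\<lambda>y. \<omega> (\<tau> y) (map (\<lambda>v. g v y) ws)) x u =
    dderiv (\<lambda>z. \<omega> z (map (\<lambda>v. g v x) ws)) (\<tau> x) (dderiv \<tau> x u) +
    altsum (\<lambda>w ws'. \<omega> (\<tau> x) (dderiv (g w) x u # map (\<lambda>v. g v x) ws')) ws"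
  using g \<omega>
proof (induction ws arbitrary: \<omega> k)
  case Nil
  have "((\<lambda>y. \<omega> (\<tau> y) []) has_derivative (\<lambda>v. dderiv (\<lambda>z. \<omega> z []) (\<tau> x) (dderiv \<tau> x v))) (at x)"
    using diff_chain_at[OF dderiv_has dderiv_has, of \<tau> x "\<lambda>z. \<omega> z []"]
      smooth_on_differentiable[OF \<tau>(1) S(2)] chart_form_differentiable[OF Nil(2), of "\<tau> x"] \<tau>(2) S(2)
    by (auto simp: o_def)
  then show ?case by (simp add: dderivI)
next
  case (Cons w ws)
  have \<tau>x: "\<tau> x \<in> T" using \<tau> S by auto
  have sub: "chart_form (k - 1) T (\<lambda>z us. \<omega> z (b # us))" for b
    using Cons.prems(2) alt_contract_Cons by (auto simp: chart_form_def)
  let ?L = "\<lambda>y. map (\<lambda>v. g v y) ws"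
  have sg: "smooth_on S (\<lambda>y. g w y \<bullet> b)" for b
    using Cons.prems(1) smooth_on_bounded_linear[OF S(1) bounded_linear_inner_left] by auto
  have dg: "dderiv (\<lambda>y. g w y \<bullet> b) x u = dderiv (g w) x u \<bullet> b" for b
    using dderivI[OF has_derivative_inner_left[OF dderiv_has[OF smooth_on_differentiable[OF _ S(2)]]], of "g w"]
      Cons.prems(1) by auto
  have sL: "smooth_on S (\<lambda>y. \<omega> (\<tau> y) (b # ?L y))" for b
    using smooth_on_alt_compose[OF fr S(1) \<tau>(1,2) _ Cons.prems(2), of ws g "[b]"] Cons.prems(1)
    by auto
  have ex: "\<omega> z (v # us) = (\<Sum>b\<in>B. (v \<bullet> b) * \<omega> z (b # us))" if "z \<in> T" for z v us
    using alt_expand[OF chart_form_alt[OF Cons.prems(2) that] fr, of "[]" v us] by simp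
  have "dderiv (\<lambda>y. \<omega> (\<tau> y) (map (\<lambda>v. g v y) (w # ws))) x =
      dderiv (\<lambda>y. \<Sum>b\<in>B. (g w y \<bullet> b) * \<omega> (\<tau> y) (b # ?L y)) x"
  proof (rule dderiv_cong[OF S])
    fix y assume "y \<in> S"
    then have "\<tau> y \<in> T" using \<tau>(2) by auto
    then show "(\<Sum>b\<in>B. (g w y \<bullet> b) * \<omega> (\<tau> y) (b # ?L y)) = \<omega> (\<tau> y) (map (\<lambda>v. g v y) (w # ws))"
      using ex[of "\<tau> y" "g w y" "?L y"] by simp
  next
    show "(\<lambda>y. \<Sum>b\<in>B. (g w y \<bullet> b) * \<omega> (\<tau> y) (b # ?L y)) differentiable (at x)"
      by (intro smooth_on_differentiable[OF _ S(2)] smooth_on_sum smooth_on_mult S(1) sg sL)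
  qed
  then have "dderiv (\<lambda>y. \<omega> (\<tau> y) (map (\<lambda>v. g v y) (w # ws))) x u =
      (\<Sum>b\<in>B. (g w x \<bullet> b) * dderiv (\<lambda>y. \<omega> (\<tau> y) (b # ?L y)) x u
        + (dderiv (g w) x u \<bullet> b) * \<omega> (\<tau> x) (b # ?L x))"
    using smooth_on_differentiable[OF sg S(2)] smooth_on_differentiable[OF sL S(2)]
    by (simp add: dderiv_sum dderiv_mult dg differentiable_mult)
  also have "\<dots> = (\<Sum>b\<in>B. (g w x \<bullet> b) * dderiv (\<lambda>z. \<omega> z (b # ?L x)) (\<tau> x) (dderiv \<tau> x u))
      + altsum (\<lambda>w' ws'. \<Sum>b\<in>B. (g w x \<bullet> b) * \<omega> (\<tau> x) (b # dderiv (g w') x u # map (\<lambda>v. g v x) ws')) ws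
      + \<omega> (\<tau> x) (dderiv (g w) x u # ?L x)"
    using Cons.IH[OF _ sub] Cons.prems(1)
    by (simp add: sum.distrib distrib_left altsum_sum altsum_cmult
        ex[OF \<tau>x, of "dderiv (g w) x u" "?L x", symmetric])
  also have "(\<Sum>b\<in>B. (g w x \<bullet> b) * dderiv (\<lambda>z. \<omega> z (b # ?L x)) (\<tau> x) (dderiv \<tau> x u)) =
      dderiv (\<lambda>z. \<Sum>b\<in>B. (g w x \<bullet> b) * \<omega> z (b # ?L x)) (\<tau> x) (dderiv \<tau> x u)"
    using chart_form_differentiable[OF Cons.prems(2) \<tau>x]
    by (simp add: dderiv_sum dderiv_cmult differentiable_mult)
  also have "\<dots> = dderiv (\<lambda>z. \<omega> z (g w x # ?L x)) (\<tau> x) (dderiv \<tau> x u)"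
    by (subst dderiv_cong[OF \<tau>(3) \<tau>x ex chart_form_differentiable[OF Cons.prems(2) \<tau>x]]) auto
  also have "altsum (\<lambda>w' ws'. \<Sum>b\<in>B. (g w x \<bullet> b) * \<omega> (\<tau> x) (b # dderiv (g w') x u # map (\<lambda>v. g v x) ws')) ws
      = - altsum (\<lambda>w' ws'. \<omega> (\<tau> x) (dderiv (g w') x u # g w x # map (\<lambda>v. g v x) ws')) ws"
    using alt_swap[OF chart_form_alt[OF Cons.prems(2) \<tau>x], of "[]" "g w x"]
    by (simp add: ex[OF \<tau>x, of "g w x", symmetric] altsum_uminus)
  finally show ?case by simp
qed

text \<open>
  The second derivatives of \<open>\<tau>\<close> that appear when a pullback is differentiated are symmetric, hence
  cancel in the alternating sum.
\<close>

lemma chart_d_pullback: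
  fixes \<omega> :: "'e::real_inner \<Rightarrow> 'e list \<Rightarrow> real"
  assumes fr: "frame (B::'e set)" and S: "open S" "x \<in> S" and \<tau>: "smooth_on S \<tau>" "\<tau> ` S \<subseteq> T" "open T"
    and \<omega>: "chart_form k T \<omega>"
  shows "chart_d (\<lambda>y us. \<omega> (\<tau> y) (map (dderiv \<tau> y) us)) x us = chart_d \<omega> (\<tau> x) (map (dderiv \<tau> x) us)"
proof -
  have "dderiv (\<lambda>y. \<omega> (\<tau> y) (map (dderiv \<tau> y) ws)) x u =
      dderiv (\<lambda>z. \<omega> z (map (dderiv \<tau> x) ws)) (\<tau> x) (dderiv \<tau> x u) +
      altsum (\<lambda>w ws'. \<omega> (\<tau> x) (dderiv (\<lambda>y. dderiv \<tau> y w) x u # map (dderiv \<tau> x) ws')) ws" for ws u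
    using dderiv_alt_compose[OF fr S \<tau> _ \<omega>, of ws "\<lambda>v y. dderiv \<tau> y v"] smooth_on_dderiv[OF \<tau>(1)]
    by simp
  then have "chart_d (\<lambda>y us. \<omega> (\<tau> y) (map (dderiv \<tau> y) us)) x us = chart_d \<omega> (\<tau> x) (map (dderiv \<tau> x) us) +
      altsum (\<lambda>u ws. altsum (\<lambda>w ws'. \<omega> (\<tau> x) (dderiv (\<lambda>y. dderiv \<tau> y w) x u # map (dderiv \<tau> x) ws')) ws) us"
    by (simp add: chart_d_def altsum_add altsum_map)
  also have "altsum (\<lambda>u ws. altsum (\<lambda>w ws'. \<omega> (\<tau> x) (dderiv (\<lambda>y. dderiv \<tau> y w) x u # map (dderiv \<tau> x) ws')) ws) us = 0"
    by (rule altsum_altsum_symmetric) (simp add: dderiv_commute_vector[OF S \<tau>(1)])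
  finally show ?thesis by simp
qed

section \<open>Multivector fields on open subsets of the model space\<close>

text \<open>
  The list \<open>[(f\<^sub>1, I\<^sub>1), \<dots>]\<close> stands for the multivector field \<open>f\<^sub>1 \<Lambda>I\<^sub>1 + \<dots>\<close>, where \<open>\<Lambda>I\<close> is the wedge product
  of the constant vector fields in \<open>I\<close>. With lists, sums of fields are concatenations.
\<close>

type_synonym 'e mv_rep = "(('e \<Rightarrow> real) \<times> 'e list) list"

definition smooth_rep :: "nat \<Rightarrow> 'e::real_normed_vector set \<Rightarrow> 'e mv_rep \<Rightarrow> bool" where
  "smooth_rep p S T \<longleftrightarrow> (\<forall>(f, I)\<in>set T. length I = p \<and> smooth_on S f)"

definition chart_int :: "'e mv_rep \<Rightarrow> ('e \<Rightarrow> 'e list \<Rightarrow> real) \<Rightarrow> 'e \<Rightarrow> 'e list \<Rightarrow> real" where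
  "chart_int T \<omega> y vs = (\<Sum>(f, I)\<leftarrow>T. f y * \<omega> y (I @ vs))"

definition chart_lie :: "nat \<Rightarrow> 'e::real_normed_vector mv_rep \<Rightarrow> ('e \<Rightarrow> 'e list \<Rightarrow> real) \<Rightarrow> 'e \<Rightarrow> 'e list \<Rightarrow> real" where
  "chart_lie p T \<omega> y vs = chart_d (chart_int T \<omega>) y vs - (-1) ^ p * chart_int T (chart_d \<omega>) y vs"

lemma chart_int_Nil [simp]: "chart_int [] \<omega> y vs = 0"
  and chart_int_Cons [simp]: "chart_int ((f, I) # T) \<omega> y vs = f y * \<omega> y (I @ vs) + chart_int T \<omega> y vs"
  and chart_int_append: "chart_int (T @ T') \<omega> y vs = chart_int T \<omega> y vs + chart_int T' \<omega> y vs"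
  by (simp_all add: chart_int_def)

lemma chart_int_concat: "chart_int (concat Ts) \<omega> y vs = (\<Sum>T\<leftarrow>Ts. chart_int T \<omega> y vs)"
  by (induction Ts) (auto simp: chart_int_append)

lemma smooth_rep_Cons: "smooth_rep p S ((f, I) # T) \<longleftrightarrow> length I = p \<and> smooth_on S f \<and> smooth_rep p S T"
  by (auto simp: smooth_rep_def)

lemma chart_form_chart_int:
  assumes "open S" "smooth_rep p S T" "chart_form k S \<omega>"
  shows "chart_form (k - int p) S (chart_int T \<omega>)"
  unfolding chart_form_def
proof (intro conjI ballI allI)
  fix y assume y: "y \<in> S"
  show "alt (k - int p) (chart_int T \<omega> y)"
    using assms(2)
  proof (induction T)
    case Nil
    then show ?case by (simp add: alt_def)
  next
    case (Cons t T)
    obtain f I where t: "t = (f, I)" by force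
    have "alt (k - int p) (\<lambda>vs. \<omega> y (I @ vs))"
      using alt_contract[OF chart_form_alt[OF assms(3) y], of I] Cons.prems by (simp add: t smooth_rep_Cons)
    moreover have "alt (k - int p) (chart_int T \<omega> y)" using Cons by (simp add: t smooth_rep_Cons)
    ultimately show ?case
      unfolding t by (simp add: alt_def algebra_simps)
  qed
next
  fix us
  show "smooth_on S (\<lambda>y. chart_int T \<omega> y us)"
    unfolding chart_int_def
    using assms(2) chart_form_smooth[OF assms(3)] assms(1)
    by (auto intro!: smooth_on_sum_list smooth_on_mult simp: smooth_rep_def case_prod_unfold)
qed

lemma sum_list_cmult: "(\<Sum>t\<leftarrow>ts. a * f t) = a * (\<Sum>t\<leftarrow>ts. f t :: real)"
  by (induction ts) (auto simp: distrib_left)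

lemma sum_list_swap: "(\<Sum>s\<leftarrow>ss. \<Sum>t\<leftarrow>ts. f s t) = (\<Sum>t\<leftarrow>ts. \<Sum>s\<leftarrow>ss. f s t :: real)"
  by (induction ss) (auto simp: sum_list_addf)

lemma chart_int_chart_int_commute:
  assumes "smooth_rep p S T" "smooth_rep q S T'" "chart_form k S \<omega>" "y \<in> S"
  shows "chart_int T (chart_int T' \<omega>) y vs = (-1) ^ (p * q) * chart_int T' (chart_int T \<omega>) y vs"
proof -
  have "chart_int T (chart_int T' \<omega>) y vs = (\<Sum>t\<leftarrow>T. \<Sum>t'\<leftarrow>T'. fst t y * (fst t' y * \<omega> y (snd t' @ snd t @ vs)))"
    by (simp add: chart_int_def case_prod_unfold sum_list_cmult)
  also have "\<dots> = (\<Sum>t\<leftarrow>T. \<Sum>t'\<leftarrow>T'. (-1) ^ (p * q) * (fst t' y * (fst t y * \<omega> y (snd t @ snd t' @ vs))))"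
  proof (intro arg_cong[where f = sum_list] map_cong refl)
    fix t t' assume "t \<in> set T" "t' \<in> set T'"
    then have "length (snd t) = p" "length (snd t') = q"
      using assms by (auto simp: smooth_rep_def)
    then have "\<omega> y (snd t' @ snd t @ vs) = (-1) ^ (p * q) * \<omega> y (snd t @ snd t' @ vs)"
      using alt_block_swap[OF chart_form_alt[OF assms(3,4)], of "snd t'" "snd t" vs] by (simp add: mult.commute)
    then show "fst t y * (fst t' y * \<omega> y (snd t' @ snd t @ vs)) =
        (-1) ^ (p * q) * (fst t' y * (fst t y * \<omega> y (snd t @ snd t' @ vs)))" by simp
  qed
  also have "\<dots> = (-1) ^ (p * q) * (\<Sum>t'\<leftarrow>T'. \<Sum>t\<leftarrow>T. fst t' y * (fst t y * \<omega> y (snd t @ snd t' @ vs)))"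
    by (subst sum_list_swap) (simp add: sum_list_cmult)
  also have "\<dots> = (-1) ^ (p * q) * chart_int T' (chart_int T \<omega>) y vs"
    by (simp add: chart_int_def case_prod_unfold sum_list_cmult)
  finally show ?thesis .
qed

lemma sign_mult_sign: "(-1) ^ p * ((-1) ^ p * x) = (x::real)"
  by (simp add: minus_one_power_iff)

lemma dderiv_chart_int:
  assumes "smooth_rep p S T" "\<And>us. (\<lambda>z. \<omega> z us) differentiable (at y)" "y \<in> S"
  shows "dderiv (\<lambda>z. chart_int T \<omega> z vs) y v =
    (\<Sum>(f, I)\<leftarrow>T. f y * dderiv (\<lambda>z. \<omega> z (I @ vs)) y v + dderiv f y v * \<omega> y (I @ vs))"
proof -
  have "fst t differentiable (at y)" if "t \<in> set T" for t
    using assms(1,3) that smooth_on_differentiable by (fastforce simp: smooth_rep_def)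
  then show ?thesis
    unfolding chart_int_def case_prod_unfold
    using dderiv_sum_list[of T "\<lambda>t z. fst t z * \<omega> z (snd t @ vs)" y v] assms(2)
    by (auto simp: dderiv_mult differentiable_mult cong: map_cong)
qed

text \<open>
  In \<open>d \<circ> \<iota>\<close> and \<open>\<iota> \<circ> d\<close> the derivatives of the form in the directions of the remaining arguments
  cancel. Those of the coefficients and those along the entries of the field are left.
\<close>

lemma chart_lie_eq:
  assumes "open S" "smooth_rep p S T" "chart_form k S \<omega>" "y \<in> S"
  shows "chart_lie p T \<omega> y vs =
    (\<Sum>(f, I)\<leftarrow>T. altsum (\<lambda>v ws. dderiv f y v * \<omega> y (I @ ws)) vs
      - (-1) ^ p * (f y * altsum (\<lambda>v ws. dderiv (\<lambda>z. \<omega> z (ws @ vs)) y v) I))"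
proof -
  have len: "length (snd t) = p" if "t \<in> set T" for t using assms(2) that by (auto simp: smooth_rep_def)
  have "chart_d (chart_int T \<omega>) y vs = (\<Sum>t\<leftarrow>T. altsum (\<lambda>v ws. dderiv (fst t) y v * \<omega> y (snd t @ ws)) vs
      + fst t y * altsum (\<lambda>v ws. dderiv (\<lambda>z. \<omega> z (snd t @ ws)) y v) vs)"
    unfolding chart_d_def
    by (simp add: dderiv_chart_int[OF assms(2) chart_form_differentiable[OF assms(3,4)] assms(4)]
        case_prod_unfold altsum_sum_list altsum_add altsum_cmult add.commute)
  moreover have "(-1) ^ p * chart_int T (chart_d \<omega>) y vs = (\<Sum>t\<leftarrow>T. (-1) ^ p * (fst t y *
      altsum (\<lambda>v ws. dderiv (\<lambda>z. \<omega> z (ws @ vs)) y v) (snd t))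
      + fst t y * altsum (\<lambda>v ws. dderiv (\<lambda>z. \<omega> z (snd t @ ws)) y v) vs)"
    unfolding chart_int_def chart_d_def case_prod_unfold sum_list_cmult[symmetric]
    by (intro arg_cong[where f = sum_list] map_cong refl)
       (simp add: altsum_append len distrib_left mult.left_commute sign_mult_sign)
  ultimately show ?thesis
    unfolding chart_lie_def by (simp add: sum_list_subtractf[symmetric] case_prod_unfold)
qed

text \<open>
  The Schouten bracket of \<open>f \<Lambda>I\<close> and \<open>g \<Lambda>J\<close>: one factor of a wedge product differentiates the
  coefficient of the other one.
\<close>

definition chart_bracket1 ::
    "nat \<Rightarrow> nat \<Rightarrow> ('e::real_normed_vector \<Rightarrow> real) \<Rightarrow> 'e list \<Rightarrow> ('e \<Rightarrow> real) \<Rightarrow> 'e list \<Rightarrow> 'e mv_rep" where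
  "chart_bracket1 p q f I g J =
     map (\<lambda>i. (\<lambda>y. - ((-1) ^ (p + (p + 1) * q + i) * (f y * dderiv g y (I ! i))),
       J @ take i I @ drop (Suc i) I)) [0..<p] @
     map (\<lambda>j. (\<lambda>y. - ((-1) ^ j * (g y * dderiv f y (J ! j))),
       I @ take j J @ drop (Suc j) J)) [0..<q]"

definition chart_bracket :: "nat \<Rightarrow> nat \<Rightarrow> 'e::real_normed_vector mv_rep \<Rightarrow> 'e mv_rep \<Rightarrow> 'e mv_rep" where
  "chart_bracket p q T T' =
     concat (map (\<lambda>t. concat (map (\<lambda>t'. chart_bracket1 p q (fst t) (snd t) (fst t') (snd t')) T')) T)"

lemma smooth_rep_chart_bracket:
  assumes "open S" "smooth_rep p S T" "smooth_rep q S T'" "1 \<le> p"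
  shows "smooth_rep (p + q - 1) S (chart_bracket p q T T')"
proof -
  have "smooth_rep (p + q - 1) S (chart_bracket1 p q f I g J)"
    if "length I = p" "length J = q" "smooth_on S f" "smooth_on S g" for f g I J
    using that assms(1,4) unfolding chart_bracket1_def smooth_rep_def
    by (auto intro!: smooth_on_bounded_linear[where L = uminus] bounded_linear_minus bounded_linear_ident
        smooth_on_cmult smooth_on_mult smooth_on_dderiv)
  then show ?thesis
    using assms(2,3) unfolding chart_bracket_def smooth_rep_def by fastforce
qed

lemma chart_int_chart_bracket1:
  assumes "length I = p" "length J = q"
  shows "chart_int (chart_bracket1 p q f I g J) \<omega> y vs =
    - ((-1) ^ (p + (p + 1) * q) * (f y * altsum (\<lambda>v ws. dderiv g y v * \<omega> y (J @ ws @ vs)) I))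
    - g y * altsum (\<lambda>v ws. dderiv f y v * \<omega> y (I @ ws @ vs)) J"
  using assms unfolding chart_bracket1_def chart_int_append chart_int_def altsum_def
  by (simp add: o_def interv_sum_list_conv_sum_set_nat atLeast0LessThan sum_distrib_left
      sum_negf power_add algebra_simps)

text \<open>
  The derivatives of the form cancel by moving a block of \<open>q\<close> entries past \<open>p - 1\<close> others, and the
  terms with \<open>df\<close> evaluated on the remaining arguments cancel by moving it past \<open>p\<close> others.
\<close>

lemma chart_bracket_identity:
  assumes S: "open S" "y \<in> S" and T: "smooth_rep p S T" "smooth_rep q S T'" and \<omega>: "chart_form k S \<omega>" and p: "1 \<le> p"
  shows "chart_int (chart_bracket p q T T') \<omega> y vs =
    (-1) ^ ((p + 1) * q) * chart_lie p T (chart_int T' \<omega>) y vs - chart_int T' (chart_lie p T \<omega>) y vs"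
proof -
  let ?s = "(-1) ^ ((p + 1) * q) :: real"
  note dif = chart_form_differentiable[OF \<omega> S(2)]
  define P1 where "P1 t t' = fst t' y * altsum (\<lambda>v ws. dderiv (fst t) y v * \<omega> y (snd t' @ snd t @ ws)) vs
      - (-1) ^ p * (fst t y * (fst t' y * altsum (\<lambda>v ws. dderiv (\<lambda>z. \<omega> z (snd t' @ ws @ vs)) y v) (snd t)
         + altsum (\<lambda>v ws. dderiv (fst t') y v * \<omega> y (snd t' @ ws @ vs)) (snd t)))" for t t'
  define P2 where "P2 t t' = fst t' y * (altsum (\<lambda>v ws. dderiv (fst t) y v * \<omega> y (snd t @ ws)) (snd t' @ vs)
      - (-1) ^ p * (fst t y * altsum (\<lambda>v ws. dderiv (\<lambda>z. \<omega> z (ws @ snd t' @ vs)) y v) (snd t)))" for t t'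
  have 1: "chart_lie p T (chart_int T' \<omega>) y vs = (\<Sum>t\<leftarrow>T. \<Sum>t'\<leftarrow>T'. P1 t t')"
  proof -
    have "altsum (\<lambda>v ws. dderiv (fst t) y v * chart_int T' \<omega> y (snd t @ ws)) vs =
        (\<Sum>t'\<leftarrow>T'. fst t' y * altsum (\<lambda>v ws. dderiv (fst t) y v * \<omega> y (snd t' @ snd t @ ws)) vs)" for t
      unfolding chart_int_def
      by (simp add: case_prod_unfold altsum_sum_list[symmetric] altsum_cmult[symmetric] mult.left_commute
          sum_list_cmult[symmetric])
    moreover have "altsum (\<lambda>v ws. dderiv (\<lambda>z. chart_int T' \<omega> z (ws @ vs)) y v) I =
        (\<Sum>t'\<leftarrow>T'. fst t' y * altsum (\<lambda>v ws. dderiv (\<lambda>z. \<omega> z (snd t' @ ws @ vs)) y v) I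
         + altsum (\<lambda>v ws. dderiv (fst t') y v * \<omega> y (snd t' @ ws @ vs)) I)" for I
      by (simp add: dderiv_chart_int[OF T(2) dif S(2)] case_prod_unfold altsum_sum_list altsum_add altsum_cmult)
    ultimately show ?thesis
      by (simp add: chart_lie_eq[OF S(1) T(1) chart_form_chart_int[OF S(1) T(2) \<omega>] S(2)] case_prod_unfold P1_def
          sum_list_subtractf sum_list_cmult)
  qed
  have 2: "chart_int T' (chart_lie p T \<omega>) y vs = (\<Sum>t\<leftarrow>T. \<Sum>t'\<leftarrow>T'. P2 t t')"
    unfolding chart_int_def chart_lie_eq[OF S(1) T(1) \<omega> S(2)] P2_def
    by (subst sum_list_swap) (simp add: case_prod_unfold sum_list_cmult)
  have "chart_int (chart_bracket1 p q (fst t) (snd t) (fst t') (snd t')) \<omega> y vs = ?s * P1 t t' - P2 t t'"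
    if t: "t \<in> set T" "t' \<in> set T'" for t t'
  proof -
    have len: "length (snd t) = p" "length (snd t') = q" using T t by (auto simp: smooth_rep_def)
    let ?f = "fst t" and ?g = "fst t'" and ?I = "snd t" and ?J = "snd t'"
    have a: "altsum (\<lambda>v ws. dderiv ?f y v * \<omega> y (?J @ ?I @ ws)) vs =
        (-1) ^ (p * q) * altsum (\<lambda>v ws. dderiv ?f y v * \<omega> y (?I @ ?J @ ws)) vs"
      using alt_block_swap[OF chart_form_alt[OF \<omega> S(2)], of ?J ?I] len
      by (simp add: altsum_cmult[symmetric] mult.commute mult.left_commute)
    have J: "dderiv (\<lambda>z. \<omega> z (?J @ ws @ vs)) y v = ?s * dderiv (\<lambda>z. \<omega> z (ws @ ?J @ vs)) y v"
      if "Suc (length ws) = p" for ws v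
    proof -
      have "dderiv (\<lambda>z. \<omega> z (?J @ ws @ vs)) y = dderiv (\<lambda>z. ?s * \<omega> z (ws @ ?J @ vs)) y"
      proof (rule dderiv_cong[OF S])
        fix z assume z: "z \<in> S"
        show "?s * \<omega> z (ws @ ?J @ vs) = \<omega> z (?J @ ws @ vs)"
          using alt_block_swap[OF chart_form_alt[OF \<omega> z], of ?J ws vs] len(2) that[symmetric]
          by (auto simp: minus_one_power_iff)
      qed (intro derivative_intros dif)
      then show ?thesis by (simp add: dderiv_cmult[OF dif])
    qed
    have b: "altsum (\<lambda>v ws. dderiv (\<lambda>z. \<omega> z (?J @ ws @ vs)) y v) ?I =
        ?s * altsum (\<lambda>v ws. dderiv (\<lambda>z. \<omega> z (ws @ ?J @ vs)) y v) ?I"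
      unfolding altsum_def sum_distrib_left
    proof (intro sum.cong refl)
      fix i assume "i \<in> {..<length ?I}"
      then have "Suc (length (take i ?I @ drop (Suc i) ?I)) = p" using len by auto
      from J[OF this]
      show "(-1) ^ i * dderiv (\<lambda>z. \<omega> z (?J @ (take i ?I @ drop (Suc i) ?I) @ vs)) y (?I ! i) =
          ?s * ((-1) ^ i * dderiv (\<lambda>z. \<omega> z ((take i ?I @ drop (Suc i) ?I) @ ?J @ vs)) y (?I ! i))"
        by (simp only: mult.left_commute)
    qed
    have c: "altsum (\<lambda>v ws. dderiv ?f y v * \<omega> y (?I @ ws)) (?J @ vs) =
        altsum (\<lambda>v ws. dderiv ?f y v * \<omega> y (?I @ ws @ vs)) ?J
        + (-1) ^ q * altsum (\<lambda>v ws. dderiv ?f y v * \<omega> y (?I @ ?J @ ws)) vs"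
      by (simp add: altsum_append len)
    have e: "?s * (-1) ^ (p * q) = (-1) ^ q" "?s * ?s = 1"
      by (simp_all add: minus_one_power_iff)
    have "?s * P1 t t' = ?g y * ((?s * (-1) ^ (p * q)) * altsum (\<lambda>v ws. dderiv ?f y v * \<omega> y (?I @ ?J @ ws)) vs)
      - (-1) ^ p * (?f y * (?g y * ((?s * ?s) * altsum (\<lambda>v ws. dderiv (\<lambda>z. \<omega> z (ws @ ?J @ vs)) y v) ?I)
         + ?s * altsum (\<lambda>v ws. dderiv ?g y v * \<omega> y (?J @ ws @ vs)) ?I))"
      unfolding P1_def a b by (simp add: algebra_simps)
    then show ?thesis
      unfolding e P2_def c chart_int_chart_bracket1[OF len] by (simp add: algebra_simps power_add)
  qed
  then have "chart_int (chart_bracket p q T T') \<omega> y vs = (\<Sum>t\<leftarrow>T. \<Sum>t'\<leftarrow>T'. ?s * P1 t t' - P2 t t')"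
    unfolding chart_bracket_def by (simp add: chart_int_concat o_def cong: map_cong)
  then show ?thesis unfolding 1 2 by (simp add: sum_list_subtractf sum_list_cmult)
qed

section \<open>Charts and tangent spaces\<close>

locale manifold =
  fixes A :: "('m::{t2_space,second_countable_topology}, 'e::real_inner) chart set"
  assumes smooth_manifold: "smooth_manifold A"
begin

abbreviation dom :: "('m, 'e) chart \<Rightarrow> 'm set" where
  "dom c \<equiv> fst c"

abbreviation im :: "('m, 'e) chart \<Rightarrow> 'e set" where
  "im c \<equiv> snd c ` fst c"

abbreviation pt :: "('m, 'e) chart \<Rightarrow> 'e \<Rightarrow> 'm" where
  "pt c \<equiv> inv_into (fst c) (snd c)"

lemma frame_ex: "\<exists>B::'e set. frame B"
  using smooth_manifold frame_exists unfolding smooth_manifold_def by blast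

lemma chart_ex: "\<exists>c\<in>A. x \<in> dom c"
  using smooth_manifold unfolding smooth_manifold_def by blast

lemma homeo: "c \<in> A \<Longrightarrow> homeomorphism (dom c) (im c) (snd c) (pt c)"
  and open_dom: "c \<in> A \<Longrightarrow> open (dom c)"
  and open_im: "c \<in> A \<Longrightarrow> open (im c)"
  and smooth_transition: "c \<in> A \<Longrightarrow> d \<in> A \<Longrightarrow> smooth_on (snd c ` (dom c \<inter> dom d)) (transition c d)"
  using smooth_manifold unfolding smooth_manifold_def by blast+

lemma pt_snd [simp]: "c \<in> A \<Longrightarrow> x \<in> dom c \<Longrightarrow> pt c (snd c x) = x"
  using homeo homeomorphism_apply1 by blast

lemma snd_pt [simp]: "c \<in> A \<Longrightarrow> y \<in> im c \<Longrightarrow> snd c (pt c y) = y"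
  using homeo homeomorphism_apply2 by blast

lemma pt_in_dom: "c \<in> A \<Longrightarrow> y \<in> im c \<Longrightarrow> pt c y \<in> dom c"
  by auto

lemma open_image: "c \<in> A \<Longrightarrow> open W \<Longrightarrow> W \<subseteq> dom c \<Longrightarrow> open (snd c ` W)"
  using homeomorphism_imp_open_map[OF homeo, of c W] open_im[of c] open_dom[of c]
  by (simp add: openin_open_eq)

lemma open_overlap: "c \<in> A \<Longrightarrow> d \<in> A \<Longrightarrow> open (snd c ` (dom c \<inter> dom d))"
  by (rule open_image) (auto intro: open_dom)

lemma transition_snd [simp]: "c \<in> A \<Longrightarrow> x \<in> dom c \<Longrightarrow> transition c d (snd c x) = snd d x"
  by (simp add: transition_def)

abbreviation jac :: "('m, 'e) chart \<Rightarrow> ('m, 'e) chart \<Rightarrow> 'm \<Rightarrow> 'e \<Rightarrow> 'e" where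
  "jac c d x \<equiv> dderiv (transition c d) (snd c x)"

lemma transition_differentiable:
  "c \<in> A \<Longrightarrow> d \<in> A \<Longrightarrow> x \<in> dom c \<Longrightarrow> x \<in> dom d \<Longrightarrow> transition c d differentiable (at (snd c x))"
  by (rule smooth_on_differentiable[OF smooth_transition]) auto

lemma jac_jac:
  assumes "c \<in> A" "d \<in> A" "e \<in> A" "x \<in> dom c" "x \<in> dom d" "x \<in> dom e"
  shows "jac d e x (jac c d x u) = jac c e x u"
proof -
  let ?S = "snd c ` (dom c \<inter> dom d \<inter> dom e)"
  have "((\<lambda>y. transition d e (transition c d y)) has_derivative (\<lambda>u. jac d e x (jac c d x u))) (at (snd c x))"
    using diff_chain_at[OF dderiv_has dderiv_has, of "transition c d" "snd c x" "transition d e"]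
      transition_differentiable assms by (simp add: o_def)
  then have "(transition c e has_derivative (\<lambda>u. jac d e x (jac c d x u))) (at (snd c x))"
    by (rule has_derivative_transform_within_open[where s = ?S])
       (use assms in \<open>auto intro!: open_image open_dom\<close>)
  then show ?thesis by (simp add: dderivI)
qed

lemma jac_id:
  assumes "c \<in> A" "x \<in> dom c"
  shows "jac c c x u = u"
proof -
  have "(transition c c has_derivative (\<lambda>u. u)) (at (snd c x))"
    by (rule has_derivative_transform_within_open[OF has_derivative_ident open_im[OF assms(1)]])
       (use assms in auto)
  then show ?thesis by (simp add: dderivI)
qed

abbreviation tangents :: "'m \<Rightarrow> ('m, 'e) tvec list \<Rightarrow> bool" where
  "tangents x vs \<equiv> set vs \<subseteq> tangent_space A x"

lemma coord_vec_coord: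
  "d \<in> A \<Longrightarrow> x \<in> dom d \<Longrightarrow> coord_vec A c x u d = jac c d x u"
  by (simp add: coord_vec_def)

lemma coord_vec_in: "c \<in> A \<Longrightarrow> x \<in> dom c \<Longrightarrow> coord_vec A c x u \<in> tangent_space A x"
  unfolding tangent_space_def by (auto simp: coord_vec_def jac_jac)

lemma coord_vec_of_tangent:
  assumes "c \<in> A" "x \<in> dom c" "v \<in> tangent_space A x"
  shows "coord_vec A c x (v c) = v"
proof
  fix d
  show "coord_vec A c x (v c) d = v d"
  proof (cases "d \<in> A \<and> x \<in> dom d")
    case True
    then have "v d = jac c d x (v c)" using assms unfolding tangent_space_def by blast
    then show ?thesis using True by (simp add: coord_vec_coord)
  next
    case False
    then have "v d = 0" using assms(3) unfolding tangent_space_def by blast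
    then show ?thesis using False by (auto simp: coord_vec_def)
  qed
qed

lemma coord_vec_lincomb:
  assumes "c \<in> A" "x \<in> dom c"
  shows "coord_vec A c x (a *\<^sub>R u + b *\<^sub>R w) = (\<lambda>d. a *\<^sub>R coord_vec A c x u d + b *\<^sub>R coord_vec A c x w d)"
  using assms by (auto simp: coord_vec_def dderiv_linear[OF transition_differentiable] fun_eq_iff)

lemma tangents_coord_vec: "c \<in> A \<Longrightarrow> x \<in> dom c \<Longrightarrow> tangents x (map (coord_vec A c x) us)"
  by (simp add: image_subset_iff coord_vec_in)

lemma map_coord_vec:
  "c \<in> A \<Longrightarrow> x \<in> dom c \<Longrightarrow> tangents x vs \<Longrightarrow> map (coord_vec A c x) (map (\<lambda>v. v c) vs) = vs"
  by (induction vs) (auto simp: coord_vec_of_tangent)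

lemma coord_vec_change:
  assumes "c \<in> A" "d \<in> A" "x \<in> dom c" "x \<in> dom d"
  shows "coord_vec A c x u = coord_vec A d x (jac c d x u)"
  using coord_vec_of_tangent[OF assms(2,4) coord_vec_in[OF assms(1,3)]] assms
  by (simp add: coord_vec_coord)

section \<open>Forms in charts\<close>

text \<open>
  A chart identifies the covectors at a point with the alternating functions of coordinate vectors, so
  that all pointwise algebra can be done in the model space.
\<close>

lemma covectors_iff:
  assumes c: "c \<in> A" "x \<in> dom c"
  shows "\<eta> \<in> covectors A x k \<longleftrightarrow>
    (\<forall>vs. \<not> tangents x vs \<longrightarrow> \<eta> vs = 0) \<and> alt (int k) (\<lambda>us. \<eta> (map (coord_vec A c x) us))"
    (is "_ \<longleftrightarrow> ?off \<and> alt _ (\<lambda>us. \<eta> (map ?cv us))")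
proof
  assume \<eta>: "\<eta> \<in> covectors A x k"
  have zero: "\<eta> vs = 0" if "\<not> (length vs = k \<and> tangents x vs)" for vs
    using \<eta> that unfolding covectors_def by blast
  have lin: "\<eta> (vs[i := (\<lambda>c. a *\<^sub>R u c + b *\<^sub>R w c)]) = a * \<eta> (vs[i := u]) + b * \<eta> (vs[i := w])"
    if "length vs = k" "tangents x vs" "i < k" "u \<in> tangent_space A x" "w \<in> tangent_space A x" for vs i u w a b
    using \<eta> that unfolding covectors_def by blast
  have adj: "\<eta> vs = 0" if "length vs = k" "tangents x vs" "i < j" "j < k" "vs ! i = vs ! j" for vs i j
    using \<eta> that unfolding covectors_def by blast
  have "alt (int k) (\<lambda>us. \<eta> (map ?cv us))"
    unfolding alt_def
  proof (intro conjI allI impI)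
    fix us :: "'e list" assume "int (length us) \<noteq> int k"
    then show "\<eta> (map ?cv us) = 0" by (intro zero) auto
  next
    fix us vs u w and a b :: real
    show "\<eta> (map ?cv (us @ (a *\<^sub>R u + b *\<^sub>R w) # vs)) =
        a * \<eta> (map ?cv (us @ u # vs)) + b * \<eta> (map ?cv (us @ w # vs))"
    proof (cases "length us + Suc (length vs) = k")
      case True
      have "(map ?cv us @ ?cv 0 # map ?cv vs)[length us := z] = map ?cv us @ z # map ?cv vs" for z
        using list_update_length[of "map ?cv us"] by simp
      then show ?thesis
        using lin[of "map ?cv us @ ?cv 0 # map ?cv vs" "length us" "?cv u" "?cv w" a b] True
          coord_vec_in[OF c] by (auto simp: coord_vec_lincomb[OF c])
    qed (simp add: zero)
  next
    fix us vs a
    show "\<eta> (map ?cv (us @ a # a # vs)) = 0"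
    proof (cases "length us + Suc (Suc (length vs)) = k")
      case True
      then show ?thesis
        using coord_vec_in[OF c] by (intro adj[of _ "length us" "Suc (length us)"]) (auto simp: nth_append)
    qed (simp add: zero)
  qed
  then show "?off \<and> alt (int k) (\<lambda>us. \<eta> (map ?cv us))" using zero by blast
next
  assume R: "?off \<and> alt (int k) (\<lambda>us. \<eta> (map ?cv us))"
  then have alt: "alt (int k) (\<lambda>us. \<eta> (map ?cv us))" by simp
  have coords: "\<eta> vs = \<eta> (map ?cv (map (\<lambda>v. v c) vs))" if "tangents x vs" for vs
    using map_coord_vec[OF c that] by simp
  show "\<eta> \<in> covectors A x k"
    unfolding covectors_def
  proof (intro CollectI conjI allI impI)
    fix vs assume n: "\<not> (length vs = k \<and> tangents x vs)"
    show "\<eta> vs = 0"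
    proof (cases "tangents x vs")
      case True
      then show ?thesis using coords[OF True] n alt_length[OF alt, of "map (\<lambda>v. v c) vs"] by simp
    qed (use R in blast)
  next
    fix vs i u w and a b :: real
    assume h: "length vs = k \<and> tangents x vs \<and> i < k \<and> u \<in> tangent_space A x \<and> w \<in> tangent_space A x"
    let ?v = "\<lambda>d. a *\<^sub>R u d + b *\<^sub>R w d"
    let ?l = "map (\<lambda>v. v c) (take i vs)" and ?r = "map (\<lambda>v. v c) (drop (Suc i) vs)"
    have v: "?v = ?cv (a *\<^sub>R u c + b *\<^sub>R w c)"
      using h by (simp add: coord_vec_lincomb[OF c] coord_vec_of_tangent[OF c])
    have tl: "tangents x (take i vs)" "tangents x (drop (Suc i) vs)"
      using h by (auto dest: in_set_takeD in_set_dropD)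
    have up: "\<eta> (vs[i := z]) = \<eta> (map ?cv (?l @ z c # ?r))" if "z \<in> tangent_space A x" for z
    proof -
      have "vs[i := z] = take i vs @ z # drop (Suc i) vs" using h by (simp add: upd_conv_take_nth_drop)
      then have "map (\<lambda>v. v c) (vs[i := z]) = ?l @ z c # ?r" by simp
      moreover have "tangents x (vs[i := z])" using h that set_update_subset_insert by fastforce
      ultimately show ?thesis using coords[of "vs[i := z]"] by (simp only:)
    qed
    have "?v \<in> tangent_space A x" unfolding v by (rule coord_vec_in[OF c])
    from up[OF this] show "\<eta> (vs[i := ?v]) = a * \<eta> (vs[i := u]) + b * \<eta> (vs[i := w])"
      using h by (simp only: up alt_lincomb[OF alt])
  next
    fix vs :: "('m, 'e) tvec list" and i j
    assume h: "length vs = k \<and> tangents x vs \<and> i < j \<and> j < k \<and> vs ! i = vs ! j"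
    then show "\<eta> vs = 0"
      using alt_repeated[OF alt, of i j "map (\<lambda>v. v c) vs"] coords[of vs] by simp
  qed
qed

lemma local_form_at:
  "c \<in> A \<Longrightarrow> x \<in> dom c \<Longrightarrow> local_form A c \<omega> (snd c x) = (\<lambda>us. \<omega> x (map (coord_vec A c x) us))"
  by (rule ext) (simp add: local_form_def)

lemmas local_form_snd = local_form_at[THEN fun_cong]

text \<open>
  The integer degree of \<open>alt\<close> makes this description uniform: for negative degree its right-hand
  side says that the form is zero.
\<close>

lemma forms_iff:
  "\<omega> \<in> forms A k \<longleftrightarrow>
    (\<forall>x vs. \<not> tangents x vs \<longrightarrow> \<omega> x vs = 0) \<and> (\<forall>c\<in>A. chart_form k (im c) (local_form A c \<omega>))"
proof (cases "k < 0")
  case True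
  show ?thesis
  proof
    assume "\<omega> \<in> forms A k"
    then have "\<omega> = 0" using True by (simp add: forms_def)
    then show "(\<forall>x vs. \<not> tangents x vs \<longrightarrow> \<omega> x vs = 0) \<and> (\<forall>c\<in>A. chart_form k (im c) (local_form A c \<omega>))"
      by (simp add: chart_form_def local_form_def alt_def smooth_on_const)
  next
    assume R: "(\<forall>x vs. \<not> tangents x vs \<longrightarrow> \<omega> x vs = 0) \<and> (\<forall>c\<in>A. chart_form k (im c) (local_form A c \<omega>))"
    have "\<omega> x vs = 0" for x vs
    proof (cases "tangents x vs")
      case t: True
      obtain c where c: "c \<in> A" "x \<in> dom c" using chart_ex by blast
      have "alt k (local_form A c \<omega> (snd c x))" using R c by (simp add: chart_form_def)
      then have "local_form A c \<omega> (snd c x) (map (\<lambda>v. v c) vs) = 0"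
        using True by (intro alt_length) auto
      then show ?thesis using c t by (simp add: local_form_snd map_coord_vec del: map_map)
    qed (use R in blast)
    then have "\<omega> = 0" by (simp add: fun_eq_iff)
    then show "\<omega> \<in> forms A k" using True by (simp add: forms_def)
  qed
next
  case False
  then have k: "int (nat k) = k" by simp
  show ?thesis
  proof
    assume \<omega>: "\<omega> \<in> forms A k"
    then have cov: "\<omega> x \<in> covectors A x (nat k)" for x using False by (simp add: forms_def)
    have "chart_form k (im c) (local_form A c \<omega>)" if c: "c \<in> A" for c
      unfolding chart_form_def
    proof (intro conjI ballI allI)
      fix y assume "y \<in> im c"
      then obtain x where x: "x \<in> dom c" "y = snd c x" by auto
      have "alt k (\<lambda>us. \<omega> x (map (coord_vec A c x) us))"
        using cov covectors_iff[OF c x(1)] k by metis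
      then show "alt k (local_form A c \<omega> y)"
        using x c by (simp add: local_form_at)
    next
      fix us
      show "smooth_on (im c) (\<lambda>y. local_form A c \<omega> y us)"
      proof (cases "length us = nat k")
        case True
        then show ?thesis using \<omega> c False by (simp add: forms_def)
      next
        case l: False
        have "local_form A c \<omega> y us = 0" for y
          using cov[of "pt c y"] l unfolding local_form_def covectors_def by simp
        then show ?thesis by (simp add: smooth_on_const)
      qed
    qed
    moreover have "\<omega> x vs = 0" if "\<not> tangents x vs" for x vs
      using cov[of x] that unfolding covectors_def by blast
    ultimately show "(\<forall>x vs. \<not> tangents x vs \<longrightarrow> \<omega> x vs = 0) \<and> (\<forall>c\<in>A. chart_form k (im c) (local_form A c \<omega>))"
      by blast
  next
    assume R: "(\<forall>x vs. \<not> tangents x vs \<longrightarrow> \<omega> x vs = 0) \<and> (\<forall>c\<in>A. chart_form k (im c) (local_form A c \<omega>))"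
    have "\<omega> x \<in> covectors A x (nat k)" for x
    proof -
      obtain c where c: "c \<in> A" "x \<in> dom c" using chart_ex by blast
      then have "alt k (local_form A c \<omega> (snd c x))" using R by (simp add: chart_form_def)
      then show ?thesis
        using R c k by (simp add: covectors_iff[OF c] local_form_at)
    qed
    then show "\<omega> \<in> forms A k" using R False by (simp add: forms_def chart_form_def)
  qed
qed

lemma form_off: "\<omega> \<in> forms A k \<Longrightarrow> \<not> tangents x vs \<Longrightarrow> \<omega> x vs = 0"
  and form_local: "\<omega> \<in> forms A k \<Longrightarrow> c \<in> A \<Longrightarrow> chart_form k (im c) (local_form A c \<omega>)"
  by (auto simp: forms_iff)

lemma form_eqI:
  assumes "\<And>x vs. \<not> tangents x vs \<Longrightarrow> \<omega> x vs = \<omega>' x vs"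
    and "\<And>c y us. c \<in> A \<Longrightarrow> y \<in> im c \<Longrightarrow> local_form A c \<omega> y us = local_form A c \<omega>' y us"
  shows "\<omega> = \<omega>'"
proof (intro ext)
  fix x vs
  obtain c where c: "c \<in> A" "x \<in> dom c" using chart_ex by blast
  show "\<omega> x vs = \<omega>' x vs"
  proof (cases "tangents x vs")
    case True
    have "local_form A c \<omega> (snd c x) (map (\<lambda>v. v c) vs) = local_form A c \<omega>' (snd c x) (map (\<lambda>v. v c) vs)"
      using c by (intro assms(2)) auto
    then show ?thesis using c True by (simp add: local_form_snd map_coord_vec del: map_map)
  qed (rule assms(1))
qed

lemma local_form_change:
  assumes "c \<in> A" "d \<in> A" "y \<in> snd c ` (dom c \<inter> dom d)"
  shows "local_form A c \<omega> y us = local_form A d \<omega> (transition c d y) (map (dderiv (transition c d) y) us)"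
proof -
  obtain x where x: "x \<in> dom c" "x \<in> dom d" "y = snd c x" using assms(3) by auto
  then show ?thesis
    using assms coord_vec_change[OF assms(1,2) x(1,2)]
    by (auto simp: local_form_snd o_def intro!: arg_cong[where f = "\<omega> x"])
qed

lemma transition_image: "c \<in> A \<Longrightarrow> transition c d ` snd c ` (dom c \<inter> dom d) \<subseteq> im d"
  by auto

subsection \<open>The exterior derivative\<close>

lemma ext_deriv_off: "\<not> tangents x vs \<Longrightarrow> ext_deriv A \<omega> x vs = 0"
  by (simp add: ext_deriv_def)

text \<open>
  The exterior derivative at a point is defined by one chosen chart. Naturality under the transition
  map to an arbitrary chart shows that the choice is immaterial, hence also that \<open>d\<omega>\<close> is smooth in every
  chart.
\<close>

lemma local_form_ext_deriv:
  assumes \<omega>: "\<omega> \<in> forms A k" and c: "c \<in> A" "y \<in> im c"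
  shows "local_form A c (ext_deriv A \<omega>) y us = chart_d (local_form A c \<omega>) y us"
proof -
  obtain B :: "'e set" where B: "frame B" using frame_ex by blast
  obtain x where x: "x \<in> dom c" "y = snd c x" using c by auto
  define d where "d = (SOME d. d \<in> A \<and> x \<in> fst d)"
  have d: "d \<in> A" "x \<in> dom d" unfolding d_def using someI_ex chart_ex[of x] by (metis (no_types, lifting))+
  let ?S = "snd c ` (dom c \<inter> dom d)" and ?\<tau> = "transition c d"
  have S: "open ?S" "y \<in> ?S" using open_overlap c d x by auto
  have "local_form A c (ext_deriv A \<omega>) y us = ext_deriv A \<omega> x (map (coord_vec A c x) us)"
    using c x by (simp add: local_form_snd)
  also have "\<dots> = chart_d (local_form A d \<omega>) (snd d x) (map (\<lambda>u. coord_vec A c x u d) us)"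
    using tangents_coord_vec[OF c(1) x(1)]
    by (simp add: ext_deriv_def Let_def d_def[symmetric] chart_d_def altsum_def o_def)
  also have "map (\<lambda>u. coord_vec A c x u d) us = map (dderiv ?\<tau> y) us"
    using d x by (simp add: coord_vec_coord)
  also have "snd d x = ?\<tau> y" using c x by simp
  also have "chart_d (local_form A d \<omega>) (?\<tau> y) (map (dderiv ?\<tau> y) us) =
      chart_d (\<lambda>y us. local_form A d \<omega> (?\<tau> y) (map (dderiv ?\<tau> y) us)) y us"
    by (rule chart_d_pullback[OF B S smooth_transition[OF c(1) d(1)] transition_image[OF c(1)]
          open_im[OF d(1)] form_local[OF \<omega> d(1)], symmetric])
  also have "\<dots> = chart_d (local_form A c \<omega>) y us"
    by (rule chart_d_cong[OF S _ chart_form_mono[OF form_local[OF \<omega> c(1)]]])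
       (auto simp only: local_form_change[OF c(1) d(1)])
  finally show ?thesis .
qed

lemma ext_deriv_form:
  assumes "\<omega> \<in> forms A k"
  shows "ext_deriv A \<omega> \<in> forms A (k + 1)"
  unfolding forms_iff
proof (intro conjI allI impI ballI)
  fix c assume c: "c \<in> A"
  show "chart_form (k + 1) (im c) (local_form A c (ext_deriv A \<omega>))"
    by (rule chart_form_cong[OF open_im[OF c] _ chart_form_chart_d[OF open_im[OF c] form_local[OF assms c]]])
       (simp add: local_form_ext_deriv[OF assms c])
qed (simp add: ext_deriv_off)

lemma ext_deriv_ext_deriv:
  assumes "\<omega> \<in> forms A k"
  shows "ext_deriv A (ext_deriv A \<omega>) = 0"
proof (rule form_eqI)
  fix c y us assume c: "c \<in> A" "y \<in> im c"
  have "local_form A c (ext_deriv A (ext_deriv A \<omega>)) y us = chart_d (local_form A c (ext_deriv A \<omega>)) y us"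
    by (rule local_form_ext_deriv[OF ext_deriv_form[OF assms] c])
  also have "\<dots> = chart_d (chart_d (local_form A c \<omega>)) y us"
    by (rule chart_d_cong[OF open_im[OF c(1)] c(2) _ chart_form_chart_d[OF open_im[OF c(1)] form_local[OF assms c(1)]]])
       (simp add: local_form_ext_deriv[OF assms c(1)])
  also have "\<dots> = 0" by (rule chart_d_chart_d[OF open_im[OF c(1)] form_local[OF assms c(1)] c(2)])
  finally show "local_form A c (ext_deriv A (ext_deriv A \<omega>)) y us = local_form A c 0 y us"
    by (simp add: local_form_def)
qed (simp add: ext_deriv_off)

definition lincomb :: "real \<Rightarrow> ('m, 'e) form \<Rightarrow> real \<Rightarrow> ('m, 'e) form \<Rightarrow> ('m, 'e) form" where
  "lincomb a \<omega> b \<omega>' = (\<lambda>x vs. a * \<omega> x vs + b * \<omega>' x vs)"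

lemma local_form_lincomb:
  "local_form A c (lincomb a \<omega> b \<omega>') y us = a * local_form A c \<omega> y us + b * local_form A c \<omega>' y us"
  by (simp add: lincomb_def local_form_def)

lemma lincomb_form:
  assumes "\<omega> \<in> forms A k" "\<omega>' \<in> forms A k"
  shows "lincomb a \<omega> b \<omega>' \<in> forms A k"
  unfolding forms_iff
proof (intro conjI allI impI ballI)
  fix x vs assume "\<not> tangents x vs"
  then show "lincomb a \<omega> b \<omega>' x vs = 0" using assms by (simp add: lincomb_def form_off)
next
  fix c assume c: "c \<in> A"
  note l = form_local[OF assms(1) c] form_local[OF assms(2) c]
  show "chart_form k (im c) (local_form A c (lincomb a \<omega> b \<omega>'))"
    unfolding chart_form_def
  proof (intro conjI ballI allI)
    fix y assume y: "y \<in> im c"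
    show "alt k (local_form A c (lincomb a \<omega> b \<omega>') y)"
      using chart_form_alt[OF l(1) y] chart_form_alt[OF l(2) y]
      unfolding alt_def local_form_lincomb by (simp add: algebra_simps)
  qed (simp add: local_form_lincomb smooth_on_add smooth_on_cmult chart_form_smooth[OF l(1)]
      chart_form_smooth[OF l(2)] open_im[OF c])
qed

lemma ext_deriv_lincomb:
  assumes "\<omega> \<in> forms A k" "\<omega>' \<in> forms A k"
  shows "ext_deriv A (lincomb a \<omega> b \<omega>') = lincomb a (ext_deriv A \<omega>) b (ext_deriv A \<omega>')"
proof (rule form_eqI)
  fix c y us assume c: "c \<in> A" "y \<in> im c"
  have "dderiv (\<lambda>z. local_form A c (lincomb a \<omega> b \<omega>') z ws) y v =
     a * dderiv (\<lambda>z. local_form A c \<omega> z ws) y v + b * dderiv (\<lambda>z. local_form A c \<omega>' z ws) y v" for ws v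
    unfolding local_form_lincomb
    by (rule dderiv_lincomb) (use chart_form_differentiable form_local assms c in blast)+
  then show "local_form A c (ext_deriv A (lincomb a \<omega> b \<omega>')) y us =
      local_form A c (lincomb a (ext_deriv A \<omega>) b (ext_deriv A \<omega>')) y us"
    by (simp add: local_form_ext_deriv[OF lincomb_form[OF assms] c] local_form_lincomb
        local_form_ext_deriv[OF assms(1) c] local_form_ext_deriv[OF assms(2) c]
        chart_d_def altsum_add altsum_cmult)
qed (simp add: ext_deriv_off lincomb_def)

section \<open>Multivector fields in charts\<close>

definition rep_field :: "('m, 'e) chart \<Rightarrow> 'e mv_rep \<Rightarrow> ('m, 'e) mvfield" where
  "rep_field c T x = (\<lambda>\<eta>. \<Sum>(f, I)\<leftarrow>T. f (snd c x) * wedge A x (map (coord_vec A c x) I) \<eta>)"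

text \<open>
  The condition on the values of a multivector field at points follows from its local representations.
\<close>

lemma mvfields_iff:
  "U \<in> mvfields A p \<longleftrightarrow> (\<forall>c\<in>A. \<exists>T. smooth_rep p (im c) T \<and> (\<forall>x\<in>dom c. U x = rep_field c T x))"
proof
  assume U: "U \<in> mvfields A p"
  show "\<forall>c\<in>A. \<exists>T. smooth_rep p (im c) T \<and> (\<forall>x\<in>dom c. U x = rep_field c T x)"
  proof
    fix c assume "c \<in> A"
    then obtain m :: nat and f us where
      h: "\<And>i. i < m \<Longrightarrow> length (us i) = p \<and> smooth_on (im c) (f i)"
        "\<And>x. x \<in> dom c \<Longrightarrow> U x = (\<lambda>\<eta>. \<Sum>i<m. f i (snd c x) * wedge A x (map (coord_vec A c x) (us i)) \<eta>)"
      using U unfolding mvfields_def by blast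
    show "\<exists>T. smooth_rep p (im c) T \<and> (\<forall>x\<in>dom c. U x = rep_field c T x)"
      by (rule exI[of _ "map (\<lambda>i. (f i, us i)) [0..<m]"])
         (auto simp: smooth_rep_def rep_field_def h o_def interv_sum_list_conv_sum_set_nat atLeast0LessThan)
  qed
next
  assume R: "\<forall>c\<in>A. \<exists>T. smooth_rep p (im c) T \<and> (\<forall>x\<in>dom c. U x = rep_field c T x)"
  have idx: "rep_field c T x = (\<lambda>\<eta>. \<Sum>i<length T. fst (T ! i) (snd c x) *
      wedge A x (map (coord_vec A c x) (snd (T ! i))) \<eta>)" for c T x
    by (simp add: rep_field_def sum_list_sum_nth atLeast0LessThan case_prod_unfold)
  have len: "length (snd (T ! i)) = p" "smooth_on (im c) (fst (T ! i))"
    if "smooth_rep p (im c) T" "i < length T" for T i c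
    using that nth_mem unfolding smooth_rep_def by fastforce+
  show "U \<in> mvfields A p"
    unfolding mvfields_def
  proof (intro CollectI conjI allI ballI)
    fix x
    obtain c where c: "c \<in> A" "x \<in> dom c" using chart_ex by blast
    then obtain T where T: "smooth_rep p (im c) T" "U x = rep_field c T x" using R by blast
    show "U x \<in> multivectors A x p"
      unfolding multivectors_def T(2) idx
      by (intro CollectI exI[of _ "length T"] exI[of _ "\<lambda>i. fst (T ! i) (snd c x)"]
          exI[of _ "\<lambda>i. map (coord_vec A c x) (snd (T ! i))"])
         (use len[OF T(1)] tangents_coord_vec[OF c] in auto)
  next
    fix c assume "c \<in> A"
    then obtain T where T: "smooth_rep p (im c) T" "\<forall>x\<in>dom c. U x = rep_field c T x" using R by blast
    show "\<exists>m f us. (\<forall>i<m. length (us i) = p \<and> smooth_on (im c) (f i)) \<and>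
        (\<forall>x\<in>dom c. U x = (\<lambda>\<eta>. \<Sum>i<(m::nat). f i (snd c x) * wedge A x (map (coord_vec A c x) (us i)) \<eta>))"
      by (intro exI[of _ "length T"] exI[of _ "\<lambda>i. fst (T ! i)"] exI[of _ "\<lambda>i. snd (T ! i)"])
         (use len[OF T(1)] T(2) idx in auto)
  qed
qed

lemma mvfield_rep_field:
  assumes "U \<in> mvfields A p" "c \<in> A"
  obtains T where "smooth_rep p (im c) T" "\<forall>x\<in>dom c. U x = rep_field c T x"
  using assms unfolding mvfields_iff by blast

text \<open>
  If the degrees do not match, the contracted covector need not be one of degree \<open>p\<close>. Both sides are then
  zero.
\<close>

lemma local_form_int_prod:
  assumes \<omega>: "\<omega> \<in> forms A k" and c: "c \<in> A" "y \<in> im c"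
    and T: "smooth_rep p (im c) T" "\<forall>x\<in>dom c. U x = rep_field c T x"
  shows "local_form A c (int_prod U \<omega>) y us = chart_int T (local_form A c \<omega>) y us"
proof -
  obtain x where x: "x \<in> dom c" "y = snd c x" using c by auto
  let ?cv = "coord_vec A c x"
  have "wedge A x (map ?cv I) (\<lambda>ws. \<omega> x (ws @ map ?cv us)) = \<omega> x (map ?cv (I @ us))"
    if "length I = p" for I
  proof -
    let ?\<eta> = "\<lambda>ws. \<omega> x (ws @ map ?cv us)"
    have alt: "alt k (\<lambda>us. \<omega> x (map ?cv us))"
      using chart_form_alt[OF form_local[OF \<omega> c(1)] c(2)] x c by (simp add: local_form_at)
    show ?thesis
    proof (cases "int p + int (length us) = k")
      case True
      have "?\<eta> \<in> covectors A x p"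
        using alt_contract_right[OF alt, of us] True form_off[OF \<omega>]
        by (auto simp: covectors_iff[OF c(1) x(1)] algebra_simps)
      then show ?thesis using that by (simp add: wedge_def)
    next
      case False
      then have "\<omega> x (map ?cv (I @ us)) = 0"
        using alt_length[OF alt, of "I @ us"] that by simp
      then show ?thesis by (simp add: wedge_def)
    qed
  qed
  then have "rep_field c T x (\<lambda>ws. \<omega> x (ws @ map ?cv us)) = (\<Sum>(f, I)\<leftarrow>T. f y * \<omega> x (map ?cv (I @ us)))"
    unfolding rep_field_def x(2)
    by (intro arg_cong[where f = sum_list] map_cong refl) (use T(1) in \<open>auto simp: smooth_rep_def\<close>)
  then show ?thesis
    using bspec[OF T(2) x(1)] x c by (simp add: local_form_snd int_prod_def chart_int_def)
qed

lemma int_prod_off: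
  assumes "U \<in> mvfields A p" "\<omega> \<in> forms A k" "\<not> tangents x vs"
  shows "int_prod U \<omega> x vs = 0"
proof -
  obtain c where c: "c \<in> A" "x \<in> dom c" using chart_ex by blast
  obtain T where T: "smooth_rep p (im c) T" "U x = rep_field c T x" using mvfield_rep_field[OF assms(1) c(1)] c by metis
  have "(\<lambda>ws. \<omega> x (ws @ vs)) = (\<lambda>_. 0)" using form_off[OF assms(2)] assms(3) by auto
  moreover have "rep_field c T x (\<lambda>_. 0) = 0" by (simp add: rep_field_def wedge_def case_prod_unfold)
  ultimately show ?thesis by (simp add: int_prod_def T(2))
qed

lemma int_prod_form:
  assumes "U \<in> mvfields A p" "\<omega> \<in> forms A k"
  shows "int_prod U \<omega> \<in> forms A (k - int p)"
  unfolding forms_iff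
proof (intro conjI allI impI ballI)
  fix c assume c: "c \<in> A"
  obtain T where T: "smooth_rep p (im c) T" "\<forall>x\<in>dom c. U x = rep_field c T x"
    by (rule mvfield_rep_field[OF assms(1) c]) (rule that)
  show "chart_form (k - int p) (im c) (local_form A c (int_prod U \<omega>))"
    by (rule chart_form_cong[OF open_im[OF c] _ chart_form_chart_int[OF open_im[OF c] T(1) form_local[OF assms(2) c]]])
       (use local_form_int_prod[OF assms(2) c _ T] in simp)
qed (rule int_prod_off[OF assms])

lemma int_prod_lincomb:
  assumes "U \<in> mvfields A p" "\<omega> \<in> forms A k" "\<omega>' \<in> forms A k"
  shows "int_prod U (lincomb a \<omega> b \<omega>') = lincomb a (int_prod U \<omega>) b (int_prod U \<omega>')"
proof (rule form_eqI)
  fix x vs assume "\<not> tangents x vs"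
  then show "int_prod U (lincomb a \<omega> b \<omega>') x vs = lincomb a (int_prod U \<omega>) b (int_prod U \<omega>') x vs"
    using int_prod_off[OF assms(1) lincomb_form[OF assms(2,3)]] int_prod_off[OF assms(1,2)]
      int_prod_off[OF assms(1,3)] by (simp add: lincomb_def)
next
  fix c y us assume c: "c \<in> A" "y \<in> im c"
  obtain T where T: "smooth_rep p (im c) T" "\<forall>x\<in>dom c. U x = rep_field c T x"
    by (rule mvfield_rep_field[OF assms(1) c(1)]) (rule that)
  note l = local_form_int_prod[OF _ c T(1) T(2)]
  have "chart_int T (local_form A c (lincomb a \<omega> b \<omega>')) y us =
      a * chart_int T (local_form A c \<omega>) y us + b * chart_int T (local_form A c \<omega>') y us"
    unfolding chart_int_def local_form_lincomb
    by (induction T) (auto simp: algebra_simps)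
  then show "local_form A c (int_prod U (lincomb a \<omega> b \<omega>')) y us =
      local_form A c (lincomb a (int_prod U \<omega>) b (int_prod U \<omega>')) y us"
    by (simp add: local_form_lincomb l[OF assms(2)] l[OF assms(3)] l[OF lincomb_form[OF assms(2,3)]])
qed

lemma int_prod_commute:
  assumes "U \<in> mvfields A p" "V \<in> mvfields A q" "\<omega> \<in> forms A k"
  shows "int_prod U (int_prod V \<omega>) = scale_form ((-1) ^ (p * q)) (int_prod V (int_prod U \<omega>))"
proof (rule form_eqI)
  fix x vs assume "\<not> tangents x vs"
  then show "int_prod U (int_prod V \<omega>) x vs = scale_form ((-1) ^ (p * q)) (int_prod V (int_prod U \<omega>)) x vs"
    using int_prod_off[OF assms(1) int_prod_form[OF assms(2,3)]]
      int_prod_off[OF assms(2) int_prod_form[OF assms(1,3)]] by (simp add: scale_form_def)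
next
  fix c y us assume c: "c \<in> A" "y \<in> im c"
  obtain T where T: "smooth_rep p (im c) T" "\<forall>x\<in>dom c. U x = rep_field c T x"
    by (rule mvfield_rep_field[OF assms(1) c(1)]) (rule that)
  obtain T' where T': "smooth_rep q (im c) T'" "\<forall>x\<in>dom c. V x = rep_field c T' x"
    by (rule mvfield_rep_field[OF assms(2) c(1)]) (rule that)
  note l = local_form_int_prod[OF _ c T(1) T(2)]
  note l' = local_form_int_prod[OF _ c T'(1) T'(2)]
  have "local_form A c (int_prod U (int_prod V \<omega>)) y us = chart_int T (chart_int T' (local_form A c \<omega>)) y us"
    using l[OF int_prod_form[OF assms(2,3)]] l'[OF assms(3)] by (simp add: chart_int_def[of T])
  also have "\<dots> = (-1) ^ (p * q) * chart_int T' (chart_int T (local_form A c \<omega>)) y us"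
    by (rule chart_int_chart_int_commute[OF T(1) T'(1) form_local[OF assms(3) c(1)] c(2)])
  also have "chart_int T' (chart_int T (local_form A c \<omega>)) y us = local_form A c (int_prod V (int_prod U \<omega>)) y us"
    using l'[OF int_prod_form[OF assms(1,3)]] l[OF assms(3)] by (simp add: chart_int_def[of T'])
  finally show "local_form A c (int_prod U (int_prod V \<omega>)) y us =
      local_form A c (scale_form ((-1) ^ (p * q)) (int_prod V (int_prod U \<omega>))) y us"
    by (simp add: local_form_def scale_form_def)
qed

lemma mvfields_lincomb:
  assumes "U \<in> mvfields A p" "V \<in> mvfields A p"
  shows "(\<lambda>x \<eta>. a * U x \<eta> + b * V x \<eta>) \<in> mvfields A p"
  unfolding mvfields_iff
proof
  fix c assume c: "c \<in> A"
  obtain T where T: "smooth_rep p (im c) T" "\<forall>x\<in>dom c. U x = rep_field c T x"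
    by (rule mvfield_rep_field[OF assms(1) c]) (rule that)
  obtain T' where T': "smooth_rep p (im c) T'" "\<forall>x\<in>dom c. V x = rep_field c T' x"
    by (rule mvfield_rep_field[OF assms(2) c]) (rule that)
  let ?sc = "\<lambda>a. map (\<lambda>(f, I). (\<lambda>y. a * f y :: real, I))"
  have sc: "rep_field c (?sc r L) x \<eta> = r * rep_field c L x \<eta>" for r L x \<eta>
    by (induction L) (auto simp: rep_field_def algebra_simps)
  have "rep_field c (?sc a T @ ?sc b T') x \<eta> = a * rep_field c T x \<eta> + b * rep_field c T' x \<eta>" for x \<eta>
    unfolding sc[symmetric] by (simp add: rep_field_def)
  moreover have "smooth_rep p (im c) (?sc a T @ ?sc b T')"
    using T(1) T'(1) open_im[OF c] by (auto simp: smooth_rep_def intro!: smooth_on_cmult)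
  ultimately show "\<exists>T. smooth_rep p (im c) T \<and> (\<forall>x\<in>dom c. (\<lambda>\<eta>. a * U x \<eta> + b * V x \<eta>) = rep_field c T x)"
    using T(2) T'(2) by (intro exI[of _ "?sc a T @ ?sc b T'"]) auto
qed

lemma lie_deriv_form:
  assumes "U \<in> mvfields A p" "\<omega> \<in> forms A k"
  shows "lie_deriv A p U \<omega> \<in> forms A (k - int p + 1)"
proof -
  have "lie_deriv A p U \<omega> = lincomb 1 (ext_deriv A (int_prod U \<omega>)) (- ((-1) ^ p)) (int_prod U (ext_deriv A \<omega>))"
    by (simp add: lie_deriv_def lincomb_def scale_form_def fun_eq_iff)
  moreover have "int_prod U (ext_deriv A \<omega>) \<in> forms A (k - int p + 1)"
    using int_prod_form[OF assms(1) ext_deriv_form[OF assms(2)]] by (simp add: algebra_simps)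
  ultimately show ?thesis
    using lincomb_form ext_deriv_form[OF int_prod_form[OF assms]] by simp
qed

lemma local_form_lie_deriv:
  assumes "U \<in> mvfields A p" "\<omega> \<in> forms A k" and c: "c \<in> A" "y \<in> im c"
    and T: "smooth_rep p (im c) T" "\<forall>x\<in>dom c. U x = rep_field c T x"
  shows "local_form A c (lie_deriv A p U \<omega>) y us = chart_lie p T (local_form A c \<omega>) y us"
proof -
  have l: "local_form A c (int_prod U \<omega>') z us = chart_int T (local_form A c \<omega>') z us"
    if "\<omega>' \<in> forms A k'" "z \<in> im c" for \<omega>' k' z us
    by (rule local_form_int_prod[OF that(1) c(1) that(2) T(1) T(2)])
  have "local_form A c (ext_deriv A (int_prod U \<omega>)) y us = chart_d (local_form A c (int_prod U \<omega>)) y us"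
    by (rule local_form_ext_deriv[OF int_prod_form[OF assms(1,2)] c])
  also have "\<dots> = chart_d (chart_int T (local_form A c \<omega>)) y us"
    by (rule chart_d_cong[OF open_im[OF c(1)] c(2) _ chart_form_chart_int[OF open_im[OF c(1)] T(1) form_local[OF assms(2) c(1)]]])
       (simp add: l[OF assms(2)])
  finally have 1: "local_form A c (ext_deriv A (int_prod U \<omega>)) y us = chart_d (chart_int T (local_form A c \<omega>)) y us" .
  have "local_form A c (int_prod U (ext_deriv A \<omega>)) y us = chart_int T (local_form A c (ext_deriv A \<omega>)) y us"
    by (rule l[OF ext_deriv_form[OF assms(2)] c(2)])
  also have "\<dots> = chart_int T (chart_d (local_form A c \<omega>)) y us"
    by (simp add: chart_int_def local_form_ext_deriv[OF assms(2) c])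
  finally have 2: "local_form A c (int_prod U (ext_deriv A \<omega>)) y us = chart_int T (chart_d (local_form A c \<omega>)) y us" .
  have "local_form A c (lie_deriv A p U \<omega>) y us =
      local_form A c (ext_deriv A (int_prod U \<omega>)) y us - (-1) ^ p * local_form A c (int_prod U (ext_deriv A \<omega>)) y us"
    by (simp add: lie_deriv_def local_form_def scale_form_def)
  then show ?thesis by (simp add: 1 2 chart_lie_def)
qed

section \<open>Existence and uniqueness of the Schouten bracket\<close>

text \<open>
  The constant form in a chart is multiplied by a bump function and extended by zero. The support is
  compact, hence closed because the manifold is Hausdorff, so the extension is smooth. Therefore a
  multivector field is determined by its contractions with globally defined forms.
\<close>

lemma covector_extends:
  assumes \<eta>: "\<eta> \<in> covectors A x k"
  shows "\<exists>\<omega>\<in>forms A (int k). \<omega> x = \<eta>"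
proof -
  obtain B :: "'e set" where B: "frame B" using frame_ex by blast
  obtain c where c: "c \<in> A" "x \<in> dom c" using chart_ex by blast
  obtain r where r: "r > 0" "cball (snd c x) r \<subseteq> im c"
    using open_im[OF c(1)] c(2) by (meson imageI open_contains_cball)
  obtain \<psi> :: "'e \<Rightarrow> real" where \<psi>: "smooth_on UNIV \<psi>" "\<psi> (snd c x) = 1" "\<And>y. y \<notin> cball (snd c x) r \<Longrightarrow> \<psi> y = 0"
    using bump_exists[OF r(1)] by blast
  define K where "K = pt c ` cball (snd c x) r"
  have "continuous_on (cball (snd c x) r) (pt c)"
    by (rule continuous_on_subset[OF homeomorphism_cont2[OF homeo[OF c(1)]] r(2)])
  then have "closed K"
    unfolding K_def by (intro compact_imp_closed compact_continuous_image compact_cball_frame[OF B])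
  let ?cv = "coord_vec A c x"
  define \<omega> where "\<omega> z vs = (if z \<in> dom c \<and> tangents z vs
    then \<psi> (snd c z) * \<eta> (map (\<lambda>v. ?cv (v c)) vs) else 0)" for z vs
  have altc: "alt (int k) (\<lambda>us. \<eta> (map ?cv us))" and off: "\<And>vs. \<not> tangents x vs \<Longrightarrow> \<eta> vs = 0"
    using \<eta> covectors_iff[OF c] by auto
  have "\<omega> \<in> forms A (int k)"
    unfolding forms_iff
  proof (intro conjI allI impI ballI)
    fix d assume d: "d \<in> A"
    let ?L = "local_form A d \<omega>"
    let ?\<omega>0 = "\<lambda>z us. \<psi> z * \<eta> (map ?cv us)" and ?\<tau> = "transition d c"
    let ?S1 = "snd d ` (dom d \<inter> dom c)" and ?S2 = "snd d ` (dom d - K)"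
    \<comment> \<open>The extension is a pullback of a smooth form on \<open>?S1\<close>, and it is zero on \<open>?S2\<close>.\<close>
    have S: "open ?S1" "open ?S2"
      using open_overlap[OF d c(1)] open_image[OF d open_Diff[OF open_dom[OF d] \<open>closed K\<close>]] by auto
    have \<omega>0: "chart_form (int k) (im c) ?\<omega>0"
      unfolding chart_form_def
    proof (intro conjI ballI allI)
      fix y show "alt (int k) (?\<omega>0 y)" by (rule alt_cmult[OF altc])
    next
      fix us show "smooth_on (im c) (\<lambda>y. ?\<omega>0 y us)"
        using \<psi>(1) smooth_on_mono[OF \<psi>(1)] open_im[OF c(1)]
        by (intro smooth_on_mult smooth_on_const) auto
    qed
    have L1: "?L (snd d z) us = ?\<omega>0 (?\<tau> (snd d z)) (map (dderiv ?\<tau> (snd d z)) us)"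
      if "z \<in> dom d" "z \<in> dom c" for z us
      using that d c tangents_coord_vec[OF d that(1)]
      by (simp add: local_form_snd \<omega>_def o_def coord_vec_coord)
    have L2: "?L (snd d z) us = 0" if "z \<in> dom d" "z \<notin> K" for z us
    proof -
      have "\<psi> (snd c z) = 0" if "z \<in> dom c"
      proof (rule \<psi>(3))
        show "snd c z \<notin> cball (snd c x) r"
          using \<open>z \<notin> K\<close> pt_snd[OF c(1) that] unfolding K_def by (metis imageI)
      qed
      then show ?thesis using that d by (simp add: local_form_snd \<omega>_def)
    qed
    have cover: "dom d = (dom d \<inter> dom c) \<union> (dom d - K)"
    proof -
      have "K \<subseteq> dom c" unfolding K_def using r(2) pt_in_dom[OF c(1)] by (auto simp only: image_subset_iff subset_iff)
      then show ?thesis by blast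
    qed
    show "chart_form (int k) (im d) ?L"
      unfolding chart_form_def
    proof (intro conjI ballI allI)
      fix y assume "y \<in> im d"
      then obtain z where z: "z \<in> dom d" "y = snd d z" by auto
      show "alt (int k) (?L y)"
      proof (cases "z \<in> dom c")
        case True
        have J: "dderiv ?\<tau> y (a *\<^sub>R u + b *\<^sub>R w) = a *\<^sub>R dderiv ?\<tau> y u + b *\<^sub>R dderiv ?\<tau> y w" for a b u w
          unfolding z(2) by (rule dderiv_linear[OF transition_differentiable[OF d c(1) z(1) True]])
        have "alt (int k) (\<lambda>us. ?\<omega>0 (?\<tau> y) (map (dderiv ?\<tau> y) us))"
          by (rule alt_map[OF alt_cmult[OF altc] J])
        moreover have "?L y = (\<lambda>us. ?\<omega>0 (?\<tau> y) (map (dderiv ?\<tau> y) us))"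
          unfolding z(2) using L1[OF z(1) True] by blast
        ultimately show ?thesis by simp
      next
        case False
        then have "?L y = (\<lambda>us. 0)" using L2[of z] z cover by auto
        then show ?thesis by (simp add: alt_def)
      qed
    next
      fix us
      have "smooth_on ?S1 (\<lambda>y. ?\<omega>0 (?\<tau> y) ([] @ map (\<lambda>v. dderiv ?\<tau> y v) us))"
        by (rule smooth_on_alt_compose[OF B S(1) smooth_transition[OF d c(1)] transition_image[OF d] _ \<omega>0])
           (rule smooth_on_dderiv[OF smooth_transition[OF d c(1)]])
      then have "smooth_on ?S1 (\<lambda>y. ?L y us)"
        by (rule smooth_on_cong[OF S(1), rotated]) (auto simp del: map_map simp: L1)
      moreover have "smooth_on ?S2 (\<lambda>y. ?L y us)"
        by (rule smooth_on_cong[OF S(2) _ smooth_on_const[of _ 0]]) (auto simp: L2)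
      moreover have "im d = ?S1 \<union> ?S2" using cover by (metis image_Un)
      ultimately show "smooth_on (im d) (\<lambda>y. ?L y us)" using smooth_on_Un[OF S] by simp
    qed
  qed (simp add: \<omega>_def)
  moreover have "\<omega> x = \<eta>"
  proof
    fix vs show "\<omega> x vs = \<eta> vs"
      using map_coord_vec[OF c, of vs] \<psi>(2) c off by (auto simp: \<omega>_def o_def)
  qed
  ultimately show ?thesis by blast
qed

lemma int_prod_value:
  "int_prod W \<omega> x [] = W x (\<omega> x)"
  by (simp add: int_prod_def)

lemma rep_field_off:
  assumes "smooth_rep r (im c) T" "\<eta> \<notin> covectors A x r"
  shows "rep_field c T x \<eta> = 0"
proof -
  have "rep_field c T x \<eta> = (\<Sum>t\<leftarrow>T. 0)"
    unfolding rep_field_def by (intro arg_cong[where f = sum_list] map_cong refl)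
       (use assms in \<open>auto simp: smooth_rep_def wedge_def\<close>)
  then show ?thesis by simp
qed

lemma mvfield_eqI:
  assumes W: "W \<in> mvfields A r" "W' \<in> mvfields A r"
    and eq: "\<And>\<omega>. \<omega> \<in> forms A (int r) \<Longrightarrow> int_prod W \<omega> = int_prod W' \<omega>"
  shows "W = W'"
proof (intro ext)
  fix x \<eta>
  obtain c where c: "c \<in> A" "x \<in> dom c" using chart_ex by blast
  obtain T where T: "smooth_rep r (im c) T" "W x = rep_field c T x"
    using mvfield_rep_field[OF W(1) c(1)] c(2) by metis
  obtain T' where T': "smooth_rep r (im c) T'" "W' x = rep_field c T' x"
    using mvfield_rep_field[OF W(2) c(1)] c(2) by metis
  show "W x \<eta> = W' x \<eta>"
  proof (cases "\<eta> \<in> covectors A x r")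
    case True
    then obtain \<omega> where \<omega>: "\<omega> \<in> forms A (int r)" "\<omega> x = \<eta>" using covector_extends by blast
    then show ?thesis using eq[OF \<omega>(1)] int_prod_value[of W \<omega> x] int_prod_value[of W' \<omega> x] by simp
  next
    case False
    then show ?thesis by (simp add: T(2) T'(2) rep_field_off[OF T(1)] rep_field_off[OF T'(1)])
  qed
qed

text \<open>
  In every chart the coordinate formula gives a bracket. Its contraction with a global form is the
  right-hand side, which does not refer to charts; so the brackets of two charts agree on their
  overlap, because global forms attain all covectors. They glue to a global field.
\<close>

lemma schouten_exists:
  assumes p: "1 \<le> p" and U: "U \<in> mvfields A p" and V: "V \<in> mvfields A q"
  shows "\<exists>W\<in>mvfields A (p + q - 1). \<forall>k. \<forall>\<omega>\<in>forms A k.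
     int_prod W \<omega> = scale_form ((-1) ^ ((p + 1) * q)) (lie_deriv A p U (int_prod V \<omega>))
       - int_prod V (lie_deriv A p U \<omega>)"
proof -
  let ?r = "p + q - 1"
  define R where "R \<omega> = scale_form ((-1) ^ ((p + 1) * q)) (lie_deriv A p U (int_prod V \<omega>))
       - int_prod V (lie_deriv A p U \<omega>)" for \<omega>
  have "\<exists>T. smooth_rep ?r (im c) T \<and> (\<forall>k \<omega> x us. \<omega> \<in> forms A k \<longrightarrow> x \<in> dom c \<longrightarrow>
      local_form A c (int_prod (rep_field c T) \<omega>) (snd c x) us = local_form A c (R \<omega>) (snd c x) us)"
    if c: "c \<in> A" for c
  proof -
    obtain T where T: "smooth_rep p (im c) T" "\<forall>x\<in>dom c. U x = rep_field c T x"
      by (rule mvfield_rep_field[OF U c]) (rule that)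
    obtain T' where T': "smooth_rep q (im c) T'" "\<forall>x\<in>dom c. V x = rep_field c T' x"
      by (rule mvfield_rep_field[OF V c]) (rule that)
    let ?T = "chart_bracket p q T T'"
    have lf: "smooth_rep ?r (im c) ?T" by (rule smooth_rep_chart_bracket[OF open_im[OF c] T(1) T'(1) p])
    have "local_form A c (int_prod (rep_field c ?T) \<omega>) y us = local_form A c (R \<omega>) y us"
      if \<omega>: "\<omega> \<in> forms A k" and y: "y \<in> im c" for k \<omega> y us
    proof -
      note l' = local_form_int_prod[OF _ c y T'(1) T'(2)]
      have 1: "local_form A c (lie_deriv A p U (int_prod V \<omega>)) y us = chart_lie p T (chart_int T' (local_form A c \<omega>)) y us"
      proof -
        have eq: "local_form A c (int_prod V \<omega>) z us = chart_int T' (local_form A c \<omega>) z us" if "z \<in> im c" for z us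
          by (rule local_form_int_prod[OF \<omega> c that T'(1) T'(2)])
        have lf1: "chart_form (k - int q) (im c) (chart_int T' (local_form A c \<omega>))"
          by (rule chart_form_chart_int[OF open_im[OF c] T'(1) form_local[OF \<omega> c]])
        have "chart_d (chart_int T (local_form A c (int_prod V \<omega>))) y us = chart_d (chart_int T (chart_int T' (local_form A c \<omega>))) y us"
          by (rule chart_d_cong[OF open_im[OF c] y _ chart_form_chart_int[OF open_im[OF c] T(1) lf1]])
             (simp add: eq chart_int_def[of T])
        moreover have "chart_d (local_form A c (int_prod V \<omega>)) y us = chart_d (chart_int T' (local_form A c \<omega>)) y us" for us
          by (rule chart_d_cong[OF open_im[OF c] y _ lf1]) (simp add: eq)
        ultimately have "chart_lie p T (local_form A c (int_prod V \<omega>)) y us = chart_lie p T (chart_int T' (local_form A c \<omega>)) y us"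
          unfolding chart_lie_def by (simp add: chart_int_def[of T "chart_d _"])
        then show ?thesis
          using local_form_lie_deriv[OF U int_prod_form[OF V \<omega>] c y T] by simp
      qed
      have 2: "local_form A c (int_prod V (lie_deriv A p U \<omega>)) y us = chart_int T' (chart_lie p T (local_form A c \<omega>)) y us"
        using l'[OF lie_deriv_form[OF U \<omega>]] local_form_lie_deriv[OF U \<omega> c y T] by (simp add: chart_int_def[of T'])
      have "local_form A c (int_prod (rep_field c ?T) \<omega>) y us = chart_int ?T (local_form A c \<omega>) y us"
        by (rule local_form_int_prod[OF \<omega> c y lf]) (simp)
      also have "\<dots> = (-1) ^ ((p + 1) * q) * chart_lie p T (chart_int T' (local_form A c \<omega>)) y us
          - chart_int T' (chart_lie p T (local_form A c \<omega>)) y us"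
        by (rule chart_bracket_identity[OF open_im[OF c] y T(1) T'(1) form_local[OF \<omega> c] p])
      also have "\<dots> = local_form A c (R \<omega>) y us"
        unfolding 1[symmetric] 2[symmetric] by (simp add: R_def local_form_def scale_form_def)
      finally show ?thesis .
    qed
    then show ?thesis using lf by blast
  qed
  then obtain T where T: "\<And>c. c \<in> A \<Longrightarrow> smooth_rep ?r (im c) (T c)"
    "\<And>c k \<omega> x us. c \<in> A \<Longrightarrow> \<omega> \<in> forms A k \<Longrightarrow> x \<in> dom c \<Longrightarrow>
      local_form A c (int_prod (rep_field c (T c)) \<omega>) (snd c x) us = local_form A c (R \<omega>) (snd c x) us"
    by metis
  have agree: "rep_field c (T c) x = rep_field d (T d) x" if c: "c \<in> A" "x \<in> dom c" and d: "d \<in> A" "x \<in> dom d" for c d x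
  proof
    fix \<eta>
    show "rep_field c (T c) x \<eta> = rep_field d (T d) x \<eta>"
    proof (cases "\<eta> \<in> covectors A x ?r")
      case True
      then obtain \<omega> where \<omega>: "\<omega> \<in> forms A (int ?r)" "\<omega> x = \<eta>" using covector_extends by blast
      have "rep_field c (T c) x \<eta> = R \<omega> x []" if "c \<in> A" "x \<in> dom c" for c
        using T(2)[OF that(1) \<omega>(1) that(2), of "[]"] that \<omega>(2) int_prod_value[of "rep_field c (T c)" \<omega> x]
        by (simp add: local_form_snd)
      then show ?thesis using c d by metis
    next
      case False
      then show ?thesis using rep_field_off[OF T(1)[OF c(1)] False] rep_field_off[OF T(1)[OF d(1)] False] by simp
    qed
  qed
  obtain ch where ch: "\<And>x. ch x \<in> A" "\<And>x. x \<in> dom (ch x)" using chart_ex by metis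
  define W where "W x = rep_field (ch x) (T (ch x)) x" for x
  have Wc: "W x = rep_field c (T c) x" if "c \<in> A" "x \<in> dom c" for c x
    unfolding W_def by (rule agree[OF ch that])
  have WM: "W \<in> mvfields A ?r" unfolding mvfields_iff using T(1) Wc by blast
  have "int_prod W \<omega> = R \<omega>" if \<omega>: "\<omega> \<in> forms A k" for k \<omega>
  proof (rule form_eqI)
    fix x vs assume n: "\<not> tangents x vs"
    have "lie_deriv A p U (int_prod V \<omega>) x vs = 0" "int_prod V (lie_deriv A p U \<omega>) x vs = 0"
      using form_off[OF lie_deriv_form[OF U int_prod_form[OF V \<omega>]] n]
        form_off[OF int_prod_form[OF V lie_deriv_form[OF U \<omega>]] n] .
    then show "int_prod W \<omega> x vs = R \<omega> x vs"
      using int_prod_off[OF WM \<omega> n] by (simp add: R_def scale_form_def)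
  next
    fix c y us assume c: "c \<in> A" "y \<in> im c"
    then obtain x where x: "x \<in> dom c" "y = snd c x" by auto
    have "local_form A c (int_prod W \<omega>) y us = local_form A c (int_prod (rep_field c (T c)) \<omega>) y us"
      using Wc[OF c(1) x(1)] c x by (simp add: local_form_snd int_prod_def)
    then show "local_form A c (int_prod W \<omega>) y us = local_form A c (R \<omega>) y us"
      using T(2)[OF c(1) \<omega> x(1)] x by simp
  qed
  then show ?thesis using WM unfolding R_def by blast
qed

lemma schouten:
  assumes "1 \<le> p" "U \<in> mvfields A p" "V \<in> mvfields A q"
  shows schouten_mvfield: "schouten A p q U V \<in> mvfields A (p + q - 1)"
    and int_prod_schouten: "\<And>k \<omega>. \<omega> \<in> forms A k \<Longrightarrow> int_prod (schouten A p q U V) \<omega> =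
      scale_form ((-1) ^ ((p + 1) * q)) (lie_deriv A p U (int_prod V \<omega>)) - int_prod V (lie_deriv A p U \<omega>)"
proof -
  let ?P = "\<lambda>W. W \<in> mvfields A (p + q - 1) \<and> (\<forall>k. \<forall>\<omega>\<in>forms A k. int_prod W \<omega> =
      scale_form ((-1) ^ ((p + 1) * q)) (lie_deriv A p U (int_prod V \<omega>)) - int_prod V (lie_deriv A p U \<omega>))"
  have "\<exists>!W. ?P W"
  proof (rule ex_ex1I)
    show "\<exists>W. ?P W" using schouten_exists[OF assms] by blast
    show "W = W'" if "?P W" "?P W'" for W W'
      by (rule mvfield_eqI) (use that in auto)
  qed
  then have "?P (schouten A p q U V)" unfolding schouten_def by (rule theI')
  then show "schouten A p q U V \<in> mvfields A (p + q - 1)"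
    "\<And>k \<omega>. \<omega> \<in> forms A k \<Longrightarrow> int_prod (schouten A p q U V) \<omega> =
      scale_form ((-1) ^ ((p + 1) * q)) (lie_deriv A p U (int_prod V \<omega>)) - int_prod V (lie_deriv A p U \<omega>)"
    by blast+
qed

section \<open>Cartan calculus\<close>

lemma scale_form_lincomb: "scale_form a \<omega> = lincomb a \<omega> 0 \<omega>"
  and uminus_lincomb: "- \<omega> = lincomb (-1) \<omega> 0 \<omega>"
  by (simp_all add: lincomb_def scale_form_def fun_eq_iff)

lemma uminus_form: "\<omega> \<in> forms A k \<Longrightarrow> - \<omega> \<in> forms A k"
  unfolding uminus_lincomb by (rule lincomb_form)

lemma int_prod_uminus:
  "U \<in> mvfields A p \<Longrightarrow> \<omega> \<in> forms A k \<Longrightarrow> int_prod U (- \<omega>) = - int_prod U \<omega>"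
  unfolding uminus_lincomb by (rule int_prod_lincomb)

lemma ext_deriv_uminus: "\<omega> \<in> forms A k \<Longrightarrow> ext_deriv A (- \<omega>) = - ext_deriv A \<omega>"
  unfolding uminus_lincomb by (rule ext_deriv_lincomb)

lemma ext_deriv_scale: "\<omega> \<in> forms A k \<Longrightarrow> ext_deriv A (scale_form a \<omega>) = scale_form a (ext_deriv A \<omega>)"
  unfolding scale_form_lincomb by (rule ext_deriv_lincomb)

lemma lie_deriv_eq_lincomb:
  "lie_deriv A p U \<omega> = lincomb 1 (ext_deriv A (int_prod U \<omega>)) (- ((-1) ^ p)) (int_prod U (ext_deriv A \<omega>))"
  by (simp add: lie_deriv_def lincomb_def scale_form_def fun_eq_iff)

lemma form_degree: "\<omega> \<in> forms A k \<Longrightarrow> k = k' \<Longrightarrow> \<omega> \<in> forms A k'"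
  by simp

lemma lie_deriv_lincomb:
  assumes U: "U \<in> mvfields A p" and \<omega>: "\<omega> \<in> forms A k" "\<omega>' \<in> forms A k"
  shows "lie_deriv A p U (lincomb a \<omega> b \<omega>') = lincomb a (lie_deriv A p U \<omega>) b (lie_deriv A p U \<omega>')"
  unfolding lie_deriv_eq_lincomb int_prod_lincomb[OF U \<omega>] ext_deriv_lincomb[OF \<omega>]
    ext_deriv_lincomb[OF int_prod_form[OF U \<omega>(1)] int_prod_form[OF U \<omega>(2)]]
    int_prod_lincomb[OF U ext_deriv_form[OF \<omega>(1)] ext_deriv_form[OF \<omega>(2)]]
  by (simp add: lincomb_def fun_eq_iff algebra_simps)

lemma int_prod_zero: "U \<in> mvfields A p \<Longrightarrow> int_prod U 0 = 0"
  using int_prod_lincomb[of U p 0 "-1" 0 0 0] by (simp add: lincomb_def forms_def zero_fun_def)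

lemma ext_deriv_lie_deriv:
  assumes U: "U \<in> mvfields A p" and \<omega>: "\<omega> \<in> forms A k"
  shows "ext_deriv A (lie_deriv A p U \<omega>) = scale_form (- ((-1) ^ p)) (lie_deriv A p U (ext_deriv A \<omega>))"
proof -
  have i: "ext_deriv A (int_prod U \<omega>) \<in> forms A (k + 1 - int p)"
    by (rule form_degree[OF ext_deriv_form[OF int_prod_form[OF U \<omega>]]]) simp
  show ?thesis
    unfolding lie_deriv_eq_lincomb ext_deriv_lincomb[OF i int_prod_form[OF U ext_deriv_form[OF \<omega>]]]
      ext_deriv_ext_deriv[OF \<omega>] ext_deriv_ext_deriv[OF int_prod_form[OF U \<omega>]] int_prod_zero[OF U]
    by (simp add: lincomb_def scale_form_def fun_eq_iff)
qed

text \<open>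
  Up to sign \<open>\<L>\<^bsub>[U,V]\<^esub>\<close> is the graded commutator of \<open>\<L>\<^sub>U\<close> and \<open>\<L>\<^sub>V\<close>: it is the commutator of \<open>d\<close> with
  \<open>\<iota>\<^bsub>[U,V]\<^esub>\<close>, and \<open>d\<close> commutes with \<open>\<L>\<^sub>U\<close> up to sign.
\<close>

lemma lie_deriv_schouten:
  assumes p: "1 \<le> p" and U: "U \<in> mvfields A p" and V: "V \<in> mvfields A q" and \<omega>: "\<omega> \<in> forms A k"
  shows "lie_deriv A (p + q - 1) (schouten A p q U V) \<omega> =
    lincomb (- ((-1) ^ ((p + 1) * q + p))) (lie_deriv A p U (lie_deriv A q V \<omega>))
      (-1) (lie_deriv A q V (lie_deriv A p U \<omega>))"
proof -
  let ?W = "schouten A p q U V" and ?s = "(-1) ^ ((p + 1) * q) :: real"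
  let ?d = "ext_deriv A" and ?L = "lie_deriv A p U" and ?i = "int_prod V"
  have W: "int_prod ?W \<eta> = lincomb ?s (?L (?i \<eta>)) (-1) (?i (?L \<eta>))" if "\<eta> \<in> forms A j" for \<eta> j
    using int_prod_schouten[OF p U V that] by (simp add: lincomb_def scale_form_def fun_eq_iff)
  have d\<omega>: "?d \<omega> \<in> forms A (k + 1)" by (rule ext_deriv_form[OF \<omega>])
  have f1: "?L (?i \<omega>) \<in> forms A (k - int p - int q + 1)"
    by (rule form_degree[OF lie_deriv_form[OF U int_prod_form[OF V \<omega>]]]) simp
  have f2: "?i (?L \<omega>) \<in> forms A (k - int p - int q + 1)"
    by (rule form_degree[OF int_prod_form[OF V lie_deriv_form[OF U \<omega>]]]) simp
  have dW: "?d (int_prod ?W \<omega>) =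
      lincomb ?s (scale_form (- ((-1) ^ p)) (?L (?d (?i \<omega>)))) (-1) (?d (?i (?L \<omega>)))"
    unfolding W[OF \<omega>] ext_deriv_lincomb[OF f1 f2] ext_deriv_lie_deriv[OF U int_prod_form[OF V \<omega>]] ..
  have Wd: "int_prod ?W (?d \<omega>) = lincomb ?s (?L (?i (?d \<omega>))) (-1) (?i (?L (?d \<omega>)))"
    by (rule W[OF d\<omega>])
  have g: "?d (?i \<omega>) \<in> forms A (k + 1 - int q)"
    by (rule form_degree[OF ext_deriv_form[OF int_prod_form[OF V \<omega>]]]) simp
  have LL: "?L (lie_deriv A q V \<omega>) = lincomb 1 (?L (?d (?i \<omega>))) (- ((-1) ^ q)) (?L (?i (?d \<omega>)))"
    unfolding lie_deriv_eq_lincomb[of q] by (rule lie_deriv_lincomb[OF U g int_prod_form[OF V d\<omega>]])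
  have "?i (?d (?L \<omega>)) = scale_form (- ((-1) ^ p)) (?i (?L (?d \<omega>)))"
    unfolding ext_deriv_lie_deriv[OF U \<omega>] scale_form_lincomb
    by (rule int_prod_lincomb[OF V]) (rule lie_deriv_form[OF U d\<omega>])+
  then have LL': "lie_deriv A q V (?L \<omega>) =
      lincomb 1 (?d (?i (?L \<omega>))) (- ((-1) ^ q)) (scale_form (- ((-1) ^ p)) (?i (?L (?d \<omega>))))"
    unfolding lie_deriv_eq_lincomb[of q] by simp
  obtain p' where p': "p = Suc p'" using p by (metis Suc_le_D One_nat_def)
  show ?thesis
    unfolding LL LL' lie_deriv_eq_lincomb[of "p + q - 1"] dW Wd
    by (simp add: lincomb_def scale_form_def fun_eq_iff p' minus_one_power_iff)
qed

section \<open>Conformal Hamiltonian forms\<close>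

lemma conformal_pair_lie_deriv:
  assumes \<alpha>: "\<alpha> \<in> forms A k" and pair: "conformal_pair A \<Theta> p \<alpha> X V"
  shows "lie_deriv A p X \<Theta> = int_prod V \<Theta>"
proof -
  have eqs: "int_prod X \<Theta> = - \<alpha>"
    "int_prod X (ext_deriv A \<Theta>) = scale_form ((-1) ^ (p + 1)) (ext_deriv A \<alpha> + int_prod V \<Theta>)"
    using pair by (auto simp: conformal_pair_def)
  show ?thesis
    unfolding lie_deriv_def eqs ext_deriv_uminus[OF \<alpha>]
    by (simp add: scale_form_def fun_eq_iff sign_mult_sign)
qed

text \<open>
  On \<open>\<Theta>\<close> the bracket is a combination of \<open>\<L>\<^sub>X\<iota>\<^sub>Y\<Theta>\<close> and \<open>\<iota>\<^sub>Y\<L>\<^sub>X\<Theta> = \<iota>\<^sub>Y\<iota>\<^sub>V\<Theta> = \<plusminus>\<iota>\<^sub>V\<iota>\<^sub>Y\<Theta>\<close>. So the multivector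
  field \<open>Y\<close> enters only through \<open>\<iota>\<^sub>Y\<Theta> = - \<beta>\<close>.
\<close>

lemma bracket_via_left_pair:
  assumes \<Theta>: "\<Theta> \<in> forms A k" and \<alpha>: "\<alpha> \<in> forms A j" and p: "1 \<le> p"
    and X: "conformal_pair A \<Theta> p \<alpha> X V" and Y: "Y \<in> mvfields A q" "int_prod Y \<Theta> = - \<beta>"
  shows "int_prod (schouten A p q X Y) \<Theta> =
    scale_form ((-1) ^ ((p + 1) * q)) (lie_deriv A p X (- \<beta>)) - scale_form ((-1) ^ (q * (p - 1))) (int_prod V (- \<beta>))"
proof -
  have XV: "X \<in> mvfields A p" "V \<in> mvfields A (p - 1)" using X by (auto simp: conformal_pair_def)
  show ?thesis
    unfolding int_prod_schouten[OF p XV(1) Y(1) \<Theta>] conformal_pair_lie_deriv[OF \<alpha> X]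
      int_prod_commute[OF Y(1) XV(2) \<Theta>] Y(2) ..
qed

text \<open>
  When the factor \<open>\<iota>\<^sub>X\<close> is moved to the right, it meets \<open>\<Theta>\<close> and gives \<open>- \<alpha>\<close>, except in the two terms with
  \<open>\<iota>\<^sub>Y\<iota>\<^sub>X d\<Theta>\<close>, one from \<open>\<L>\<^sub>X\<iota>\<^sub>Y\<Theta>\<close> and one from \<open>\<iota>\<^sub>Y\<L>\<^sub>X\<Theta>\<close>. These cancel, so \<open>X\<close> enters only through \<open>\<alpha>\<close>.
\<close>

lemma bracket_via_right_pair:
  assumes \<Theta>: "\<Theta> \<in> forms A k" and \<alpha>: "\<alpha> \<in> forms A j" and \<beta>: "\<beta> \<in> forms A (k - int q)"
    and p: "1 \<le> p" and q: "1 \<le> q"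
    and X: "X \<in> mvfields A p" "int_prod X \<Theta> = - \<alpha>" and Y: "conformal_pair A \<Theta> q \<beta> Y Z"
  shows "int_prod (schouten A p q X Y) \<Theta> =
    (\<lambda>x vs. int_prod Y (ext_deriv A \<alpha>) x vs - (-1) ^ q * ext_deriv A (int_prod Y \<alpha>) x vs
      + (-1) ^ q * int_prod Z \<alpha> x vs)"
proof -
  let ?d = "ext_deriv A" and ?s = "(-1) ^ ((p + 1) * q) :: real"
  have YZ: "Y \<in> mvfields A q" "Z \<in> mvfields A (q - 1)" "int_prod Y \<Theta> = - \<beta>"
    "int_prod Y (?d \<Theta>) = scale_form ((-1) ^ (q + 1)) (?d \<beta> + int_prod Z \<Theta>)"
    using Y by (auto simp: conformal_pair_def)
  have d\<Theta>: "?d \<Theta> \<in> forms A (k + 1)" by (rule ext_deriv_form[OF \<Theta>])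
  have XY: "int_prod X (int_prod Y \<Theta>) = scale_form (- ((-1) ^ (p * q))) (int_prod Y \<alpha>)"
    unfolding int_prod_commute[OF X(1) YZ(1) \<Theta>] X(2) int_prod_uminus[OF YZ(1) \<alpha>]
    by (simp add: scale_form_def fun_eq_iff)
  have Y\<alpha>: "int_prod Y \<alpha> \<in> forms A (j - int q)" by (rule int_prod_form[OF YZ(1) \<alpha>])
  have dY: "?d (int_prod Y \<Theta>) = lincomb ((-1) ^ q) (int_prod Y (?d \<Theta>)) 1 (int_prod Z \<Theta>)"
    unfolding YZ(3,4) ext_deriv_uminus[OF \<beta>]
    by (simp add: lincomb_def scale_form_def fun_eq_iff sign_mult_sign)
  have Z\<Theta>: "int_prod Z \<Theta> \<in> forms A (k + 1 - int q)"
    using q by (intro form_degree[OF int_prod_form[OF YZ(2) \<Theta>]]) simp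
  have XdY: "int_prod X (?d (int_prod Y \<Theta>)) =
      lincomb ((-1) ^ (q + p * q)) (int_prod Y (int_prod X (?d \<Theta>))) (- ((-1) ^ (p * (q - 1)))) (int_prod Z \<alpha>)"
    unfolding dY int_prod_lincomb[OF X(1) int_prod_form[OF YZ(1) d\<Theta>] Z\<Theta>]
      int_prod_commute[OF X(1) YZ(1) d\<Theta>] int_prod_commute[OF X(1) YZ(2) \<Theta>] X(2) int_prod_uminus[OF YZ(2) \<alpha>]
    by (simp add: lincomb_def scale_form_def fun_eq_iff power_add)
  have LX: "lie_deriv A p X \<Theta> = lincomb (-1) (?d \<alpha>) (- ((-1) ^ p)) (int_prod X (?d \<Theta>))"
    unfolding lie_deriv_eq_lincomb X(2) ext_deriv_uminus[OF \<alpha>] by (simp add: lincomb_def fun_eq_iff)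
  have deg: "\<alpha> \<in> forms A (k - int p)"
    using uminus_form[OF int_prod_form[OF X(1) \<Theta>]] X(2) by simp
  have d\<alpha>: "?d \<alpha> \<in> forms A (k + 1 - int p)"
    by (rule form_degree[OF ext_deriv_form[OF deg]]) simp
  have YL: "int_prod Y (lie_deriv A p X \<Theta>) =
      lincomb (-1) (int_prod Y (?d \<alpha>)) (- ((-1) ^ p)) (int_prod Y (int_prod X (?d \<Theta>)))"
    unfolding LX by (rule int_prod_lincomb[OF YZ(1) d\<alpha> int_prod_form[OF X(1) d\<Theta>]])
  have LY: "lie_deriv A p X (int_prod Y \<Theta>) =
      lincomb (- ((-1) ^ (p * q))) (?d (int_prod Y \<alpha>)) (- ((-1) ^ p)) (int_prod X (?d (int_prod Y \<Theta>)))"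
    unfolding lie_deriv_eq_lincomb XY ext_deriv_scale[OF Y\<alpha>]
    by (simp add: lincomb_def scale_form_def fun_eq_iff)
  obtain q' where q': "q = Suc q'" using q by (metis Suc_le_D One_nat_def)
  show ?thesis
    unfolding int_prod_schouten[OF p X(1) YZ(1) \<Theta>] YL LY XdY
    by (auto simp: lincomb_def scale_form_def fun_eq_iff q' minus_one_power_iff)
qed

lemma bracket_independent:
  assumes \<Theta>: "\<Theta> \<in> forms A k" and \<alpha>: "\<alpha> \<in> forms A (k - int p)" and \<beta>: "\<beta> \<in> forms A (k - int q)"
    and pq: "1 \<le> p" "1 \<le> q"
    and X: "conformal_pair A \<Theta> p \<alpha> X V" "conformal_pair A \<Theta> p \<alpha> X' V'"
    and Y: "conformal_pair A \<Theta> q \<beta> Y Z" "conformal_pair A \<Theta> q \<beta> Y' Z'"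
  shows "int_prod (schouten A p q X' Y') \<Theta> = int_prod (schouten A p q X Y) \<Theta>"
proof -
  have m: "X \<in> mvfields A p" "int_prod X \<Theta> = - \<alpha>" "X' \<in> mvfields A p" "int_prod X' \<Theta> = - \<alpha>"
    "Y \<in> mvfields A q" "int_prod Y \<Theta> = - \<beta>" "Y' \<in> mvfields A q" "int_prod Y' \<Theta> = - \<beta>"
    using X Y by (auto simp: conformal_pair_def)
  have "int_prod (schouten A p q X' Y') \<Theta> = int_prod (schouten A p q X' Y) \<Theta>"
    using bracket_via_left_pair[OF \<Theta> \<alpha> pq(1) X(2) m(7,8)]
      bracket_via_left_pair[OF \<Theta> \<alpha> pq(1) X(2) m(5,6)] by simp
  also have "\<dots> = int_prod (schouten A p q X Y) \<Theta>"
    using bracket_via_right_pair[OF \<Theta> \<alpha> \<beta> pq m(3,4) Y(1)]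
      bracket_via_right_pair[OF \<Theta> \<alpha> \<beta> pq m(1,2) Y(1)] by simp
  finally show ?thesis .
qed

text \<open>
  With \<open>\<L>\<^sub>X\<Theta> = \<iota>\<^sub>V\<Theta>\<close> and \<open>\<L>\<^sub>Y\<Theta> = \<iota>\<^sub>Z\<Theta>\<close>, the graded commutator of \<open>\<L>\<^sub>X\<close> and \<open>\<L>\<^sub>Y\<close> on \<open>\<Theta>\<close> involves
  \<open>\<L>\<^sub>X\<iota>\<^sub>Z\<Theta>\<close> and \<open>\<L>\<^sub>Y\<iota>\<^sub>V\<Theta>\<close>. Moving the Lie derivatives past the contractions produces \<open>\<iota>\<^bsub>[X,Z]\<^esub>\<Theta>\<close> and
  \<open>\<iota>\<^bsub>[Y,V]\<^esub>\<Theta>\<close>, while the remaining terms with \<open>\<iota>\<^sub>Z\<iota>\<^sub>V\<Theta>\<close> cancel.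
\<close>

lemma schouten_infinitesimal_conformal:
  assumes \<Theta>: "\<Theta> \<in> forms A k" and pq: "1 \<le> p" "1 \<le> q"
    and X: "X \<in> mvfields A p" "V \<in> mvfields A (p - 1)" "lie_deriv A p X \<Theta> = int_prod V \<Theta>"
    and Y: "Y \<in> mvfields A q" "Z \<in> mvfields A (q - 1)" "lie_deriv A q Y \<Theta> = int_prod Z \<Theta>"
  shows "infinitesimal_conformal A \<Theta> (p + q - 1) (schouten A p q X Y)"
proof -
  obtain p' q' where p': "p = Suc p'" and q': "q = Suc q'" using pq by (metis Suc_le_D One_nat_def)
  let ?t = "(-1) ^ ((p + 1) * (q + 1)) :: real"
  define N where "N = (\<lambda>x \<eta>. 1 * schouten A p (q - 1) X Z x \<eta> + (- ?t) * schouten A q (p - 1) Y V x \<eta>)"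
  have "schouten A p (q - 1) X Z \<in> mvfields A (p + q - 1 - 1)"
    "schouten A q (p - 1) Y V \<in> mvfields A (p + q - 1 - 1)"
    using schouten_mvfield[OF pq(1) X(1) Y(2)] schouten_mvfield[OF pq(2) Y(1) X(2)]
    by (simp_all add: p' q' add.commute)
  then have N: "N \<in> mvfields A (p + q - 1 - 1)" unfolding N_def by (rule mvfields_lincomb)
  have XZ: "int_prod (schouten A p (q - 1) X Z) \<Theta> x vs =
      (-1) ^ ((p + 1) * (q - 1)) * lie_deriv A p X (int_prod Z \<Theta>) x vs - int_prod Z (int_prod V \<Theta>) x vs" for x vs
    using int_prod_schouten[OF pq(1) X(1) Y(2) \<Theta>] by (simp add: X(3) scale_form_def fun_eq_iff)
  have YV: "int_prod (schouten A q (p - 1) Y V) \<Theta> x vs =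
      (-1) ^ ((q + 1) * (p - 1)) * lie_deriv A q Y (int_prod V \<Theta>) x vs
      - (-1) ^ ((p - 1) * (q - 1)) * int_prod Z (int_prod V \<Theta>) x vs" for x vs
    using int_prod_schouten[OF pq(2) Y(1) X(2) \<Theta>] int_prod_commute[OF X(2) Y(2) \<Theta>]
    by (simp add: Y(3) scale_form_def fun_eq_iff)
  have "lie_deriv A (p + q - 1) (schouten A p q X Y) \<Theta> x vs = int_prod N \<Theta> x vs" for x vs
  proof -
    have "lie_deriv A (p + q - 1) (schouten A p q X Y) \<Theta> x vs =
        - ((-1) ^ ((p + 1) * q + p)) * lie_deriv A p X (int_prod Z \<Theta>) x vs - lie_deriv A q Y (int_prod V \<Theta>) x vs"
      using lie_deriv_schouten[OF pq(1) X(1) Y(1) \<Theta>] by (simp add: X(3) Y(3) lincomb_def)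
    also have "\<dots> = int_prod (schouten A p (q - 1) X Z) \<Theta> x vs - ?t * int_prod (schouten A q (p - 1) Y V) \<Theta> x vs"
      unfolding XZ YV by (auto simp: p' q' minus_one_power_iff)
    also have "\<dots> = int_prod N \<Theta> x vs" by (simp add: N_def int_prod_def)
    finally show ?thesis .
  qed
  then have "lie_deriv A (p + q - 1) (schouten A p q X Y) \<Theta> = int_prod N \<Theta>" by blast
  then show ?thesis
    using N schouten_mvfield[OF pq(1) X(1) Y(1)] pq unfolding infinitesimal_conformal_def by auto
qed

end

theorem theorem2p4:
  fixes A :: "('m::{t2_space,second_countable_topology}, 'e::real_inner) chart set"
    and n p q :: nat
    and \<Theta> \<alpha> \<beta> :: "('m, 'e) form"
    and X\<^sub>\<alpha> V\<^sub>\<alpha> X\<^sub>\<beta> V\<^sub>\<beta> :: "('m, 'e) mvfield"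
  assumes "smooth_manifold A"
    and "\<Theta> \<in> forms A (int n)"
    and "1 \<le> p" "p \<le> n" "1 \<le> q" "q \<le> n"
    and "conformal_hamiltonian A n \<Theta> p \<alpha>"
    and "conformal_hamiltonian A n \<Theta> q \<beta>"
    and "conformal_pair A \<Theta> p \<alpha> X\<^sub>\<alpha> V\<^sub>\<alpha>"
    and "conformal_pair A \<Theta> q \<beta> X\<^sub>\<beta> V\<^sub>\<beta>"
  shows "(\<forall>X\<^sub>\<alpha>' V\<^sub>\<alpha>' X\<^sub>\<beta>' V\<^sub>\<beta>'.
            conformal_pair A \<Theta> p \<alpha> X\<^sub>\<alpha>' V\<^sub>\<alpha>' \<and> conformal_pair A \<Theta> q \<beta> X\<^sub>\<beta>' V\<^sub>\<beta>' \<longrightarrow>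
            - int_prod (schouten A p q X\<^sub>\<alpha>' X\<^sub>\<beta>') \<Theta> = - int_prod (schouten A p q X\<^sub>\<alpha> X\<^sub>\<beta>) \<Theta>) \<and>
         conformal_hamiltonian A n \<Theta> (p + q - 1) (- int_prod (schouten A p q X\<^sub>\<alpha> X\<^sub>\<beta>) \<Theta>)"
proof -
  interpret manifold A by unfold_locales (rule assms(1))
  note \<Theta> = assms(2) and pq = assms(3,5) and pairs = assms(9,10)
  have \<alpha>: "\<alpha> \<in> forms A (int n - int p)" and \<beta>: "\<beta> \<in> forms A (int n - int q)"
    using assms(7,8) by (auto simp: conformal_hamiltonian_def)
  have m: "X\<^sub>\<alpha> \<in> mvfields A p" "V\<^sub>\<alpha> \<in> mvfields A (p - 1)" "X\<^sub>\<beta> \<in> mvfields A q" "V\<^sub>\<beta> \<in> mvfields A (q - 1)"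
    using pairs by (auto simp: conformal_pair_def)
  let ?W = "schouten A p q X\<^sub>\<alpha> X\<^sub>\<beta>"
  have "infinitesimal_conformal A \<Theta> (p + q - 1) ?W"
    by (rule schouten_infinitesimal_conformal[OF \<Theta> pq m(1,2) _ m(3,4)])
       (rule conformal_pair_lie_deriv[OF \<alpha> pairs(1)] conformal_pair_lie_deriv[OF \<beta> pairs(2)])+
  moreover have "- int_prod ?W \<Theta> \<in> forms A (int n - int (p + q - 1))"
    by (intro uminus_form int_prod_form[OF schouten_mvfield[OF pq(1) m(1,3)] \<Theta>])
  ultimately have "conformal_hamiltonian A n \<Theta> (p + q - 1) (- int_prod ?W \<Theta>)"
    unfolding conformal_hamiltonian_def by (metis minus_minus)
  moreover have "int_prod (schouten A p q X Y) \<Theta> = int_prod ?W \<Theta>"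
    if "conformal_pair A \<Theta> p \<alpha> X V" "conformal_pair A \<Theta> q \<beta> Y Z" for X V Y Z
    by (rule bracket_independent[OF \<Theta> \<alpha> \<beta> pq pairs(1) that(1) pairs(2) that(2)])
  ultimately show ?thesis by metis
qed

end
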